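(* Let $\Theta$ be a compact metric space, $T:\Theta\to\Theta$ a homeomorphism, and $\mu$ a $T$-ergodic Borel probability measure on $\Theta$. Let $m\ge1$, $C\in\mathrm{GL}(m,\mathbb{C})$, let $f_0$ be a continuous map from $\Theta$ to the set of $m\times m$ Hermitian complex matrices, and let $H_\theta$ be the operator on $\ell^2(\mathbb{Z},\mathbb{C}^m)$ given by $$(H_\theta \mathbf{u})_n=C^*\mathbf{u}_{n-1}+f_0(T^n\theta)\mathbf{u}_n+C\mathbf{u}_{n+1}.$$ Let $\mathcal{N}(E)$ be the integrated density of states of the family $\{H_\theta\}$, and let $\operatorname{rot}_f(E)$ be the fibered rotation function of the associated Schrödinger cocycle family $(T,A_E)$, $E\in\mathbb{R}$. Then $$m\bigl(1-\mathcal{N}(E)\bigr)=\operatorname{rot}_f(E)\mod \mu(C(\Theta,\mathbb{Z})),$$ where the modulo means that different choices of the fibered rotation function may differ by an element of $\mu(C(\Theta,\mathbb{Z}))$.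
   Context: Integrated density of states: with $\delta_{0,i}\in\ell^2(\mathbb{Z},\mathbb{C}^m)$ equal to the standard basis vector $\mathbf{e}_i$ at $0$ and zero elsewhere, let $k$ be the measure with $\int g\,dk=\int_\Theta\frac1m\sum_{i=1}^m\langle\delta_{0,i},g(H_\theta)\delta_{0,i}\rangle\,d\mu(\theta)$ for bounded measurable $g$; $\mathcal{N}(E)=k((-\infty,E])$. $C(\Theta,\mathbb{Z})$ is the set of continuous integer-valued functions and $\mu(C(\Theta,\mathbb{Z}))=\{\int p\,d\mu: p\in C(\Theta,\mathbb{Z})\}$. Hermitian symplectic cocycles: $J=\begin{pmatrix}0&I_m\\ -I_m&0\end{pmatrix}$, $\mathrm{HSp}(2m,\mathbb{C})=\{M\in\mathrm{GL}(2m,\mathbb{C}):M^*JM=J\}$. A Lagrangian subspace $\Lambda$ of $\mathbb{C}^{2m}$ is the column span of a rank-$m$ matrix $\begin{pmatrix}X\\ Y\end{pmatrix}$ with $X,Y\in\mathbb{C}^{m\times m}$, $X^*Y=Y^*X$; put $W_\Lambda=(X+iY)(X-iY)^{-1}\in\mathbf{U}(m)$. This is independent of the frame, and $\Lambda\mapsto W_\Lambda$ is a bijection (homeomorphism) from the Lagrangian Grassmannian onto $\mathbf{U}(m)$. A continuous $A:\Theta\to\mathrm{HSp}(2m,\mathbb{C})$ defines the map $(T,A):\Theta\times\mathbf{U}(m)\to\Theta\times\mathbf{U}(m)$, $(\theta,W_\Lambda)\mapsto(T\theta,W_{A(\theta)\Lambda})$. $A$ is homotopic to the identity if there is a continuous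 $H:[0,1]\times\Theta\to\mathrm{HSp}(2m,\mathbb{C})$ with $H(0,\cdot)=A$ and $H(1,\cdot)=I_{2m}$. Fibered rotation number: let $q:\Theta\times\mathbb{R}\times\mathbf{SU}(m)\to\Theta\times\mathbf{U}(m)$, $q(\theta,x,S)=(\theta,e^{2\pi ix}S)$. If $A$ is homotopic to the identity, there is a continuous lift $\tilde F$ of $(T,A)$, i.e. a continuous self-map of $\Theta\times\mathbb{R}\times\mathbf{SU}(m)$ with $q\circ\tilde F=(T,A)\circ q$. With $p_2$ the projection on the $\mathbb{R}$ factor, $f(\theta,e^{2\pi ix}S):=m\,(p_2\tilde F(\theta,x,S)-x)$ is a well-defined continuous function on $\Theta\times\mathbf{U}(m)$, and $\lim_{n\to\infty}\frac1n\sum_{k=0}^{n-1}f((T,A)^k(\theta,W))$ exists for $\mu$-a.e. $\theta$ and all $W\in\mathbf{U}(m)$ and equals a constant. Its class modulo $\mu(C(\Theta,\mathbb{Z}))$, which does not depend on the lift, is the fibered rotation number $\operatorname{rot}_f(T,A)$. Schrödinger cocycle: $A_E(\theta)=\begin{pmatrix}(E-f_0(\theta))C^{-1}&-C^*\\ C^{-1}&0\end{pmatrix}\in\mathrm{HSp}(2m,\mathbb{C})$, $E\in\mathbb{R}$; it is homotopic to the identity. The fibered rotation function $\operatorname{rot}_f(E)$ of the family is a continuous branch of $E\mapsto\operatorname{rot}_f(T,A_E)$, i.e. a continuous function $\mathbb{R}\to\mathbb{R}$ whose value at each $E$ represents the class $\operatorname{rot}_f(T,A_E)$. *)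

theory Defs
  imports "HOL-Probability.Probability"
begin

section \<open>Complex matrices\<close>

definition adjoint_mat :: "complex^'n^'k \<Rightarrow> complex^'k^'n" where
  "adjoint_mat A = (\<chi> i j. cnj (A $ j $ i))"

definition hermitian :: "complex^'n^'n \<Rightarrow> bool" where
  "hermitian A \<longleftrightarrow> adjoint_mat A = A"

definition unitary_group :: "(complex^'n^'n) set" where
  "unitary_group = {U. adjoint_mat U ** U = mat 1}"

definition special_unitary_group :: "(complex^'n^'n) set" where
  "special_unitary_group = {U \<in> unitary_group. det U = 1}"

abbreviation scale_mat :: "complex \<Rightarrow> complex^'n^'k \<Rightarrow> complex^'n^'k" where
  "scale_mat c A \<equiv> map_matrix ((*) c) A"

text \<open>Matrices of size \<open>2m\<close> are indexed by the sum type \<open>'m + 'm\<close>, the constructor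
  \<open>Inl\<close> being the first block.\<close>

definition block_mat ::
  "'a^'m^'m \<Rightarrow> 'a^'m^'m \<Rightarrow> 'a^'m^'m \<Rightarrow> 'a^'m^'m \<Rightarrow> 'a^('m::finite + 'm)^('m::finite + 'm)" where
  "block_mat P Q R S = (\<chi> i j. case i of
      Inl a \<Rightarrow> (case j of Inl b \<Rightarrow> P $ a $ b | Inr b \<Rightarrow> Q $ a $ b)
    | Inr a \<Rightarrow> (case j of Inl b \<Rightarrow> R $ a $ b | Inr b \<Rightarrow> S $ a $ b))"

definition stack_mat :: "'a^'m^'m \<Rightarrow> 'a^'m^'m \<Rightarrow> 'a^'m^('m::finite + 'm)" where
  "stack_mat X Y = (\<chi> i j. case i of Inl a \<Rightarrow> X $ a $ j | Inr a \<Rightarrow> Y $ a $ j)"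


section \<open>Ergodic measures\<close>

definition ergodic_measure :: "('t::topological_space \<Rightarrow> 't) \<Rightarrow> 't measure \<Rightarrow> bool" where
  "ergodic_measure T M \<longleftrightarrow>
     prob_space M \<and> sets M = sets borel \<and> T \<in> measurable M M \<and> distr M M T = M \<and>
     (\<forall>A\<in>sets M. T -` A = A \<longrightarrow> measure M A = 0 \<or> measure M A = 1)"

text \<open>The group \<open>\<mu>(C(\<Theta>, \<int>))\<close>; the type \<^typ>\<open>int\<close> carries the discrete topology.\<close>

definition integer_integrals :: "'t::topological_space measure \<Rightarrow> real set" where
  "integer_integrals M =
     {\<integral>\<theta>. real_of_int (p \<theta>) \<partial>M | p :: 't \<Rightarrow> int. continuous_on UNIV p}"

definition int_iterate :: "('t \<Rightarrow> 't) \<Rightarrow> int \<Rightarrow> 't \<Rightarrow> 't" where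
  "int_iterate T n = (if 0 \<le> n then T ^^ nat n else inv T ^^ nat (- n))"


section \<open>Operators on \<open>\<ell>\<^sup>2(\<int>, \<complex>\<^sup>m)\<close>\<close>

text \<open>Operators are total functions on sequences, but only their restriction to \<open>ell2\<close> matters.\<close>

definition ell2 :: "(int \<Rightarrow> complex^'m) set" where
  "ell2 = {u. (\<lambda>n. (norm (u n))\<^sup>2) summable_on UNIV}"

definition ell2_inner :: "(int \<Rightarrow> complex^'m) \<Rightarrow> (int \<Rightarrow> complex^'m) \<Rightarrow> complex" where
  "ell2_inner u v = (\<Sum>\<^sub>\<infinity>n. \<Sum>i\<in>UNIV. cnj (u n $ i) * v n $ i)"

definition ell2_norm :: "(int \<Rightarrow> complex^'m) \<Rightarrow> real" where
  "ell2_norm u = sqrt (\<Sum>\<^sub>\<infinity>n. (norm (u n))\<^sup>2)"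

definition delta0 :: "'m \<Rightarrow> int \<Rightarrow> complex^'m" where
  "delta0 i n = (if n = 0 then axis i 1 else 0)"

definition bounded_operator :: "((int \<Rightarrow> complex^'m) \<Rightarrow> (int \<Rightarrow> complex^'m)) \<Rightarrow> bool" where
  "bounded_operator L \<longleftrightarrow>
     (\<forall>u\<in>ell2. L u \<in> ell2) \<and>
     (\<forall>u\<in>ell2. \<forall>v\<in>ell2. \<forall>a. L (\<lambda>n. a *s u n + v n) = (\<lambda>n. a *s L u n + L v n)) \<and>
     (\<exists>K. \<forall>u\<in>ell2. ell2_norm (L u) \<le> K * ell2_norm u)"

definition bounded_borel :: "(real \<Rightarrow> complex) set" where
  "bounded_borel = {g. g \<in> borel_measurable borel \<and> bounded (range g)}"

text \<open>\<open>\<Phi> g\<close> is \<open>g(H)\<close>: the bounded Borel functional calculus of a self-adjoint operator \<open>H\<close> is the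
  unique *-homomorphism on the bounded Borel functions that is continuous with respect to bounded
  pointwise convergence and sends the identity function to \<open>H\<close>. As the identity is unbounded on
  the real line, the last condition is stated through its truncations.\<close>

definition borel_functional_calculus ::
  "((int \<Rightarrow> complex^'m) \<Rightarrow> (int \<Rightarrow> complex^'m)) \<Rightarrow>
   ((real \<Rightarrow> complex) \<Rightarrow> (int \<Rightarrow> complex^'m) \<Rightarrow> (int \<Rightarrow> complex^'m)) \<Rightarrow> bool" where
  "borel_functional_calculus H \<Phi> \<longleftrightarrow>
     (\<forall>g\<in>bounded_borel. bounded_operator (\<Phi> g)) \<and>
     (\<forall>g\<in>bounded_borel. \<forall>h\<in>bounded_borel. \<forall>a. \<forall>u\<in>ell2.
        \<Phi> (\<lambda>x. a * g x + h x) u = (\<lambda>n. a *s \<Phi> g u n + \<Phi> h u n)) \<and>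
     (\<forall>g\<in>bounded_borel. \<forall>h\<in>bounded_borel. \<forall>u\<in>ell2. \<Phi> (\<lambda>x. g x * h x) u = \<Phi> g (\<Phi> h u)) \<and>
     (\<forall>u\<in>ell2. \<Phi> (\<lambda>x. 1) u = u) \<and>
     (\<forall>g\<in>bounded_borel. \<forall>u\<in>ell2. \<forall>v\<in>ell2.
        ell2_inner (\<Phi> g u) v = ell2_inner u (\<Phi> (\<lambda>x. cnj (g x)) v)) \<and>
     (\<forall>G g. (\<forall>n. G n \<in> bounded_borel) \<and> g \<in> bounded_borel \<and>
        (\<exists>K. \<forall>n x. norm (G n x) \<le> K) \<and> (\<forall>x. (\<lambda>n::nat. G n x) \<longlonglongrightarrow> g x) \<longrightarrow>
        (\<forall>u\<in>ell2. (\<lambda>n. ell2_norm (\<lambda>j. \<Phi> (G n) u j - \<Phi> g u j)) \<longlonglongrightarrow> 0)) \<and>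
     (\<forall>u\<in>ell2. (\<lambda>n::nat. ell2_norm
        (\<lambda>j. \<Phi> (\<lambda>x. if \<bar>x\<bar> \<le> real n then complex_of_real x else 0) u j - H u j)) \<longlonglongrightarrow> 0)"

definition schrodinger_operator ::
  "('t \<Rightarrow> 't) \<Rightarrow> complex^'m^'m \<Rightarrow> ('t \<Rightarrow> complex^'m^'m) \<Rightarrow> 't \<Rightarrow>
   (int \<Rightarrow> complex^'m) \<Rightarrow> (int \<Rightarrow> complex^'m)" where
  "schrodinger_operator T C f0 \<theta> u =
     (\<lambda>n. adjoint_mat C *v u (n - 1) + f0 (int_iterate T n \<theta>) *v u n + C *v u (n + 1))"

text \<open>\<open>k\<close> is the density of states measure of the family \<open>H\<close>; the integrated density of
  states at \<open>E\<close> is then \<open>measure k {..E}\<close>. The function \<open>g = 1\<close> shows that \<open>k\<close> is a probability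
  measure.\<close>

definition density_of_states ::
  "'t measure \<Rightarrow> ('t \<Rightarrow> (int \<Rightarrow> complex^'m) \<Rightarrow> (int \<Rightarrow> complex^'m)) \<Rightarrow> real measure \<Rightarrow> bool" where
  "density_of_states M H k \<longleftrightarrow> sets k = sets borel \<and>
     (\<exists>\<Phi>. (\<forall>\<theta>. borel_functional_calculus (H \<theta>) (\<Phi> \<theta>)) \<and>
        (\<forall>g\<in>bounded_borel. (\<integral>x. g x \<partial>k) =
           (\<integral>\<theta>. (1 / of_nat CARD('m)) *
              (\<Sum>i\<in>UNIV. ell2_inner (delta0 i) (\<Phi> \<theta> g (delta0 i))) \<partial>M)))"


section \<open>Hermitian symplectic cocycles\<close>

definition symplectic_J :: "complex^('m::finite + 'm)^('m::finite + 'm)" where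
  "symplectic_J = block_mat 0 (mat 1) (- mat 1) 0"

definition hermitian_symplectic :: "(complex^('m::finite + 'm)^('m::finite + 'm)) set" where
  "hermitian_symplectic =
     {A. invertible A \<and> adjoint_mat A ** symplectic_J ** A = symplectic_J}"

definition lagrangian_frame ::
  "complex^'m^'m \<Rightarrow> complex^'m^'m \<Rightarrow> (complex^('m::finite + 'm)) set \<Rightarrow> bool" where
  "lagrangian_frame X Y \<Lambda> \<longleftrightarrow>
     rank (stack_mat X Y) = CARD('m) \<and> adjoint_mat X ** Y = adjoint_mat Y ** X \<and>
     \<Lambda> = vec.span (columns (stack_mat X Y))"

definition lagrangian_grassmannian :: "(complex^('m::finite + 'm)) set set" where
  "lagrangian_grassmannian = {\<Lambda>. \<exists>X Y. lagrangian_frame X Y \<Lambda>}"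

text \<open>\<open>W\<^sub>\<Lambda>\<close>, which does not depend on the frame of \<open>\<Lambda>\<close>.\<close>

definition lagrangian_unitary :: "(complex^('m::finite + 'm)) set \<Rightarrow> complex^'m^'m" where
  "lagrangian_unitary \<Lambda> =
     (THE W. \<exists>X Y. lagrangian_frame X Y \<Lambda> \<and>
        W = (X + scale_mat \<i> Y) ** matrix_inv (X - scale_mat \<i> Y))"

text \<open>As \<open>\<Lambda> \<mapsto> W\<^sub>\<Lambda>\<close> is a bijection onto the unitary group, \<open>W\<close> there determines \<open>\<Lambda>\<close>.\<close>

definition symplectic_action ::
  "complex^('m::finite + 'm)^('m::finite + 'm) \<Rightarrow> complex^'m^'m \<Rightarrow> complex^'m^'m" where
  "symplectic_action A W =
     lagrangian_unitary ((*v) A ` inv_into lagrangian_grassmannian lagrangian_unitary W)"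

definition cocycle_map ::
  "('t \<Rightarrow> 't) \<Rightarrow> ('t \<Rightarrow> complex^('m::finite + 'm)^('m::finite + 'm)) \<Rightarrow>
   't \<times> (complex^'m^'m) \<Rightarrow> 't \<times> (complex^'m^'m)" where
  "cocycle_map T A = (\<lambda>(\<theta>, W). (T \<theta>, symplectic_action (A \<theta>) W))"

definition covering_q :: "'t \<times> real \<times> (complex^'m^'m) \<Rightarrow> 't \<times> (complex^'m^'m)" where
  "covering_q = (\<lambda>(\<theta>, x, S). (\<theta>, scale_mat (exp (2 * pi * \<i> * complex_of_real x)) S))"

definition cocycle_lift ::
  "('t::topological_space \<Rightarrow> 't) \<Rightarrow> ('t \<Rightarrow> complex^('m::finite + 'm)^('m::finite + 'm)) \<Rightarrow>
   ('t \<times> real \<times> (complex^'m^'m) \<Rightarrow> 't \<times> real \<times> (complex^'m^'m)) \<Rightarrow> bool" where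
  "cocycle_lift T A F \<longleftrightarrow>
     (let D = UNIV \<times> UNIV \<times> special_unitary_group in
       continuous_on D F \<and> F ` D \<subseteq> D \<and>
       (\<forall>z\<in>D. covering_q (F z) = cocycle_map T A (covering_q z)))"

text \<open>The fibered rotation number as a class of real numbers modulo \<^const>\<open>integer_integrals\<close>.
  The function \<open>f\<close> is determined by the lift \<open>F\<close> on \<open>\<Theta> \<times> U(m)\<close> and is irrelevant elsewhere.
  A cocycle homotopic to the identity has a lift, and all lifts give the same class; the set is
  empty for a cocycle without a lift.\<close>

definition fibered_rotation_number ::
  "('t::topological_space) measure \<Rightarrow> ('t \<Rightarrow> 't) \<Rightarrow>
   ('t \<Rightarrow> complex^('m::finite + 'm)^('m::finite + 'm)) \<Rightarrow> real set" where
  "fibered_rotation_number M T A =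
     {r. \<exists>F f r0. cocycle_lift T A F \<and>
        (\<forall>\<theta> x. \<forall>S\<in>special_unitary_group.
           f (covering_q (\<theta>, x, S)) = real CARD('m) * (fst (snd (F (\<theta>, x, S))) - x)) \<and>
        (AE \<theta> in M. \<forall>W\<in>unitary_group.
           (\<lambda>n. (\<Sum>j<n. f ((cocycle_map T A ^^ j) (\<theta>, W))) / real n) \<longlonglongrightarrow> r0) \<and>
        r - r0 \<in> integer_integrals M}"

definition fibered_rotation_function ::
  "('t::topological_space) measure \<Rightarrow> ('t \<Rightarrow> 't) \<Rightarrow>
   (real \<Rightarrow> 't \<Rightarrow> complex^('m::finite + 'm)^('m::finite + 'm)) \<Rightarrow> (real \<Rightarrow> real) \<Rightarrow> bool" where
  "fibered_rotation_function M T A rot \<longleftrightarrow>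
     continuous_on UNIV rot \<and> (\<forall>E. rot E \<in> fibered_rotation_number M T (A E))"

definition schrodinger_cocycle ::
  "complex^'m^'m \<Rightarrow> ('t \<Rightarrow> complex^'m^'m) \<Rightarrow> real \<Rightarrow> 't \<Rightarrow> complex^('m::finite + 'm)^('m::finite + 'm)" where
  "schrodinger_cocycle C f0 E \<theta> =
     block_mat ((mat (complex_of_real E) - f0 \<theta>) ** matrix_inv C) (- adjoint_mat C)
       (matrix_inv C) 0"

end

theory Submission
  imports Defs "HOL-Computational_Algebra.Fundamental_Theorem_Algebra"
begin

text \<open>Both sides of the identity are rates of growth of a phase, and they can be compared at complex energies first.
  For \<open>z = E + i s\<close> with \<open>s > 0\<close> put \<open>L 0 = z - f0 \<theta>\<close> and
  \<open>L (j+1) = z - f0 (T^(j+1) \<theta>) - C* (L j)^(-1) C\<close>. All \<open>L j\<close> lie in the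
  convex set of matrices with positive imaginary part, where \<open>det\<close> has a continuous logarithm
  \<open>logdet\<close> with bounded imaginary part. The product of \<open>det (L j)\<close>,
  \<open>j < n\<close>, is the determinant of \<open>z - H\<close> on a box of length \<open>n\<close>, so its
  phase is the sum of \<open>arg (z - \<lambda>)\<close> over the eigenvalues \<open>\<lambda>\<close> of the
  box, which should be \<open>n m \<integral> arg (z - x) dk(x)\<close> up to boundary terms. The proof works
  with derivatives in \<open>s\<close>: the derivative of the phase is a sum of traces of diagonal entries of
  the Green function of the box (\<open>phase_sum_has_derivative\<close>), these are close to the entries of
  the resolvent away from the ends (\<open>box_green_approx\<close>), and the average of the latter is the
  derivative of the integral against \<open>k\<close> (\<open>mean_arg_derivative\<close>). Both sides tend to
  \<open>m pi/2\<close> per site for large \<open>s\<close>, which gives \<open>mean_rotation_limit\<close>.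

  Convergence at each \<open>z\<close> is not enough, because the rotation number lives on the real axis. The
  phase is additive along the orbit up to the constant \<open>4 pi m\<close>: it depends on the initial matrix
  of the recursion only through the difference of two bounded phases (\<open>phase_sum_indep\<close>, by a
  Schur complement identity). Hence the mean of the phase of length \<open>n\<close> differs from
  \<open>n\<close> times its rate by at most \<open>4 pi m\<close>, uniformly in \<open>z\<close>
  (\<open>mean_rotation_rate\<close>).

  The Cayley transform maps the matrices \<open>L j\<close> to contractions and the recursion to a Moebius
  action on the closed ball of contractions, which for real \<open>z\<close> maps the unitary group to itself
  and is, after taking adjoints, the action of the Schroedinger cocycle on \<open>U(m)\<close>
  (\<open>schrodinger_action\<close>). On the closed ball, for \<open>Im z \<ge> 0\<close>, the denominator of
  the Moebius map stays invertible, so that its determinant has a logarithm \<open>lift_log\<close> that is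
  continuous down to the real axis. Above the real axis the sums of \<open>Im lift_log\<close> along an orbit
  are the phases above up to a bounded error (\<open>lift_sum_close\<close>). On the real axis one step
  multiplies \<open>det W\<close> by \<open>exp (2 i Im lift_log)\<close>
  (\<open>det_moebius_unitary\<close>). Since \<open>U(m)\<close> is connected by paths, it follows that for
  every lift of the cocycle the function \<open>f\<close>, which is \<open>m\<close> times the displacement,
  is \<open>Im lift_log / pi\<close> plus a continuous integer function of \<open>\<theta>\<close>
  (\<open>lift_decomposition\<close>).

  Letting \<open>s\<close> tend to \<open>0\<close>, the argument of \<open>E + i s - x\<close> tends to
  \<open>0\<close>, \<open>pi/2\<close> or \<open>pi\<close> for \<open>x < E\<close>, \<open>x = E\<close> or
  \<open>x > E\<close>. So the averaged lift of length \<open>n\<close> is \<open>n pi rho(E)\<close> up to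
  \<open>8 pi m\<close>, where \<open>rho(E) = m (k(E,\<infinity>) + k{E}/2)\<close>. As the averaged lift is
  continuous in \<open>E\<close>, this uniform estimate makes \<open>rho\<close> continuous. So
  \<open>k\<close> has no atoms (\<open>no_atoms\<close>) and \<open>rho(E) = m (1 - N(E))\<close>. By
  \<open>rotation_number_mean_lift\<close> the continuous function \<open>rho - rot\<close> takes values in
  \<open>\<mu>(C(\<Theta>,\<int>))\<close>, which is countable, and is therefore constant.\<close>

section \<open>Complex matrices and the real inner product\<close>

lemma matrix_vector_mul_uminus: "(- A) *v v = - (A *v (v::'a::ring_1^'n))"
  by (simp add: matrix_vector_mult_def vec_eq_iff sum_negf)

lemma mat_vector_mult: "mat c *v v = c *s (v::'a::semiring_1^'n)"
  by (simp add: mat_def matrix_vector_mult_def vec_eq_iff if_distrib[of "\<lambda>x. x * _"] cong: if_cong)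

lemma matrix_mult_uminus_left: "(- A) ** B = - (A ** (B::'a::ring_1^'n^'k))"
  by (simp add: matrix_matrix_mult_def vec_eq_iff sum_negf)

lemma matrix_mult_uminus_right: "A ** (- B) = - (A ** (B::'a::ring_1^'n^'k))"
  by (simp add: matrix_matrix_mult_def vec_eq_iff sum_negf)

lemma matrix_diff_ldistrib: "A ** (B - C) = A ** B - A ** (C::'a::ring_1^'n^'k)"
  by (simp add: matrix_matrix_mult_def vec_eq_iff sum_subtractf algebra_simps)

lemma matrix_diff_rdistrib: "(A - B) ** C = A ** C - B ** (C::'a::ring_1^'n^'k)"
  by (simp add: matrix_matrix_mult_def vec_eq_iff sum_subtractf algebra_simps)

lemma matrix_mult_add_left: "(A + B) ** C = A ** C + B ** (C::'a::ring_1^'n^'k)"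
  by (simp add: matrix_matrix_mult_def vec_eq_iff sum.distrib algebra_simps)

lemma matrix_scaleR_left: "(r *\<^sub>R A) ** B = r *\<^sub>R (A ** (B::complex^'n^'k))"
  by (simp add: matrix_matrix_mult_def vec_eq_iff scaleR_sum_right)

lemma matrix_scaleR_right: "A ** (r *\<^sub>R B) = r *\<^sub>R (A ** (B::complex^'n^'k))"
  by (simp add: matrix_matrix_mult_def vec_eq_iff scaleR_sum_right)

lemma matrix_vector_scaleR_left: "(r *\<^sub>R A) *v v = r *\<^sub>R (A *v (v::complex^'n))"
  by (simp add: matrix_vector_mult_def vec_eq_iff scaleR_sum_right)

lemma mat_mult_component: "(mat c ** A) $ i $ j = c * (A $ i $ j::'a::semiring_1)"
  by (simp add: mat_def matrix_matrix_mult_def if_distrib[of "\<lambda>x. x * _"] cong: if_cong)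

lemma mult_mat_component: "(A ** mat c) $ i $ j = (A $ i $ j::'a::semiring_1) * c"
  by (simp add: mat_def matrix_matrix_mult_def if_distrib[of "\<lambda>x. _ * x"] cong: if_cong)

lemma mult_mat_commute: "(A::'a::comm_semiring_1^'n^'n) ** mat c = mat c ** A"
  by (simp add: vec_eq_iff mat_mult_component mult_mat_component mult.commute)

lemma scale_mat_eq_mult: "scale_mat c A = mat c ** A"
  by (simp add: vec_eq_iff mat_mult_component)

lemma det_mat: "det (mat c :: 'a::comm_ring_1^'n^'n) = c ^ CARD('n)"
proof -
  have "(mat c :: 'a^'n^'n) = (\<chi> i. c *s (mat 1 :: 'a^'n^'n) $ i)" by (simp add: vec_eq_iff mat_def)
  thus ?thesis by (simp add: det_rows_mul)
qed

lemma matrix_inv_left_right: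
  fixes A :: "'a::semiring_1^'n^'m"
  assumes "invertible A" shows "A ** matrix_inv A = mat 1" "matrix_inv A ** A = mat 1"
proof -
  have "A ** matrix_inv A = mat 1 \<and> matrix_inv A ** A = mat 1"
    unfolding matrix_inv_def using assms unfolding invertible_def by (rule someI_ex)
  thus "A ** matrix_inv A = mat 1" "matrix_inv A ** A = mat 1" by auto
qed

lemma matrix_inv_cancel:
  fixes A :: "'a::semiring_1^'n^'m"
  assumes "invertible A"
  shows "A *v (matrix_inv A *v v) = v" "matrix_inv A *v (A *v w) = w"
  using matrix_inv_left_right[OF assms] by (simp_all add: matrix_vector_mul_assoc)

lemma matrix_inv_cancel_mult:
  fixes A :: "'a::semiring_1^'n^'m"
  assumes "invertible A"
  shows "A ** (matrix_inv A ** B) = B" "matrix_inv A ** (A ** D) = D"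
  using matrix_inv_left_right[OF assms] by (simp_all add: matrix_mul_assoc)

lemma matrix_inv_eqI:
  fixes A :: "'a::field^'n^'n"
  assumes "A ** B = mat 1" shows "matrix_inv A = B" "invertible A"
proof -
  show i: "invertible A" using assms invertible_right_inverse by blast
  have "matrix_inv A ** (A ** B) = matrix_inv A" by (simp add: assms)
  thus "matrix_inv A = B" using matrix_inv_cancel_mult(2)[OF i] by metis
qed

lemma invertible_matrix_inv: "invertible A \<Longrightarrow> invertible (matrix_inv (A::'a::semiring_1^'n^'m))"
  unfolding invertible_def[of "matrix_inv A"] using matrix_inv_left_right by blast

lemma det_matrix_inv:
  assumes "invertible (A::'a::field^'n^'n)" shows "det (matrix_inv A) = inverse (det A)"
proof -
  have "det A * det (matrix_inv A) = 1" using matrix_inv_left_right[OF assms] by (metis det_I det_mul)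
  thus ?thesis by (metis inverse_unique)
qed

lemma matrix_inv_mult:
  fixes A B :: "'a::field^'n^'n"
  assumes "invertible A" "invertible B"
  shows "matrix_inv (A ** B) = matrix_inv B ** matrix_inv A"
proof (rule matrix_inv_eqI)
  have "(A ** B) ** (matrix_inv B ** matrix_inv A) = A ** (B ** (matrix_inv B ** matrix_inv A))"
    by (simp add: matrix_mul_assoc)
  also have "\<dots> = mat 1" using assms by (simp add: matrix_inv_cancel_mult matrix_inv_left_right)
  finally show "(A ** B) ** (matrix_inv B ** matrix_inv A) = mat 1" .
qed

lemma invertible_injI:
  fixes A :: "'a::field^'n^'n"
  assumes "\<And>v. A *v v = 0 \<Longrightarrow> v = 0" shows "invertible A"
proof -
  have "\<exists>B. B ** A = mat 1" using matrix_left_invertible_ker[of A] assms by blast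
  thus ?thesis using invertible_left_inverse by blast
qed

lemma tendsto_matrix_mult [tendsto_intros]:
  fixes f :: "'b \<Rightarrow> complex^'n^'m"
  assumes "(f \<longlongrightarrow> a) F" "(g \<longlongrightarrow> b) F"
  shows "((\<lambda>x. f x ** g x) \<longlongrightarrow> a ** b) F"
  unfolding matrix_matrix_mult_def using assms by (intro tendsto_intros)

lemma tendsto_det [tendsto_intros]:
  fixes f :: "'b \<Rightarrow> complex^'n^'n"
  assumes "(f \<longlongrightarrow> a) F" shows "((\<lambda>x. det (f x)) \<longlongrightarrow> det a) F"
  unfolding det_def using assms by (intro tendsto_intros)

lemma tendsto_mat [tendsto_intros]:
  fixes f :: "'b \<Rightarrow> complex"
  assumes "(f \<longlongrightarrow> a) F" shows "((\<lambda>x. mat (f x) :: complex^'n^'n) \<longlongrightarrow> mat a) F"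
  unfolding mat_def
proof (intro tendsto_vec_lambda)
  fix i j :: 'n
  show "((\<lambda>x. if i = j then f x else 0) \<longlongrightarrow> (if i = j then a else 0)) F"
    using assms by (cases "i = j") auto
qed

lemma tendsto_adjoint_mat [tendsto_intros]:
  assumes "(f \<longlongrightarrow> a) F" shows "((\<lambda>x. adjoint_mat (f x)) \<longlongrightarrow> adjoint_mat a) F"
  unfolding adjoint_mat_def using assms by (intro tendsto_intros)

lemma tendsto_trace [tendsto_intros]:
  fixes f :: "'b \<Rightarrow> complex^'n^'n"
  assumes "(f \<longlongrightarrow> a) F" shows "((\<lambda>x. trace (f x)) \<longlongrightarrow> trace a) F"
  unfolding trace_def using assms by (intro tendsto_intros)

lemma matrix_vector_mult_axis: "(A *v axis k 1) $ i = (A $ i $ k :: 'a::semiring_1)"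
  by (simp add: matrix_vector_mult_def axis_def if_distrib[of "\<lambda>x. _ * x"] cong: if_cong)

lemma matrix_inv_component:
  fixes A :: "complex^'n^'n"
  assumes "invertible A"
  shows "matrix_inv A $ k $ l = det (\<chi> i j. if j = k then axis l 1 $ i else A $ i $ j) / det A"
proof -
  have d: "det A \<noteq> 0" using assms invertible_det_nz by blast
  have "A *v (matrix_inv A *v axis l 1) = axis l 1" by (rule matrix_inv_cancel[OF assms])
  from this[unfolded cramer[OF d]]
  have "(matrix_inv A *v axis l 1) $ k = det (\<chi> i j. if j = k then axis l 1 $ i else A $ i $ j) / det A"
    by (simp only: vec_lambda_beta)
  moreover have "(matrix_inv A *v axis l 1) $ k = matrix_inv A $ k $ l"
    by (rule matrix_vector_mult_axis)
  ultimately show ?thesis by simp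
qed

lemma tendsto_matrix_inv [tendsto_intros]:
  fixes f :: "'b \<Rightarrow> complex^'n^'n"
  assumes f: "(f \<longlongrightarrow> a) F" and a: "invertible a"
  shows "((\<lambda>x. matrix_inv (f x)) \<longlongrightarrow> matrix_inv a) F"
proof (intro vec_tendstoI)
  fix k l
  have d: "det a \<noteq> 0" using a invertible_det_nz by blast
  have 1: "((\<lambda>x. det (\<chi> i j. if j = k then axis l 1 $ i else f x $ i $ j) / det (f x)) \<longlongrightarrow>
     det (\<chi> i j. if j = k then axis l 1 $ i else a $ i $ j) / det a) F"
  proof (intro tendsto_divide tendsto_det tendsto_vec_lambda f d)
    fix i j
    show "((\<lambda>x. if j = k then axis l 1 $ i else f x $ i $ j) \<longlongrightarrow> (if j = k then axis l 1 $ i else a $ i $ j)) F"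
      using f by (cases "j = k") (simp_all add: tendsto_vec_nth)
  qed
  have "eventually (\<lambda>x. det (f x) \<noteq> 0) F"
    using tendsto_imp_eventually_ne[OF tendsto_det[OF f] d] .
  hence 2: "eventually (\<lambda>x. det (\<chi> i j. if j = k then axis l 1 $ i else f x $ i $ j) / det (f x)
      = matrix_inv (f x) $ k $ l) F"
    by eventually_elim (rule matrix_inv_component[symmetric], simp add: invertible_det_nz)
  show "((\<lambda>x. matrix_inv (f x) $ k $ l) \<longlongrightarrow> matrix_inv a $ k $ l) F"
    using Lim_transform_eventually[OF 1 2] by (simp add: matrix_inv_component[OF a])
qed

lemma continuous_on_matrix_mult [continuous_intros]:
  fixes f :: "'b::topological_space \<Rightarrow> complex^'n^'m"
  shows "continuous_on S f \<Longrightarrow> continuous_on S g \<Longrightarrow> continuous_on S (\<lambda>x. f x ** g x)"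
  unfolding continuous_on_def by (simp add: tendsto_matrix_mult)

lemma continuous_on_det [continuous_intros]:
  fixes f :: "'b::topological_space \<Rightarrow> complex^'n^'n"
  shows "continuous_on S f \<Longrightarrow> continuous_on S (\<lambda>x. det (f x))"
  unfolding continuous_on_def by (simp add: tendsto_det)

lemma continuous_on_trace [continuous_intros]:
  fixes f :: "'b::topological_space \<Rightarrow> complex^'n^'n"
  shows "continuous_on S f \<Longrightarrow> continuous_on S (\<lambda>x. trace (f x))"
  unfolding continuous_on_def by (simp add: tendsto_trace)

lemma continuous_on_mat [continuous_intros]:
  fixes f :: "'b::topological_space \<Rightarrow> complex"
  shows "continuous_on S f \<Longrightarrow> continuous_on S (\<lambda>x. mat (f x) :: complex^'n^'n)"
  unfolding continuous_on_def by (simp add: tendsto_mat)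

lemma continuous_on_adjoint_mat [continuous_intros]:
  fixes f :: "'b::topological_space \<Rightarrow> complex^'n^'m"
  shows "continuous_on S f \<Longrightarrow> continuous_on S (\<lambda>x. adjoint_mat (f x))"
  unfolding continuous_on_def by (simp add: tendsto_adjoint_mat)

lemma continuous_on_matrix_inv [continuous_intros]:
  fixes f :: "'b::topological_space \<Rightarrow> complex^'n^'n"
  shows "continuous_on S f \<Longrightarrow> (\<And>x. x \<in> S \<Longrightarrow> invertible (f x)) \<Longrightarrow> continuous_on S (\<lambda>x. matrix_inv (f x))"
  unfolding continuous_on_def by (simp add: tendsto_matrix_inv)

lemma adjoint_mat_mult: "adjoint_mat (A ** B) = adjoint_mat B ** adjoint_mat A"
  by (simp add: adjoint_mat_def matrix_matrix_mult_def vec_eq_iff mult.commute)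

lemma adjoint_mat_adjoint_mat [simp]: "adjoint_mat (adjoint_mat A) = A"
  by (simp add: adjoint_mat_def vec_eq_iff)

lemma adjoint_mat_add: "adjoint_mat (A + B) = adjoint_mat A + adjoint_mat B"
  by (simp add: adjoint_mat_def vec_eq_iff)

lemma adjoint_mat_diff: "adjoint_mat (A - B) = adjoint_mat A - adjoint_mat B"
  by (simp add: adjoint_mat_def vec_eq_iff)

lemma adjoint_mat_scaleR: "adjoint_mat (r *\<^sub>R A) = r *\<^sub>R adjoint_mat A"
  by (simp add: adjoint_mat_def vec_eq_iff)

lemma adjoint_mat_mat [simp]: "adjoint_mat (mat c) = mat (cnj c)"
  by (simp add: adjoint_mat_def vec_eq_iff mat_def)

lemma det_adjoint_mat: "det (adjoint_mat A) = cnj (det (A::complex^'n^'n))"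
proof -
  have "det (adjoint_mat A) = cnj (det (transpose A))"
    by (simp add: det_def adjoint_mat_def transpose_def cnj_sum cnj_prod)
  thus ?thesis by simp
qed

lemma invertible_adjoint_mat: "invertible (A::complex^'n^'n) \<Longrightarrow> invertible (adjoint_mat A)"
  by (simp add: invertible_det_nz det_adjoint_mat)

text \<open>Throughout, \<open>inner\<close> is the real inner product, the real part of the Hermitian one. The imaginary
  part of the form of \<open>B\<close> at \<open>v\<close> is then \<open>inner (\<i> *s v) (B *v v)\<close>.\<close>

lemma inner_adjoint_mat: "inner (A *v u) w = inner u (adjoint_mat A *v (w::complex^'k))"
proof -
  have "inner (A *v u) w = (\<Sum>i\<in>UNIV. \<Sum>j\<in>UNIV. inner (A $ i $ j * u $ j) (w $ i))"
    by (simp add: inner_vec_def matrix_vector_mult_def inner_sum_left)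
  also have "\<dots> = (\<Sum>j\<in>UNIV. \<Sum>i\<in>UNIV. inner (u $ j) (cnj (A $ i $ j) * w $ i))"
    by (subst sum.swap) (simp add: inner_complex_def algebra_simps)
  also have "\<dots> = inner u (adjoint_mat A *v w)"
    by (simp add: inner_vec_def matrix_vector_mult_def inner_sum_right adjoint_mat_def)
  finally show ?thesis .
qed

lemma inner_adjoint_mat_right: "inner u (A *v w) = inner (adjoint_mat A *v u) (w::complex^'k)"
  using inner_adjoint_mat[of "adjoint_mat A"] by simp

lemma norm_scalar_mult: "norm (c *s (v::complex^'n)) = cmod c * norm v"
  by (simp add: norm_vec_def norm_mult L2_set_right_distrib)

lemma inner_i_i [simp]: "inner (\<i> *s u) (\<i> *s v) = inner u (v::complex^'n)"
  by (simp add: inner_vec_def inner_complex_def add.commute)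

lemma inner_i_left: "inner (\<i> *s u) v = - inner u (\<i> *s (v::complex^'n))"
  by (simp add: inner_vec_def inner_complex_def sum_negf[symmetric])

lemma norm_i [simp]: "norm (\<i> *s (v::complex^'n)) = norm v"
  by (simp add: norm_scalar_mult)

lemma inner_i_scalar: "inner (\<i> *s v) (c *s v) = Im c * (norm (v::complex^'n))\<^sup>2"
proof -
  have "inner (\<i> *s v) (c *s v) = Im c * inner v v"
    by (simp add: inner_vec_def inner_complex_def sum_distrib_left algebra_simps)
  thus ?thesis by (simp add: power2_norm_eq_inner)
qed

lemma hermitian_inner: "hermitian B \<Longrightarrow> inner (\<i> *s v) (B *v v) = 0"
proof -
  assume "hermitian B"
  hence "inner (B *v (\<i> *s v)) v = inner (\<i> *s v) (B *v v)" by (simp add: inner_adjoint_mat hermitian_def)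
  moreover have "inner (B *v (\<i> *s v)) v = - inner (\<i> *s v) (B *v v)"
    by (simp only: vector_scalar_commute inner_i_left inner_commute[of "B *v v"])
  ultimately show ?thesis by simp
qed

lemma norm_matrix_vector_le:
  fixes A :: "complex^'n^'k"
  shows "norm (A *v v) \<le> real (CARD('k) * CARD('n)) * norm A * norm v"
proof -
  have "norm (A *v v) \<le> (\<Sum>i\<in>UNIV. norm ((A *v v) $ i))" unfolding norm_vec_def by (rule L2_set_le_sum) auto
  also have "\<dots> \<le> (\<Sum>i\<in>(UNIV::'k set). \<Sum>j\<in>(UNIV::'n set). norm A * norm v)"
  proof (rule sum_mono)
    fix i
    have "norm ((A *v v) $ i) \<le> (\<Sum>j\<in>UNIV. norm (A $ i $ j * v $ j))"
      by (simp add: matrix_vector_mult_def norm_sum)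
    also have "\<dots> \<le> (\<Sum>j\<in>(UNIV::'n set). norm A * norm v)"
    proof (rule sum_mono)
      fix j
      have "norm (A $ i $ j) \<le> norm A" by (meson Finite_Cartesian_Product.norm_nth_le order_trans)
      thus "norm (A $ i $ j * v $ j) \<le> norm A * norm v"
        by (simp add: norm_mult mult_mono Finite_Cartesian_Product.norm_nth_le)
    qed
    finally show "norm ((A *v v) $ i) \<le> (\<Sum>j\<in>(UNIV::'n set). norm A * norm v)" .
  qed
  finally show ?thesis by simp
qed

lemma norm_matrix_le:
  fixes A :: "complex^'n^'k"
  assumes "\<And>v. norm (A *v v) \<le> K * norm v"
  shows "norm A \<le> real (CARD('k) * CARD('n)) * K"
proof -
  have c: "norm (A $ i $ j) \<le> K" for i j
  proof -
    have "norm (A $ i $ j) = norm ((A *v axis j 1) $ i)" by (simp only: matrix_vector_mult_axis)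
    also have "\<dots> \<le> norm (A *v axis j 1)" by (rule Finite_Cartesian_Product.norm_nth_le)
    also have "\<dots> \<le> K * norm (axis j 1 :: complex^'n)" by (rule assms)
    also have "norm (axis j 1 :: complex^'n) = 1" by (simp add: norm_eq_sqrt_inner inner_axis_axis)
    finally show ?thesis by simp
  qed
  have "norm A \<le> (\<Sum>i\<in>UNIV. norm (A $ i))" unfolding norm_vec_def[of A] by (rule L2_set_le_sum) auto
  also have "\<dots> \<le> (\<Sum>i\<in>(UNIV::'k set). \<Sum>j\<in>(UNIV::'n set). K)"
  proof (rule sum_mono)
    fix i
    have "norm (A $ i) \<le> (\<Sum>j\<in>UNIV. norm (A $ i $ j))" unfolding norm_vec_def by (rule L2_set_le_sum) auto
    thus "norm (A $ i) \<le> (\<Sum>j\<in>(UNIV::'n set). K)" using c by (meson sum_mono order_trans)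
  qed
  finally show ?thesis by simp
qed

lemma norm_trace_le:
  fixes A :: "complex^'n^'n"
  assumes "\<And>v. norm (A *v v) \<le> K * norm v"
  shows "norm (trace A) \<le> real CARD('n) * K"
proof -
  have c: "norm (A $ i $ i) \<le> K" for i
  proof -
    have "norm (A $ i $ i) = norm ((A *v axis i 1) $ i)" by (simp only: matrix_vector_mult_axis)
    also have "\<dots> \<le> norm (A *v axis i 1)" by (rule Finite_Cartesian_Product.norm_nth_le)
    also have "\<dots> \<le> K * norm (axis i 1 :: complex^'n)" by (rule assms)
    also have "norm (axis i 1 :: complex^'n) = 1" by (simp add: norm_eq_sqrt_inner inner_axis_axis)
    finally show ?thesis by simp
  qed
  have "norm (trace A) \<le> (\<Sum>i\<in>UNIV. norm (A $ i $ i))" unfolding trace_def by (rule norm_sum)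
  also have "\<dots> \<le> (\<Sum>i\<in>(UNIV::'n set). K)" using c by (rule sum_mono)
  finally show ?thesis by simp
qed

section \<open>Matrices with positive imaginary part and their logarithmic determinant\<close>

text \<open>The Hermitian imaginary part of \<open>B\<close>, its skew part divided by \<open>\<i>\<close>, is at least
  \<open>s\<close>.\<close>

definition im_ge :: "real \<Rightarrow> complex^'n^'n \<Rightarrow> bool" where
  "im_ge s B \<longleftrightarrow> (\<forall>v. s * (norm v)\<^sup>2 \<le> inner (\<i> *s v) (B *v v))"

text \<open>The matrix analogue of the upper half plane, convex and made of invertible matrices.\<close>

definition Upper :: "(complex^'n^'n) set" where
  "Upper = {B. \<exists>s>0. im_ge s B}"

lemma im_geD: "im_ge s B \<Longrightarrow> s * (norm v)\<^sup>2 \<le> inner (\<i> *s v) (B *v v)"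
  by (simp add: im_ge_def)

lemma im_ge_mono: "im_ge s B \<Longrightarrow> r \<le> s \<Longrightarrow> im_ge r B"
  unfolding im_ge_def by (meson mult_right_mono order_trans zero_le_power2)

lemma im_ge_add: "im_ge s A \<Longrightarrow> im_ge r B \<Longrightarrow> im_ge (s + r) (A + B)"
  unfolding im_ge_def
  by (simp add: matrix_vector_mult_add_rdistrib inner_add_right distrib_right add_mono)

lemma im_ge_mat: "im_ge (Im c) (mat c)"
  by (simp add: im_ge_def mat_vector_mult inner_i_scalar)

lemma im_ge_hermitian: "hermitian B \<Longrightarrow> im_ge 0 B" "hermitian B \<Longrightarrow> im_ge 0 (- B)"
  by (simp_all add: im_ge_def hermitian_inner matrix_vector_mul_uminus)

lemma im_ge_scaleR: "im_ge s A \<Longrightarrow> 0 \<le> r \<Longrightarrow> im_ge (r * s) (r *\<^sub>R A)"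
  unfolding im_ge_def by (simp add: matrix_vector_scaleR_left mult.assoc mult_left_mono)

text \<open>Cauchy-Schwarz: \<open>s |v|^2\<close> is at most \<open>|v| |B v|\<close>. This is the source of all
  resolvent bounds below.\<close>

lemma im_ge_norm_le:
  assumes "im_ge s B" "0 < s" shows "norm v \<le> norm (B *v v) / s"
proof (cases "v = 0")
  case False
  have "s * (norm v)\<^sup>2 \<le> inner (\<i> *s v) (B *v v)" using assms im_geD by blast
  also have "\<dots> \<le> norm v * norm (B *v v)" using norm_cauchy_schwarz[of "\<i> *s v" "B *v v"] by simp
  finally have "norm v * (s * norm v) \<le> norm v * norm (B *v v)" by (simp add: power2_eq_square mult.left_commute)
  hence "s * norm v \<le> norm (B *v v)" using False by (simp add: mult_le_cancel_left)
  thus ?thesis using assms by (simp add: field_simps)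
qed simp

lemma Upper_invertible: "B \<in> Upper \<Longrightarrow> invertible B"
proof (rule invertible_injI)
  fix v assume "B \<in> Upper" "B *v v = 0"
  then obtain s where "s > 0" "im_ge s B" by (auto simp: Upper_def)
  from im_ge_norm_le[OF this(2,1), of v] \<open>B *v v = 0\<close> show "v = 0" by simp
qed

lemma im_ge_inv_norm_le:
  assumes "im_ge s B" "0 < s" shows "norm (matrix_inv B *v v) \<le> norm v / s"
proof -
  have "invertible B" using assms Upper_invertible by (auto simp: Upper_def)
  from matrix_inv_cancel(1)[OF this, of v] im_ge_norm_le[OF assms, of "matrix_inv B *v v"]
  show ?thesis by simp
qed

text \<open>With \<open>C v = B w\<close> the form of \<open>- C* B^(-1) C\<close> at \<open>v\<close> has the imaginary
  part of the form of \<open>B\<close> at \<open>w\<close>. So the Riccati recursion does not lose imaginary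
  part.\<close>

lemma im_ge_neg_inv:
  assumes B: "B \<in> Upper" shows "im_ge 0 (- (adjoint_mat C ** matrix_inv B ** C))"
proof -
  from B obtain s where s: "s > 0" "im_ge s B" by (auto simp: Upper_def)
  have "0 \<le> inner (\<i> *s v) (- (adjoint_mat C ** matrix_inv B ** C) *v v)" for v
  proof -
    define w where "w = matrix_inv B *v (C *v v)"
    have w: "C *v v = B *v w" using matrix_inv_cancel(1)[OF Upper_invertible[OF B]] by (simp add: w_def)
    have "inner (\<i> *s v) (- (adjoint_mat C ** matrix_inv B ** C) *v v) = - inner (\<i> *s v) (adjoint_mat C *v w)"
      by (simp add: matrix_vector_mul_uminus w_def matrix_vector_mul_assoc matrix_mul_assoc)
    also have "\<dots> = - inner (\<i> *s (B *v w)) w"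
      by (simp add: inner_adjoint_mat[symmetric] vector_scalar_commute w)
    also have "\<dots> = inner (\<i> *s w) (B *v w)" 
      using inner_i_left[of "B *v w" w] by (simp only: minus_minus inner_commute)
    also have "\<dots> \<ge> s * (norm w)\<^sup>2" using s im_geD by blast
    finally show ?thesis using s by (smt (verit) mult_nonneg_nonneg zero_le_power2)
  qed
  thus ?thesis by (simp add: im_ge_def)
qed

lemma Upper_add: "A \<in> Upper \<Longrightarrow> im_ge 0 B \<Longrightarrow> A + B \<in> Upper"
  unfolding Upper_def using im_ge_add[of _ A 0 B] by fastforce

lemma im_ge_Upper: "im_ge s B \<Longrightarrow> 0 < s \<Longrightarrow> B \<in> Upper"
  by (auto simp: Upper_def)

lemma mat_Upper: "0 < Im c \<Longrightarrow> mat c \<in> Upper"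
  using im_ge_mat im_ge_Upper by blast

lemma Upper_im_ge0: "B \<in> Upper \<Longrightarrow> im_ge 0 B"
  by (auto simp: Upper_def intro: im_ge_mono less_imp_le)

lemma Upper_scaleR: "B \<in> Upper \<Longrightarrow> 0 < r \<Longrightarrow> r *\<^sub>R B \<in> Upper"
proof -
  assume "B \<in> Upper" "0 < r"
  then obtain s where "s > 0" "im_ge s B" by (auto simp: Upper_def)
  with \<open>0 < r\<close> show ?thesis using im_ge_scaleR[of s B r] im_ge_Upper[of "r * s"] by simp
qed

lemma convex_Upper: "convex (Upper :: (complex^'n^'n) set)"
proof (rule convexI)
  fix x y :: "complex^'n^'n" and u v :: real
  assume "x \<in> Upper" "y \<in> Upper" and uv: "0 \<le> u" "0 \<le> v" "u + v = 1"
  thus "u *\<^sub>R x + v *\<^sub>R y \<in> Upper"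
  proof (cases "u = 0")
    case False
    hence "u *\<^sub>R x \<in> Upper" using \<open>x \<in> Upper\<close> uv by (intro Upper_scaleR) auto
    moreover have "im_ge 0 (v *\<^sub>R y)" using im_ge_scaleR[OF Upper_im_ge0[OF \<open>y \<in> Upper\<close>] uv(2)] by simp
    ultimately show ?thesis by (rule Upper_add)
  qed auto
qed

text \<open>The difference of two logarithms of the same function is continuous with values in the discrete set
  \<open>2 pi i\<close> times the integers. Identities between logarithms are proved below by checking them
  after exponentiation and at one point of a connected set.\<close>

lemma continuous_log_unique_const:
  fixes f g :: "'b::topological_space \<Rightarrow> complex"
  assumes S: "connected S" and f: "continuous_on S f" and g: "continuous_on S g"
    and e: "\<And>x. x \<in> S \<Longrightarrow> exp (f x) = exp (g x)"
  shows "\<exists>c. \<forall>x\<in>S. f x = g x + c"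
proof -
  have "(\<lambda>x. f x - g x) constant_on S"
  proof (rule continuous_discrete_range_constant[OF S continuous_on_diff[OF f g]])
    fix x assume x: "x \<in> S"
    have "2 * pi \<le> norm ((f y - g y) - (f x - g x))" if y: "y \<in> S" "f y - g y \<noteq> f x - g x" for y
    proof -
      have "exp (f y - g y) = exp (f x - g x)" using e[OF x] e[OF y(1)] by (simp add: exp_diff)
      then obtain n :: int where n: "f y - g y = f x - g x + (of_real (of_int (2 * n) * pi)) * \<i>"
        unfolding exp_eq by blast
      with y have "n \<noteq> 0" by auto
      hence "1 \<le> \<bar>real_of_int n\<bar>" by linarith
      thus ?thesis by (simp add: n norm_mult)
    qed
    thus "\<exists>e>0. \<forall>y. y \<in> S \<and> f y - g y \<noteq> f x - g x \<longrightarrow> e \<le> norm (f y - g y - (f x - g x))"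
      by (intro exI[of _ "2*pi"]) auto
  qed
  then obtain c where "\<forall>x\<in>S. f x - g x = c" unfolding constant_on_def by blast
  thus ?thesis by (intro exI[of _ c]) (auto simp: algebra_simps)
qed

lemma continuous_log_unique:
  fixes f g :: "'b::topological_space \<Rightarrow> complex"
  assumes "connected S" "continuous_on S f" "continuous_on S g"
    and "\<And>x. x \<in> S \<Longrightarrow> exp (f x) = exp (g x)" and a: "a \<in> S" "f a = g a" and x: "x \<in> S"
  shows "f x = g x"
proof -
  obtain c where c: "\<forall>x\<in>S. f x = g x + c" using continuous_log_unique_const[OF assms(1-4)] by blast
  with a have "c = 0" by force
  with c x show ?thesis by simp
qed

text \<open>The logarithm of \<open>det\<close> on \<^const>\<open>Upper\<close> whose imaginary part is
  \<open>m pi/2\<close> at \<open>\<i>\<close> times the identity. For a scalar it is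
  \<^const>\<open>Ln\<close>; in general it is not \<open>Ln \<circ> det\<close>, since the argument of the
  determinant is not confined to an interval of length \<open>2 pi\<close>.\<close>

definition logdet :: "complex^'n^'n \<Rightarrow> complex" where
  "logdet = (SOME g. continuous_on Upper g \<and> (\<forall>B\<in>Upper. exp (g B) = det B) \<and>
      g (mat \<i>) = of_nat CARD('n) * Ln \<i>)"

text \<open>A nonvanishing continuous function on a convex set has a continuous logarithm.\<close>

lemma logdet_props:
  "continuous_on Upper (logdet :: complex^'n^'n \<Rightarrow> complex) \<and> (\<forall>B\<in>Upper. exp (logdet (B::complex^'n^'n)) = det B) \<and>
    logdet (mat \<i> :: complex^'n^'n) = of_nat CARD('n) * Ln \<i>"
proof -
  have "contractible (Upper :: (complex^'n^'n) set)" using convex_Upper convex_imp_contractible by blast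
  moreover have "det B \<noteq> 0" if "B \<in> Upper" for B :: "complex^'n^'n"
    using Upper_invertible[OF that] invertible_det_nz by blast
  ultimately obtain g where g: "continuous_on (Upper :: (complex^'n^'n) set) g" "\<And>B. B \<in> Upper \<Longrightarrow> det B = exp (g B)"
    using continuous_logarithm_on_contractible[of Upper "det :: complex^'n^'n \<Rightarrow> complex"]
      continuous_on_det[OF continuous_on_id, of Upper] by metis
  \<comment> \<open>Shift the logarithm so that it has the prescribed value at \<open>\<i>\<close>.\<close>
  define c where "c = of_nat CARD('n) * Ln \<i> - g (mat \<i>)"
  have i: "mat \<i> \<in> (Upper :: (complex^'n^'n) set)" by (rule mat_Upper) simp
  have "exp (of_nat CARD('n) * Ln \<i>) = \<i> ^ CARD('n)" by (simp only: exp_of_nat_mult exp_Ln[OF complex_i_not_zero])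
  hence "exp c = 1" using g(2)[OF i] by (simp add: c_def exp_diff det_mat)
  hence "continuous_on Upper (\<lambda>B. g B + c) \<and> (\<forall>B\<in>Upper. exp (g B + c) = det B) \<and> g (mat \<i>) + c = of_nat CARD('n) * Ln \<i>"
    using g by (auto simp: exp_add c_def intro!: continuous_intros)
  hence "\<exists>g. continuous_on (Upper :: (complex^'n^'n) set) g \<and> (\<forall>B\<in>Upper. exp (g B) = det B) \<and> g (mat \<i>) = of_nat CARD('n) * Ln \<i>"
    by (rule exI[of _ "\<lambda>B. g B + c"])
  thus ?thesis unfolding logdet_def by (rule someI_ex)
qed

lemma continuous_on_logdet: "continuous_on Upper logdet"
  and exp_logdet: "B \<in> Upper \<Longrightarrow> exp (logdet B) = det B"
  and logdet_i: "logdet (mat \<i> :: complex^'n^'n) = of_nat CARD('n) * Ln \<i>"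
  using logdet_props by blast+

lemma continuous_on_logdet_compose [continuous_intros]:
  "continuous_on S f \<Longrightarrow> (\<And>x. x \<in> S \<Longrightarrow> f x \<in> Upper) \<Longrightarrow> continuous_on S (\<lambda>x. logdet (f x))"
  by (rule continuous_on_compose2[OF continuous_on_logdet]) auto

lemma logdet_scaleR:
  fixes B :: "complex^'n^'n"
  assumes B: "B \<in> Upper" and r: "0 < r"
  shows "logdet (r *\<^sub>R B) = logdet B + of_real (real CARD('n) * ln r)"
proof (rule continuous_log_unique[where S = "{0<..}" and a = 1 and x = r])
  show "continuous_on {0<..} (\<lambda>r. logdet (r *\<^sub>R B))"
    using Upper_scaleR[OF B] by (auto intro!: continuous_intros)
  show "continuous_on {0<..} (\<lambda>r. logdet B + complex_of_real (real CARD('n) * ln r))"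
    by (auto intro!: continuous_intros)
  fix x :: real assume x: "x \<in> {0<..}"
  have "x *\<^sub>R B = mat (of_real x) ** B" 
    unfolding vec_eq_iff mat_mult_component vector_scaleR_component by (simp only: scaleR_conv_of_real) simp
  hence "det (x *\<^sub>R B) = of_real x ^ CARD('n) * det B" by (simp add: det_mul det_mat)
  also have "of_real x ^ CARD('n) = exp (complex_of_real (real CARD('n) * ln x))"
    using x by (simp add: exp_of_real exp_of_nat_mult)
  finally show "exp (logdet (x *\<^sub>R B)) = exp (logdet B + complex_of_real (real CARD('n) * ln x))"
    using x B Upper_scaleR[OF B] by (simp add: exp_logdet exp_add mult.commute)
qed (use r in auto)

text \<open>Both sides are the determinant of the block matrix with rows \<open>Z, K\<close> and \<open>L, Q\<close>,
  eliminated in the two possible orders.\<close>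

lemma det_schur:
  fixes Z Q K L :: "complex^'n^'n"
  assumes Z: "invertible Z" and Q: "invertible Q" and K: "invertible K" and L: "invertible L"
  shows "det Z * det (Q - L ** matrix_inv Z ** K) = det Q * det (Z - K ** matrix_inv Q ** L)"
proof -
  have "Q - L ** matrix_inv Z ** K = Q ** (matrix_inv K ** ((Z - K ** matrix_inv Q ** L) ** (matrix_inv Z ** K)))"
    using assms
    by (simp add: matrix_diff_ldistrib matrix_diff_rdistrib matrix_mul_assoc[symmetric]
        matrix_inv_cancel_mult matrix_inv_left_right)
  hence "det (Q - L ** matrix_inv Z ** K) = det Q * (det (matrix_inv K) * (det (Z - K ** matrix_inv Q ** L)
      * (det (matrix_inv Z) * det K)))" by (simp only: det_mul)
  thus ?thesis using Z K by (simp add: det_matrix_inv invertible_det_nz field_simps)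
qed

text \<open>The logarithmic form of the Schur identity. It moves the dependence of the Riccati iterates on their initial
  matrix into a single term.\<close>

lemma logdet_schur:
  fixes Z Q C :: "complex^'n^'n"
  assumes Z: "Z \<in> Upper" and Q: "Q \<in> Upper" and C: "invertible C"
  shows "logdet Z + logdet (Q - adjoint_mat C ** matrix_inv Z ** C) =
         logdet Q + logdet (Z - C ** matrix_inv Q ** adjoint_mat C)"
proof -
  \<comment> \<open>Both sides are deformed to the trivial case \<open>C = 0\<close>; the Schur identity for determinants holds all along.\<close>
  define D where "D t = t *\<^sub>R C" for t :: real
  define f where "f t = logdet Z + logdet (Q - adjoint_mat (D t) ** matrix_inv Z ** D t)" for t
  define g where "g t = logdet Q + logdet (Z - D t ** matrix_inv Q ** adjoint_mat (D t))" for t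
  have U: "Q - adjoint_mat (D t) ** matrix_inv Z ** D t \<in> Upper" for t
    using Upper_add[OF Q im_ge_neg_inv[OF Z, of "D t"]] by simp
  have V: "Z - D t ** matrix_inv Q ** adjoint_mat (D t) \<in> Upper" for t
    using Upper_add[OF Z im_ge_neg_inv[OF Q, of "adjoint_mat (D t)"]] by simp
  have iZ: "invertible Z" and iQ: "invertible Q" using Z Q Upper_invertible by auto
  have "f 1 = g 1"
  proof (rule continuous_log_unique[where S = "UNIV :: real set" and a = 0])
    show "continuous_on UNIV f" "continuous_on UNIV g"
      unfolding f_def g_def using U V unfolding D_def by (auto intro!: continuous_intros)
    show "f 0 = g 0" by (simp add: f_def g_def D_def adjoint_mat_def zero_vec_def[symmetric])
    fix t
    define K where "K = D t"
    have "det Z * det (Q - adjoint_mat K ** matrix_inv Z ** K) =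
          det Q * det (Z - K ** matrix_inv Q ** adjoint_mat K)"
    proof (cases "t = 0")
      case True
      thus ?thesis by (simp add: K_def D_def adjoint_mat_def zero_vec_def[symmetric] mult.commute)
    next
      case False
      hence "invertible K" using C by (simp add: K_def D_def scalar_invertible)
      thus ?thesis using det_schur[OF iZ iQ _ invertible_adjoint_mat] by blast
    qed
    thus "exp (f t) = exp (g t)"
      using U[of t] V[of t] Z Q by (simp add: f_def g_def exp_add exp_logdet K_def)
  qed auto
  thus ?thesis by (simp add: f_def g_def D_def)
qed

text \<open>Along a segment the argument of each linear factor of a polynomial changes by less than \<open>pi\<close>.\<close>

lemma poly_log_segment:
  fixes p :: "complex poly"
  assumes "degree p \<le> n" "\<And>t::real. t \<in> {0..1} \<Longrightarrow> poly p (of_real t) \<noteq> 0"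
  shows "\<exists>g. continuous_on {0..1} g \<and> (\<forall>t\<in>{0..1}. exp (g t) = poly p (of_real t)) \<and>
     \<bar>Im (g 1 - g 0)\<bar> \<le> real n * pi"
  using assms
proof (induction n arbitrary: p)
  case 0
  then obtain c where c: "p = [:c:]" by (metis degree_0_id le_zero_eq degree_eq_zeroE)
  with 0(2)[of 0] have "c \<noteq> 0" by auto
  thus ?case by (intro exI[of _ "\<lambda>_. Ln c"]) (simp add: c)
next
  case (Suc n)
  show ?case
  proof (cases "degree p = 0")
    case True
    then obtain c where c: "p = [:c:]" by (metis degree_eq_zeroE)
    with Suc.prems(2)[of 0] have "c \<noteq> 0" by auto
    thus ?thesis by (intro exI[of _ "\<lambda>_. Ln c"]) (simp add: c)
  next
    case False
    hence "\<not> constant (poly p)" by (simp add: constant_degree)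
    then obtain r where r: "poly p r = 0" using fundamental_theorem_of_algebra by blast
    then obtain q where q: "p = [:-r, 1:] * q" by (auto simp: poly_eq_0_iff_dvd)
    have "q \<noteq> 0" using q False by auto
    hence dq: "degree q \<le> n" using Suc.prems(1) unfolding q by (subst (asm) degree_mult_eq) auto
    have nz: "poly q (of_real t) \<noteq> 0" "complex_of_real t \<noteq> r" if "t \<in> {0..1}" for t
      using Suc.prems(2)[OF that] by (auto simp: q)
    obtain g where g: "continuous_on {0..1} g" "\<forall>t\<in>{0..1}. exp (g t) = poly q (of_real t)"
      "\<bar>Im (g 1 - g 0)\<bar> \<le> real n * pi" using Suc.IH[OF dq nz(1)] by blast
    have r0: "r \<noteq> 0" using nz(2)[of 0] by auto
    have np: "1 - complex_of_real t / r \<notin> \<real>\<^sub>\<le>\<^sub>0" if t: "t \<in> {0..1}" for t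
    proof
      assume "1 - complex_of_real t / r \<in> \<real>\<^sub>\<le>\<^sub>0"
      then obtain x where x: "x \<le> 0" "1 - complex_of_real t / r = of_real x" by (auto elim: nonpos_Reals_cases)
      hence "complex_of_real t = r * of_real (1 - x)" using r0 by (simp add: field_simps)
      hence "r = of_real (t / (1 - x))" using x by (simp add: field_simps of_real_eq_0_iff del: of_real_diff)
      moreover have "t / (1 - x) \<in> {0..1}" using t x by (auto simp: field_simps)
      ultimately show False using nz(2) by blast
    qed
    \<comment> \<open>The root \<open>r\<close> is off the segment, so \<open>1 - t / r\<close> avoids the cut of \<^const>\<open>Ln\<close>.\<close>
    define h where "h t = g t + Ln (1 - complex_of_real t / r) + Ln (- r)" for t
    have "continuous_on {0..1} h" unfolding h_def using np g(1) r0 by (auto intro!: continuous_intros)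
    moreover have "exp (h t) = poly p (of_real t)" if t: "t \<in> {0..1}" for t
    proof -
      have "1 - complex_of_real t / r \<noteq> 0" using np[OF t] by auto
      thus ?thesis using g(2) t r0 by (simp add: h_def exp_add q field_simps)
    qed
    moreover have "\<bar>Im (h 1 - h 0)\<bar> \<le> real (Suc n) * pi"
    proof -
      have "\<bar>Im (Ln (1 - 1 / r))\<bar> \<le> pi"
        using np[of 1] Im_Ln_le_pi[of "1 - 1/r"] mpi_less_Im_Ln[of "1 - 1/r"] by (force simp: abs_le_iff)
      thus ?thesis using g(3) by (simp add: h_def algebra_simps abs_le_iff)
    qed
    ultimately show ?thesis by blast
  qed
qed

lemma mat_of_real_mult: "mat (complex_of_real r) ** A = r *\<^sub>R A"
  unfolding vec_eq_iff mat_mult_component vector_scaleR_component by (simp only: scaleR_conv_of_real[where 'a=complex]) simp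

lemma det_segment_poly:
  fixes A B :: "complex^'n^'n"
  shows "\<exists>p. degree p \<le> CARD('n) \<and> (\<forall>z. poly p z = det (mat (1 - z) ** A + mat z ** B))"
proof -
  define M :: "complex poly^'n^'n" where "M = (\<chi> i j. [:A $ i $ j, B $ i $ j - A $ i $ j:])"
  have "degree (det M) \<le> CARD('n)"
    unfolding det_def
  proof (rule degree_sum_le)
    fix p :: "'n \<Rightarrow> 'n"
    have "degree (\<Prod>i\<in>UNIV. M $ i $ p i) \<le> (\<Sum>i\<in>(UNIV::'n set). degree (M $ i $ p i))"
      using degree_prod_sum_le[of UNIV "\<lambda>i. M $ i $ p i"] by (simp add: o_def)
    also have "\<dots> \<le> (\<Sum>i\<in>(UNIV::'n set). 1)" by (rule sum_mono) (simp add: M_def)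
    finally have 1: "degree (\<Prod>i\<in>UNIV. M $ i $ p i) \<le> CARD('n)" by simp
    have "degree (of_int (sign p) * (\<Prod>i\<in>UNIV. M $ i $ p i)) \<le> degree (of_int (sign p) :: complex poly) + degree (\<Prod>i\<in>UNIV. M $ i $ p i)"
      by (rule degree_mult_le)
    thus "degree (of_int (sign p) * (\<Prod>i\<in>UNIV. M $ i $ p i)) \<le> CARD('n)" using 1 by simp
  qed (simp add: finite_permutations)
  moreover have "poly (det M) z = det (mat (1 - z) ** A + mat z ** B)" for z
    unfolding det_def poly_sum poly_mult poly_prod
    by (intro sum.cong refl arg_cong2[of _ _ _ _ "(*)"] prod.cong)
       (auto simp: M_def mat_mult_component algebra_simps)
  ultimately show ?thesis by blast
qed

text \<open>On the segment from \<open>\<i>\<close> times the identity to \<open>B\<close>, which stays in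
  \<^const>\<open>Upper\<close>, the determinant is a polynomial of degree at most \<open>n\<close>, so its
  argument changes by at most \<open>n pi\<close>.\<close>

lemma Im_logdet_bound:
  fixes B :: "complex^'n^'n"
  assumes B: "B \<in> Upper"
  shows "\<bar>Im (logdet B)\<bar> \<le> 2 * pi * CARD('n)"
proof -
  define A where "A = (mat \<i> :: complex^'n^'n)"
  have A: "A \<in> Upper" by (simp add: A_def mat_Upper)
  have U: "(1 - t) *\<^sub>R A + t *\<^sub>R B \<in> Upper" if "t \<in> {0..1}" for t
    using convex_Upper[THEN convexD_alt, OF A B, of t] that by auto
  obtain p where p1: "degree p \<le> CARD('n)" "\<forall>z. poly p z = det (mat (1 - z) ** A + mat z ** B)"
    using det_segment_poly by blast
  have p2: "poly p (of_real t) = det ((1 - t) *\<^sub>R A + t *\<^sub>R B)" for t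
    unfolding p1(2)[rule_format] mat_of_real_mult[symmetric] of_real_diff of_real_1 ..
  note p = p1(1) p2
  have "poly p (of_real t) \<noteq> 0" if "t \<in> {0..1}" for t
    using p(2) Upper_invertible[OF U[OF that]] by (simp add: invertible_det_nz)
  from poly_log_segment[OF p(1) this] obtain g where g: "continuous_on {0..1} g"
    "\<forall>t\<in>{0..1}. exp (g t) = poly p (of_real t)" "\<bar>Im (g 1 - g 0)\<bar> \<le> real CARD('n) * pi" by blast
  have "\<exists>c. \<forall>t\<in>{0..1}. logdet ((1 - t) *\<^sub>R A + t *\<^sub>R B) = g t + c"
    by (rule continuous_log_unique_const) (use U g p in \<open>auto intro!: continuous_intros simp: exp_logdet\<close>)
  then obtain c where c: "\<forall>t\<in>{0..1}. logdet ((1 - t) *\<^sub>R A + t *\<^sub>R B) = g t + c" by blast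
  from c[rule_format, of 0] c[rule_format, of 1] have "logdet B = logdet A + (g 1 - g 0)" by simp
  hence "Im (logdet B) = real CARD('n) * (pi/2) + Im (g 1 - g 0)"
    by (simp add: A_def logdet_i)
  moreover have "0 \<le> real CARD('n) * pi" by simp
  ultimately show ?thesis using g(3) by (simp add: abs_le_iff algebra_simps)
qed

section \<open>The Riccati recursion and the Green functions of finite boxes\<close>

text \<open>Block elimination from the left of the block tridiagonal matrix with diagonal \<open>a\<close> and
  off-diagonal blocks \<open>C\<close> and \<open>C*\<close> up to sign; the iterates are the pivots. The
  initial matrix \<open>Z\<close> stands in the place of \<open>a 0\<close>, so that the recursion can be
  restarted in the middle of an orbit.\<close>

fun riccati :: "complex^'m^'m \<Rightarrow> (nat \<Rightarrow> complex^'m^'m) \<Rightarrow> complex^'m^'m \<Rightarrow> nat \<Rightarrow> complex^'m^'m" where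
  "riccati C a Z 0 = Z"
| "riccati C a Z (Suc j) = a (Suc j) - adjoint_mat C ** matrix_inv (riccati C a Z j) ** C"

text \<open>The product of the pivots is the determinant of the block tridiagonal matrix, so this is a continuous branch
  of its argument.\<close>

definition phase_sum :: "complex^'m^'m \<Rightarrow> (nat \<Rightarrow> complex^'m^'m) \<Rightarrow> complex^'m^'m \<Rightarrow> nat \<Rightarrow> real" where
  "phase_sum C a Z n = (\<Sum>j<n. Im (logdet (riccati C a Z j)))"

lemma riccati_im_ge:
  assumes "\<And>j. im_ge s (a j)" "0 < s" "im_ge s Z"
  shows "im_ge s (riccati C a Z j)"
proof (induction j)
  case (Suc j)
  have "im_ge 0 (- (adjoint_mat C ** matrix_inv (riccati C a Z j) ** C))"
    using im_ge_neg_inv im_ge_Upper Suc assms(2) by blast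
  from im_ge_add[OF assms(1)[of "Suc j"] this] show ?case by simp
qed (use assms in simp)

lemma riccati_Upper:
  assumes "\<And>j. a j \<in> Upper" "Z \<in> Upper"
  shows "riccati C a Z j \<in> Upper"
proof (induction j)
  case (Suc j)
  from Upper_add[OF assms(1)[of "Suc j"] im_ge_neg_inv[OF Suc, of C]] show ?case by simp
qed (use assms in simp)

lemma riccati_shift:
  "riccati C a Z (n + j) = riccati C (\<lambda>i. a (n + i)) (riccati C a Z n) j"
  by (induction j) auto

lemma phase_sum_add:
  "phase_sum C a Z (n + j) = phase_sum C a Z n + phase_sum C (\<lambda>i. a (n + i)) (riccati C a Z n) j"
proof -
  have "phase_sum C a Z (n + j) = phase_sum C a Z n + (\<Sum>i<j. Im (logdet (riccati C a Z (n + i))))"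
    unfolding phase_sum_def by (induction j) auto
  thus ?thesis by (simp add: phase_sum_def riccati_shift)
qed

text \<open>By induction: peeling off the first step leaves a phase sum that starts at
  \<open>a 1 - C* Z^(-1) C\<close>, and \<open>logdet_schur\<close> turns the sum of the two terms containing
  \<open>Z\<close> into a constant plus one term of the same shape.\<close>

lemma phase_sum_form:
  assumes C: "invertible C" and a: "\<And>j. a j \<in> Upper"
  shows "\<exists>Q c. im_ge 0 Q \<and> (\<forall>Z\<in>Upper. phase_sum C a Z (Suc n) = c + Im (logdet (Z + Q)))"
  using a
proof (induction n arbitrary: a)
  case 0
  show ?case by (intro exI[of _ 0]) (simp add: phase_sum_def im_ge_def)
next
  case (Suc n)
  define a' where "a' = (\<lambda>j. a (Suc j))"
  have "\<And>j. a' j \<in> Upper" using Suc.prems by (simp add: a'_def)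
  from Suc.IH[of a', OF this] obtain Q c where
    Q: "im_ge 0 Q" "\<forall>Z\<in>Upper. phase_sum C a' Z (Suc n) = c + Im (logdet (Z + Q))" by blast
  define Q' where "Q' = a 1 + Q"
  have Q': "Q' \<in> Upper" unfolding Q'_def using Suc.prems Q(1) by (rule Upper_add)
  have "phase_sum C a Z (Suc (Suc n)) = c + Im (logdet Q') + Im (logdet (Z + - (C ** matrix_inv Q' ** adjoint_mat C)))"
    if Z: "Z \<in> Upper" for Z
  proof -
    have U: "a 1 + - (adjoint_mat C ** matrix_inv Z ** C) \<in> Upper"
      by (intro Upper_add Suc.prems im_ge_neg_inv Z)
    have "phase_sum C a Z (1 + Suc n) = Im (logdet Z) + phase_sum C a' (a 1 - adjoint_mat C ** matrix_inv Z ** C) (Suc n)"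
      unfolding phase_sum_add by (simp add: phase_sum_def a'_def)
    also have "\<dots> = Im (logdet Z) + (c + Im (logdet (a 1 - adjoint_mat C ** matrix_inv Z ** C + Q)))"
      using Q(2) U by simp
    also have "a 1 - adjoint_mat C ** matrix_inv Z ** C + Q = Q' - adjoint_mat C ** matrix_inv Z ** C"
      by (simp add: Q'_def)
    also have "Im (logdet Z) + (c + Im (logdet (Q' - adjoint_mat C ** matrix_inv Z ** C))) =
        c + Im (logdet Z + logdet (Q' - adjoint_mat C ** matrix_inv Z ** C))" by simp
    also have "\<dots> = c + Im (logdet Q' + logdet (Z - C ** matrix_inv Q' ** adjoint_mat C))"
      by (simp only: logdet_schur[OF Z Q' C])
    finally show ?thesis by simp
  qed
  moreover have "im_ge 0 (- (C ** matrix_inv Q' ** adjoint_mat C))"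
    using im_ge_neg_inv[OF Q', of "adjoint_mat C"] by simp
  ultimately show ?case by blast
qed

text \<open>By \<open>phase_sum_form\<close> only two bounded phases differ. The bound is uniform in \<open>n\<close>;
  this makes the phase quasi-additive along orbits.\<close>

lemma phase_sum_indep:
  fixes C :: "complex^'m^'m"
  assumes C: "invertible C" and a: "\<And>j. a j \<in> Upper" and Z: "Z \<in> Upper" "Z' \<in> Upper"
  shows "\<bar>phase_sum C a Z n - phase_sum C a Z' n\<bar> \<le> 4 * pi * CARD('m)"
proof (cases n)
  case 0
  thus ?thesis by (simp add: phase_sum_def)
next
  case (Suc k)
  obtain Q c where Q: "im_ge 0 Q" "\<forall>Z\<in>Upper. phase_sum C a Z (Suc k) = c + Im (logdet (Z + Q))"
    using phase_sum_form[where a=a, OF C a] by blast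
  have "\<bar>Im (logdet (Z + Q))\<bar> \<le> 2 * pi * CARD('m)" "\<bar>Im (logdet (Z' + Q))\<bar> \<le> 2 * pi * CARD('m)"
    by (intro Im_logdet_bound Upper_add Z Q)+
  with Q(2) Z show ?thesis by (simp add: Suc abs_le_iff)
qed

lemma phase_sum_bound:
  fixes C :: "complex^'m^'m"
  assumes "\<And>j. a j \<in> Upper" "Z \<in> Upper"
  shows "\<bar>phase_sum C a Z n\<bar> \<le> real n * (2 * pi * CARD('m))"
proof -
  have "\<bar>phase_sum C a Z n\<bar> \<le> (\<Sum>j<n. 2 * pi * CARD('m))"
    unfolding phase_sum_def
    by (rule order_trans[OF sum_abs]) (intro sum_mono Im_logdet_bound riccati_Upper assms)
  thus ?thesis by simp
qed

text \<open>With \<open>L\<close> the pivots, the diagonal block at position \<open>j\<close> of the inverse of the block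
  tridiagonal matrix of size \<open>j + d + 1\<close> (\<open>box_solution\<close>), expressed by the block at
  \<open>j + 1\<close> of the same inverse.\<close>

fun green :: "complex^'m^'m \<Rightarrow> (nat \<Rightarrow> complex^'m^'m) \<Rightarrow> nat \<Rightarrow> nat \<Rightarrow> complex^'m^'m" where
  "green C L j 0 = matrix_inv (L j)"
| "green C L j (Suc d) = matrix_inv (L j) +
     matrix_inv (L j) ** (C ** (green C L (Suc j) d ** (adjoint_mat C ** matrix_inv (L j))))"

text \<open>The box ends at the source \<open>e\<close> at \<open>k\<close>: there elimination leaves
  \<open>L k w = e\<close>, and back substitution gives the other values. The unknowns are indexed from
  \<open>1\<close>, so that \<open>w 0 = 0\<close> and the vanishing of \<open>w\<close> beyond the box are
  the Dirichlet conditions.\<close>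

lemma half_box_solution:
  fixes C :: "complex^'m^'m"
  assumes a: "\<And>j. a j \<in> Upper"
  defines "L \<equiv> riccati C a (a 0)"
  shows "\<exists>w. w 0 = 0 \<and> (\<forall>i>k. w (Suc i) = 0) \<and> w (Suc k) = matrix_inv (L k) *v e \<and>
    (\<forall>j<k. w (Suc j) = matrix_inv (L j) *v (C *v w (Suc (Suc j)))) \<and>
    (\<forall>i\<le>k. a i *v w (Suc i) - adjoint_mat C *v w i - C *v w (Suc (Suc i)) = (if i = k then e else 0))"
proof (induction k arbitrary: e)
  case 0
  have "a 0 *v (matrix_inv (a 0) *v e) = e" by (intro matrix_inv_cancel Upper_invertible a)
  thus ?case by (intro exI[of _ "\<lambda>i. if i = 1 then matrix_inv (L 0) *v e else 0"]) (auto simp: L_def)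
next
  case (Suc k)
  define v where "v = matrix_inv (L (Suc k)) *v e"
  have U: "L j \<in> Upper" for j unfolding L_def by (intro riccati_Upper a)
  obtain w where w: "w 0 = 0" "\<forall>i>k. w (Suc i) = 0" "w (Suc k) = matrix_inv (L k) *v (C *v v)"
    "\<forall>j<k. w (Suc j) = matrix_inv (L j) *v (C *v w (Suc (Suc j)))"
    "\<forall>i\<le>k. a i *v w (Suc i) - adjoint_mat C *v w i - C *v w (Suc (Suc i)) = (if i = k then C *v v else 0)"
    using Suc[of "C *v v"] by blast
  have Lv: "L (Suc k) *v v = e" unfolding v_def by (intro matrix_inv_cancel Upper_invertible U)
  have LS: "L (Suc k) *v v = a (Suc k) *v v - adjoint_mat C *v (matrix_inv (L k) *v (C *v v))"
    by (simp add: L_def matrix_vector_mult_diff_rdistrib matrix_vector_mul_assoc matrix_mul_assoc)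
  define w' where "w' i = (if i = Suc (Suc k) then v else w i)" for i
  have "a i *v w' (Suc i) - adjoint_mat C *v w' i - C *v w' (Suc (Suc i)) = (if i = Suc k then e else 0)"
    if i: "i \<le> Suc k" for i
  proof -
    consider "i < k" | "i = k" | "i = Suc k" using i by linarith
    thus ?thesis
    proof cases
      case 1 thus ?thesis using w(5)[rule_format, of i] by (simp add: w'_def)
    next
      case 2
      with w(5)[rule_format, of k] w(2) show ?thesis by (simp add: w'_def)
    next
      case 3
      have "w (Suc (Suc (Suc k))) = 0" using w(2) by simp
      with 3 w(3) show ?thesis using Lv LS by (simp add: w'_def)
    qed
  qed
  moreover have "w' (Suc j) = matrix_inv (L j) *v (C *v w' (Suc (Suc j)))" if "j < Suc k" for j
    using w(3,4) that by (cases "j = k") (auto simp: w'_def)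
  moreover have "w' 0 = 0" "\<forall>i>Suc k. w' (Suc i) = 0" "w' (Suc (Suc k)) = matrix_inv (L (Suc k)) *v e"
    using w by (auto simp: w'_def v_def)
  ultimately show ?case by blast
qed

text \<open>The solution for the box that ends at the source violates the equation only at the next site
  \<open>k + 1\<close>. The solution for the full box with a source at \<open>k + 1\<close> repairs this.\<close>

lemma box_solution:
  fixes C :: "complex^'m^'m"
  assumes a: "\<And>j. a j \<in> Upper"
  defines "L \<equiv> riccati C a (a 0)"
  shows "\<exists>w. w 0 = 0 \<and> (\<forall>i>k+d. w (Suc i) = 0) \<and> w (Suc k) = green C L k d *v e \<and>
    (\<forall>j<k. w (Suc j) = matrix_inv (L j) *v (C *v w (Suc (Suc j)))) \<and>
    (\<forall>i\<le>k+d. a i *v w (Suc i) - adjoint_mat C *v w i - C *v w (Suc (Suc i)) = (if i = k then e else 0))"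
proof (induction d arbitrary: k e)
  case 0
  show ?case using half_box_solution[where a=a and C=C and k=k and e=e, OF a] by (simp add: L_def)
next
  case (Suc d)
  define e' where "e' = adjoint_mat C *v (matrix_inv (L k) *v e)"
  obtain x where x: "x 0 = 0" "\<forall>i>k. x (Suc i) = 0" "x (Suc k) = matrix_inv (L k) *v e"
    "\<forall>j<k. x (Suc j) = matrix_inv (L j) *v (C *v x (Suc (Suc j)))"
    "\<forall>i\<le>k. a i *v x (Suc i) - adjoint_mat C *v x i - C *v x (Suc (Suc i)) = (if i = k then e else 0)"
    using half_box_solution[where a=a and C=C and k=k and e=e, OF a] unfolding L_def by blast
  obtain y where y: "y 0 = 0" "\<forall>i>Suc k+d. y (Suc i) = 0" "y (Suc (Suc k)) = green C L (Suc k) d *v e'"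
    "\<forall>j<Suc k. y (Suc j) = matrix_inv (L j) *v (C *v y (Suc (Suc j)))"
    "\<forall>i\<le>Suc k+d. a i *v y (Suc i) - adjoint_mat C *v y i - C *v y (Suc (Suc i)) = (if i = Suc k then e' else 0)"
    using Suc[of "Suc k" e'] by blast
  define w where "w i = x i + y i" for i
  have x0: "x i = 0" if "i > Suc k" for i using x(2) that by (cases i) auto
  have "a i *v w (Suc i) - adjoint_mat C *v w i - C *v w (Suc (Suc i)) = (if i = k then e else 0)"
    if i: "i \<le> k + Suc d" for i
  proof -
    have *: "a i *v w (Suc i) - adjoint_mat C *v w i - C *v w (Suc (Suc i)) =
       (a i *v x (Suc i) - adjoint_mat C *v x i - C *v x (Suc (Suc i))) +
       (a i *v y (Suc i) - adjoint_mat C *v y i - C *v y (Suc (Suc i)))"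
      by (simp add: w_def matrix_vector_right_distrib)
    consider "i \<le> k" | "i = Suc k" | "i > Suc k" by linarith
    thus ?thesis
    proof cases
      case 1 thus ?thesis using * x(5) y(5) by simp
    next
      case 2 thus ?thesis using * x(3) x0 y(5) by (simp add: e'_def)
    next
      case 3 thus ?thesis using * x0 y(5) i by simp
    qed
  qed
  moreover have "w (Suc k) = green C L k (Suc d) *v e"
    using x(3) y(3,4)
    by (simp add: w_def e'_def matrix_vector_mult_add_rdistrib matrix_vector_mul_assoc matrix_mul_assoc)
  moreover have "\<forall>j<k. w (Suc j) = matrix_inv (L j) *v (C *v w (Suc (Suc j)))"
    using x(4) y(4) by (simp add: w_def matrix_vector_right_distrib)
  moreover have "w 0 = 0" "\<forall>i>k + Suc d. w (Suc i) = 0" using x y x0 by (auto simp: w_def)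
  ultimately show ?case by blast
qed

text \<open>The hopping terms form a Hermitian matrix and do not contribute to the imaginary part.\<close>

lemma box_coercive:
  fixes C :: "complex^'m^'m" and w :: "nat \<Rightarrow> complex^'m"
  assumes a: "\<And>j. im_ge s (a j)" and w: "w 0 = 0" "w (Suc N) = 0"
  shows "s * (\<Sum>i<N. (norm (w (Suc i)))\<^sup>2) \<le>
    (\<Sum>i<N. inner (\<i> *s w (Suc i)) (a i *v w (Suc i) - adjoint_mat C *v w i - C *v w (Suc (Suc i))))"
proof -
  define t where "t i = inner (\<i> *s w i) (C *v w (Suc i))" for i
  have 1: "inner (\<i> *s w (Suc i)) (adjoint_mat C *v w i) = - t i" for i
    by (simp add: t_def inner_adjoint_mat[symmetric] vector_scalar_commute inner_i_left[of "C *v _"]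
        inner_commute[of "C *v _"])
  have "(\<Sum>i<N. inner (\<i> *s w (Suc i)) (a i *v w (Suc i) - adjoint_mat C *v w i - C *v w (Suc (Suc i)))) =
     (\<Sum>i<N. inner (\<i> *s w (Suc i)) (a i *v w (Suc i)) + (t i - t (Suc i)))"
    by (simp add: inner_diff_right 1) (simp add: t_def algebra_simps)
  also have "\<dots> = (\<Sum>i<N. inner (\<i> *s w (Suc i)) (a i *v w (Suc i))) + (t 0 - t N)"
    by (simp add: sum.distrib sum_lessThan_telescope')
  also have "t 0 - t N = 0" using w by (simp add: t_def)
  finally show ?thesis using a
    by (simp add: sum_distrib_left) (intro sum_mono im_geD, blast)
qed

text \<open>The resolvent bound for the box, uniform in its size.\<close>

lemma green_norm_le:
  fixes C :: "complex^'m^'m"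
  assumes a: "\<And>j. im_ge s (a j)" and s: "0 < s"
  shows "norm (green C (riccati C a (a 0)) k d *v e) \<le> norm e / s"
proof -
  have "\<And>j. a j \<in> Upper" using a s im_ge_Upper by blast
  from box_solution[where a=a and C=C and k=k and d=d and e=e, OF this] obtain w where
    w: "w 0 = 0" "\<forall>i>k+d. w (Suc i) = 0" "w (Suc k) = green C (riccati C a (a 0)) k d *v e"
    "\<forall>i\<le>k+d. a i *v w (Suc i) - adjoint_mat C *v w i - C *v w (Suc (Suc i)) = (if i = k then e else 0)"
    by blast
  define N where "N = Suc (k + d)"
  have "s * (norm (w (Suc k)))\<^sup>2 \<le> s * (\<Sum>i<N. (norm (w (Suc i)))\<^sup>2)"
    using s by (intro mult_left_mono member_le_sum) (auto simp: N_def)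
  also have "\<dots> \<le> (\<Sum>i<N. inner (\<i> *s w (Suc i)) (a i *v w (Suc i) - adjoint_mat C *v w i - C *v w (Suc (Suc i))))"
    by (rule box_coercive) (use a w in \<open>auto simp: N_def\<close>)
  also have "\<dots> = (\<Sum>i<N. if i = k then inner (\<i> *s w (Suc k)) e else 0)"
    using w(4) by (intro sum.cong) (auto simp: N_def)
  also have "\<dots> = inner (\<i> *s w (Suc k)) e" by (simp add: N_def)
  also have "\<dots> \<le> norm (w (Suc k)) * norm e" using norm_cauchy_schwarz[of "\<i> *s w (Suc k)" e] by simp
  finally have *: "norm (w (Suc k)) * (s * norm (w (Suc k))) \<le> norm (w (Suc k)) * norm e"
    by (simp add: power2_eq_square mult.left_commute)
  show ?thesis
  proof (cases "w (Suc k) = 0")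
    case False
    hence "s * norm (w (Suc k)) \<le> norm e" using * by (simp add: mult_le_cancel_left)
    thus ?thesis using s by (simp add: w(3)[symmetric] field_simps)
  qed (use s w(3) in simp)
qed

text \<open>The restriction of \<open>u\<close> to the box solves the Dirichlet problem with two extra sources at the
  ends, which come from the values of \<open>u\<close> just outside. Coercivity bounds their effect.\<close>

lemma green_approx:
  fixes C :: "complex^'m^'m" and u :: "nat \<Rightarrow> complex^'m"
  assumes a: "\<And>j. im_ge s (a j)" and s: "0 < s"
    and K: "\<And>v. norm (C *v v) \<le> K * norm v" "\<And>v. norm (adjoint_mat C *v v) \<le> K * norm v"
    and u: "\<And>i. i \<le> k + d \<Longrightarrow>
      a i *v u (Suc i) - adjoint_mat C *v u i - C *v u (Suc (Suc i)) = (if i = k then e else 0)"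
  shows "norm (u (Suc k) - green C (riccati C a (a 0)) k d *v e) \<le> K * (norm (u 0) + norm (u (k + d + 2))) / s"
proof -
  have "\<And>j. a j \<in> Upper" using a s im_ge_Upper by blast
  from box_solution[where a=a and C=C and k=k and d=d and e=e, OF this] obtain v where
    v: "v 0 = 0" "\<forall>i>k+d. v (Suc i) = 0" "v (Suc k) = green C (riccati C a (a 0)) k d *v e"
    "\<forall>i\<le>k+d. a i *v v (Suc i) - adjoint_mat C *v v i - C *v v (Suc (Suc i)) = (if i = k then e else 0)"
    by blast
  define N where "N = Suc (k + d)"
  \<comment> \<open>The difference with zero boundary values; its equation has the sources \<open>C* u 0\<close> and \<open>C u (Suc N)\<close> at the two ends.\<close>
  define w where "w i = (if i = 0 \<or> i = Suc N then 0 else u i - v i)" for i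
  define \<sigma> where "\<sigma> = sqrt (\<Sum>i<N. (norm (w (Suc i)))\<^sup>2)"
  define X where "X = K * (norm (u 0) + norm (u (Suc N)))"
  have nw: "norm (w (Suc i)) \<le> \<sigma>" if "i < N" for i
    unfolding \<sigma>_def by (rule real_le_rsqrt) (rule member_le_sum[of i "{..<N}" "\<lambda>i. (norm (w (Suc i)))\<^sup>2"], use that in auto)
  have r: "a i *v w (Suc i) - adjoint_mat C *v w i - C *v w (Suc (Suc i)) =
     (if i = 0 then adjoint_mat C *v u 0 else 0) + (if i = N - 1 then C *v u (Suc N) else 0)" if i: "i < N" for i
  proof -
    have 1: "w i = u i - v i - (if i = 0 then u 0 else 0)" using i v(1) by (auto simp: w_def)
    have 2: "w (Suc (Suc i)) = u (Suc (Suc i)) - v (Suc (Suc i)) - (if i = N - 1 then u (Suc N) else 0)"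
      using i v(2) by (auto simp: w_def N_def)
    have 3: "w (Suc i) = u (Suc i) - v (Suc i)" using i by (simp add: w_def)
    have "a i *v w (Suc i) - adjoint_mat C *v w i - C *v w (Suc (Suc i)) =
      (a i *v u (Suc i) - adjoint_mat C *v u i - C *v u (Suc (Suc i))) -
      (a i *v v (Suc i) - adjoint_mat C *v v i - C *v v (Suc (Suc i))) +
      adjoint_mat C *v (if i = 0 then u 0 else 0) + C *v (if i = N - 1 then u (Suc N) else 0)"
      unfolding 1 2 3 by (simp add: matrix_vector_mult_diff_distrib)
    also have "\<dots> = adjoint_mat C *v (if i = 0 then u 0 else 0) + C *v (if i = N - 1 then u (Suc N) else 0)"
      using u[of i] v(4)[rule_format, of i] i by (simp add: N_def)
    finally show ?thesis by (cases "i = 0"; cases "i = N - 1") simp_all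
  qed
  have "s * \<sigma>\<^sup>2 = s * (\<Sum>i<N. (norm (w (Suc i)))\<^sup>2)" by (simp add: \<sigma>_def sum_nonneg)
  also have "\<dots> \<le> (\<Sum>i<N. inner (\<i> *s w (Suc i)) (a i *v w (Suc i) - adjoint_mat C *v w i - C *v w (Suc (Suc i))))"
    by (rule box_coercive) (use a in \<open>auto simp: w_def\<close>)
  also have "\<dots> = (\<Sum>i<N. (if i = 0 then inner (\<i> *s w (Suc 0)) (adjoint_mat C *v u 0) else 0) +
       (if i = N - 1 then inner (\<i> *s w (Suc (N - 1))) (C *v u (Suc N)) else 0))"
  proof (rule sum.cong[OF refl])
    fix i assume "i \<in> {..<N}"
    hence "i < N" by simp
    from r[OF this] show "inner (\<i> *s w (Suc i)) (a i *v w (Suc i) - adjoint_mat C *v w i - C *v w (Suc (Suc i))) =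
      (if i = 0 then inner (\<i> *s w (Suc 0)) (adjoint_mat C *v u 0) else 0) +
       (if i = N - 1 then inner (\<i> *s w (Suc (N - 1))) (C *v u (Suc N)) else 0)"
      by (cases "i = 0"; cases "i = N - 1") (simp_all add: inner_add_right)
  qed
  also have "\<dots> = inner (\<i> *s w (Suc 0)) (adjoint_mat C *v u 0) + inner (\<i> *s w (Suc (N - 1))) (C *v u (Suc N))"
    by (simp add: sum.distrib N_def)
  also have "\<dots> \<le> norm (w (Suc 0)) * norm (adjoint_mat C *v u 0) + norm (w (Suc (N-1))) * norm (C *v u (Suc N))"
    using norm_cauchy_schwarz[of "\<i> *s w (Suc 0)" "adjoint_mat C *v u 0"]
      norm_cauchy_schwarz[of "\<i> *s w (Suc (N-1))" "C *v u (Suc N)"] by simp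
  also have "\<dots> \<le> \<sigma> * (K * norm (u 0)) + \<sigma> * (K * norm (u (Suc N)))"
    by (intro add_mono mult_mono K nw) (auto simp: N_def \<sigma>_def sum_nonneg)
  also have "\<dots> = \<sigma> * X" by (simp add: X_def algebra_simps)
  finally have *: "\<sigma> * (s * \<sigma>) \<le> \<sigma> * X" by (simp add: power2_eq_square mult.left_commute)
  have \<sigma>0: "0 \<le> \<sigma>" by (simp add: \<sigma>_def sum_nonneg)
  have "0 \<le> K * norm (u 0)" "0 \<le> K * norm (u (Suc N))" using K(1) norm_ge_zero order_trans by blast+
  hence X0: "0 \<le> X" by (simp add: X_def distrib_left)
  have "s * \<sigma> \<le> X"
  proof (cases "\<sigma> = 0")
    case False thus ?thesis using * \<sigma>0 by (simp add: mult_le_cancel_left)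
  qed (use X0 in simp)
  hence "\<sigma> \<le> X / s" using s by (simp add: field_simps)
  moreover have "u (Suc k) - green C (riccati C a (a 0)) k d *v e = w (Suc k)" by (simp add: w_def N_def v(3))
  ultimately show ?thesis using nw[of k] by (simp add: N_def X_def)
qed

text \<open>The derivative of the pivots when all diagonal blocks move with derivative \<open>1\<close>.\<close>

fun driccati :: "complex^'m^'m \<Rightarrow> (nat \<Rightarrow> complex^'m^'m) \<Rightarrow> nat \<Rightarrow> complex^'m^'m" where
  "driccati C L 0 = mat 1"
| "driccati C L (Suc j) = mat 1 +
     (adjoint_mat C ** matrix_inv (L j)) ** (driccati C L j ** (matrix_inv (L j) ** C))"

text \<open>The traces of the derivatives of the pivots, regrouped by the site at which the block was moved, are the
  traces of the diagonal blocks of the inverse. The terms of the sites before \<open>j\<close> are collected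
  in \<^const>\<open>driccati\<close>; with general \<open>j\<close> the induction on \<open>d\<close> goes
  through.\<close>

lemma trace_green_sum:
  "(\<Sum>l\<le>d. trace (matrix_inv (L (j + l)) ** driccati C L (j + l))) =
   trace (green C L j d ** driccati C L j) + (\<Sum>l<d. trace (green C L (j + Suc l) (d - Suc l)))"
proof (induction d arbitrary: j)
  case 0
  show ?case by simp
next
  case (Suc d)
  have "(\<Sum>l\<le>Suc d. trace (matrix_inv (L (j + l)) ** driccati C L (j + l))) =
    trace (matrix_inv (L j) ** driccati C L j) + (\<Sum>l\<le>d. trace (matrix_inv (L (Suc j + l)) ** driccati C L (Suc j + l)))"
    by (subst sum.atMost_Suc_shift) simp
  also have "\<dots> = trace (matrix_inv (L j) ** driccati C L j) +
     (trace (green C L (Suc j) d ** driccati C L (Suc j)) + (\<Sum>l<d. trace (green C L (Suc j + Suc l) (d - Suc l))))"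
    by (simp only: Suc)
  also have "trace (green C L (Suc j) d ** driccati C L (Suc j)) = trace (green C L (Suc j) d) +
     trace (matrix_inv (L j) ** (C ** (green C L (Suc j) d ** (adjoint_mat C ** matrix_inv (L j)))) ** driccati C L j)"
  proof -
    have "trace (green C L (Suc j) d ** ((adjoint_mat C ** matrix_inv (L j)) ** (driccati C L j ** (matrix_inv (L j) ** C)))) =
      trace (((green C L (Suc j) d ** (adjoint_mat C ** matrix_inv (L j))) ** driccati C L j) ** (matrix_inv (L j) ** C))"
      by (simp only: matrix_mul_assoc)
    also have "\<dots> = trace ((matrix_inv (L j) ** C) ** ((green C L (Suc j) d ** (adjoint_mat C ** matrix_inv (L j))) ** driccati C L j))"
      by (rule trace_mul_sym)
    finally show ?thesis by (simp add: matrix_add_ldistrib trace_add matrix_mul_assoc)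
  qed
  also have "trace (matrix_inv (L j) ** driccati C L j) + (trace (green C L (Suc j) d) +
     trace (matrix_inv (L j) ** (C ** (green C L (Suc j) d ** (adjoint_mat C ** matrix_inv (L j)))) ** driccati C L j) +
     (\<Sum>l<d. trace (green C L (Suc j + Suc l) (d - Suc l)))) =
     trace (green C L j (Suc d) ** driccati C L j) + (trace (green C L (Suc j) d) + (\<Sum>l<d. trace (green C L (Suc j + Suc l) (d - Suc l))))"
    by (simp add: matrix_mult_add_left trace_add)
  also have "trace (green C L (Suc j) d) + (\<Sum>l<d. trace (green C L (Suc j + Suc l) (d - Suc l))) =
     (\<Sum>l<Suc d. trace (green C L (j + Suc l) (Suc d - Suc l)))"
    by (subst sum.lessThan_Suc_shift) simp
  finally show ?case .
qed

lemma trace_green_sum_0: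
  "(\<Sum>l<n. trace (matrix_inv (L l) ** driccati C L l)) = (\<Sum>l<n. trace (green C L l (n - Suc l)))"
proof (cases n)
  case (Suc d)
  have "(\<Sum>l<n. trace (matrix_inv (L l) ** driccati C L l)) = (\<Sum>l\<le>d. trace (matrix_inv (L (0 + l)) ** driccati C L (0 + l)))"
    by (simp add: Suc lessThan_Suc_atMost)
  also have "\<dots> = trace (green C L 0 d) + (\<Sum>l<d. trace (green C L (Suc l) (d - Suc l)))"
    by (simp only: trace_green_sum) simp
  also have "\<dots> = (\<Sum>l<n. trace (green C L l (n - Suc l)))"
    unfolding Suc by (simp add: sum.lessThan_Suc_shift del: sum.lessThan_Suc)
  finally show ?thesis .
qed simp

section \<open>Derivatives with respect to the spectral parameter\<close>

lemma has_vector_derivative_iff_quotient: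
  "(f has_vector_derivative d) (at s) \<longleftrightarrow> ((\<lambda>t. (f t - f s) /\<^sub>R (t - s)) \<longlongrightarrow> d) (at s)"
proof -
  have "(f has_vector_derivative d) (at s) \<longleftrightarrow>
    ((\<lambda>y. norm (f y - f s - (y - s) *\<^sub>R d) / norm (y - s)) \<longlongrightarrow> 0) (at s)"
    by (simp add: has_vector_derivative_def has_derivative_iff_norm bounded_linear_scaleR_left)
  also have "\<dots> \<longleftrightarrow> ((\<lambda>y. norm ((f y - f s) /\<^sub>R (y - s) - d)) \<longlongrightarrow> 0) (at s)"
  proof (rule filterlim_cong[OF refl refl])
    show "\<forall>\<^sub>F y in at s. norm (f y - f s - (y - s) *\<^sub>R d) / norm (y - s) = norm ((f y - f s) /\<^sub>R (y - s) - d)"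
      unfolding eventually_at_filter
    proof (intro always_eventually allI impI)
      fix y assume "y \<noteq> s"
      hence "(f y - f s) /\<^sub>R (y - s) - d = (f y - f s - (y - s) *\<^sub>R d) /\<^sub>R (y - s)"
        by (simp add: scaleR_diff_right)
      thus "norm (f y - f s - (y - s) *\<^sub>R d) / norm (y - s) = norm ((f y - f s) /\<^sub>R (y - s) - d)"
        by (simp add: divide_inverse mult.commute)
    qed
  qed
  also have "\<dots> \<longleftrightarrow> ((\<lambda>y. (f y - f s) /\<^sub>R (y - s)) \<longlongrightarrow> d) (at s)"
    by (simp add: tendsto_norm_zero_iff LIM_zero_iff)
  finally show ?thesis .
qed

lemma bounded_linear_matrix_mult: "bounded_linear (\<lambda>A. K ** A ** (L :: complex^'n^'n))" for K :: "complex^'n^'n"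
proof -
  have "linear (\<lambda>A. K ** A ** L)"
    by (rule linearI) (simp_all add: matrix_add_ldistrib matrix_mult_add_left matrix_scaleR_left matrix_scaleR_right)
  thus ?thesis by (simp add: linear_conv_bounded_linear)
qed

text \<open>Only the identity permutation contributes to first order at the identity matrix: any other permutation has at
  least two factors off the diagonal.\<close>

lemma det_has_vector_derivative_at_mat_1:
  fixes A :: "real \<Rightarrow> complex^'n^'n"
  assumes A: "(A has_vector_derivative A') (at s)" and A1: "A s = mat 1"
  shows "((\<lambda>t. det (A t)) has_vector_derivative trace A') (at s)"
proof -
  have c: "((\<lambda>t. A t $ i $ j) has_derivative (\<lambda>y. y *\<^sub>R A' $ i $ j)) (at s)" for i j
  proof -
    have "((\<lambda>t. A t $ i $ j) has_vector_derivative A' $ i $ j) (at s)"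
      using bounded_linear.has_vector_derivative[OF bounded_linear_vec_nth[of j]
          bounded_linear.has_vector_derivative[OF bounded_linear_vec_nth[of i] A]] .
    thus ?thesis by (simp add: has_vector_derivative_def)
  qed
  have s: "of_int (sign p) * (\<Sum>i\<in>UNIV. y *\<^sub>R A' $ i $ p i * (\<Prod>j\<in>UNIV - {i}. A s $ j $ p j)) =
     (if p = id then y *\<^sub>R trace A' else 0)" if p: "p permutes UNIV" for p :: "'n \<Rightarrow> 'n" and y
  proof (cases "p = id")
    case True
    thus ?thesis by (simp add: A1 mat_def trace_def sign_id scaleR_sum_right)
  next
    case False
    have "(\<Prod>j\<in>UNIV - {i}. A s $ j $ p j) = 0" for i
    proof -
      have "\<exists>j. j \<noteq> i \<and> p j \<noteq> j"
      proof (rule ccontr)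
        assume *: "\<not> ?thesis"
        have "p i = i" using * permutes_inj[OF p] by (metis injD)
        with * have "p = id" by (auto simp: fun_eq_iff)
        with False show False by simp
      qed
      then obtain j where "j \<noteq> i" "p j \<noteq> j" by blast
      thus ?thesis by (intro prod_zero) (auto simp: A1 mat_def intro!: bexI[of _ j])
    qed
    thus ?thesis using False by (simp only: mult_zero_right sum.neutral_const if_False)
  qed
  have "((\<lambda>t. det (A t)) has_derivative (\<lambda>y. \<Sum>p | p permutes UNIV. of_int (sign p) *
      (\<Sum>i\<in>UNIV. y *\<^sub>R A' $ i $ p i * (\<Prod>j\<in>UNIV - {i}. A s $ j $ p j)))) (at s)"
    unfolding det_def by (intro has_derivative_sum has_derivative_mult_right has_derivative_prod c)
  also have "(\<lambda>y. \<Sum>p | p permutes (UNIV::'n set). of_int (sign p) *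
      (\<Sum>i\<in>UNIV. y *\<^sub>R A' $ i $ p i * (\<Prod>j\<in>UNIV - {i}. A s $ j $ p j))) = (\<lambda>y. y *\<^sub>R trace A')"
  proof
    fix y
    have "(\<Sum>p | p permutes (UNIV::'n set). of_int (sign p) *
      (\<Sum>i\<in>UNIV. y *\<^sub>R A' $ i $ p i * (\<Prod>j\<in>UNIV - {i}. A s $ j $ p j))) =
      (\<Sum>p | p permutes (UNIV::'n set). if p = id then y *\<^sub>R trace A' else 0)"
      using s by (intro sum.cong) auto
    also have "\<dots> = y *\<^sub>R trace A'"
      by (subst sum.delta) (simp_all add: finite_permutations permutes_id)
    finally show "(\<Sum>p | p permutes (UNIV::'n set). of_int (sign p) *
      (\<Sum>i\<in>UNIV. y *\<^sub>R A' $ i $ p i * (\<Prod>j\<in>UNIV - {i}. A s $ j $ p j))) = y *\<^sub>R trace A'" .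
  qed
  finally show ?thesis by (simp add: has_vector_derivative_def)
qed

lemma det_has_vector_derivative:
  fixes A :: "real \<Rightarrow> complex^'n^'n"
  assumes A: "(A has_vector_derivative A') (at s)" and inv: "invertible (A s)"
  shows "((\<lambda>t. det (A t)) has_vector_derivative (det (A s) * trace (matrix_inv (A s) ** A'))) (at s)"
proof -
  have "((\<lambda>t. matrix_inv (A s) ** A t) has_vector_derivative matrix_inv (A s) ** A') (at s)"
    using bounded_linear.has_vector_derivative[OF bounded_linear_matrix_mult[of _ "mat 1"] A] by simp
  from det_has_vector_derivative_at_mat_1[OF this] have
    "((\<lambda>t. det (matrix_inv (A s) ** A t)) has_vector_derivative trace (matrix_inv (A s) ** A')) (at s)"
    using inv by (simp add: matrix_inv_left_right)
  from has_vector_derivative_mult_right[OF this, of "det (A s)"]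
  show ?thesis using inv by (simp add: det_mul det_matrix_inv invertible_det_nz mult.assoc[symmetric])
qed

lemma matrix_inv_has_vector_derivative:
  fixes A :: "real \<Rightarrow> complex^'n^'n"
  assumes A: "(A has_vector_derivative A') (at s)" and inv: "\<forall>\<^sub>F t in at s. invertible (A t)" "invertible (A s)"
  shows "((\<lambda>t. matrix_inv (A t)) has_vector_derivative - (matrix_inv (A s) ** A' ** matrix_inv (A s))) (at s)"
proof -
  have q: "((\<lambda>t. (A t - A s) /\<^sub>R (t - s)) \<longlongrightarrow> A') (at s)"
    using A by (simp add: has_vector_derivative_iff_quotient)
  have "(A \<longlongrightarrow> A s) (at s)"
    using has_vector_derivative_continuous[OF A] by (simp add: continuous_at)
  hence "((\<lambda>t. matrix_inv (A t)) \<longlongrightarrow> matrix_inv (A s)) (at s)" using inv(2) by (rule tendsto_matrix_inv)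
  from tendsto_minus[OF tendsto_matrix_mult[OF tendsto_matrix_mult[OF this q] tendsto_const[of "matrix_inv (A s)"]]]
  have "((\<lambda>t. - (matrix_inv (A t) ** ((A t - A s) /\<^sub>R (t - s)) ** matrix_inv (A s))) \<longlongrightarrow>
    - (matrix_inv (A s) ** A' ** matrix_inv (A s))) (at s)" .
  moreover have "\<forall>\<^sub>F t in at s. - (matrix_inv (A t) ** ((A t - A s) /\<^sub>R (t - s)) ** matrix_inv (A s)) =
    (matrix_inv (A t) - matrix_inv (A s)) /\<^sub>R (t - s)"
    using inv(1)
  proof eventually_elim
    case (elim t)
    have "matrix_inv (A t) ** (A t - A s) ** matrix_inv (A s) = matrix_inv (A s) - matrix_inv (A t)"
      using elim inv(2) by (simp add: matrix_diff_ldistrib matrix_diff_rdistrib matrix_mul_assoc[symmetric]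
          matrix_inv_left_right matrix_inv_cancel_mult)
    thus ?case by (simp add: matrix_scaleR_left matrix_scaleR_right scaleR_minus_right[symmetric])
  qed
  ultimately show ?thesis unfolding has_vector_derivative_iff_quotient by (rule Lim_transform_eventually)
qed

lemma logdet_has_vector_derivative:
  fixes A :: "real \<Rightarrow> complex^'n^'n"
  assumes A: "(A has_vector_derivative A') (at s)" and U: "\<forall>\<^sub>F t in at s. A t \<in> Upper" "A s \<in> Upper"
  shows "((\<lambda>t. logdet (A t)) has_vector_derivative trace (matrix_inv (A s) ** A')) (at s)"
proof -
  define r where "r t = det (A t) / det (A s)" for t
  have d0: "det (A s) \<noteq> 0" using Upper_invertible[OF U(2)] invertible_det_nz by blast
  have "((\<lambda>t. r t) has_vector_derivative trace (matrix_inv (A s) ** A')) (at s)"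
    unfolding r_def divide_inverse
    using has_vector_derivative_mult_left[OF det_has_vector_derivative[OF A Upper_invertible[OF U(2)]], of "inverse (det (A s))"]
      nonzero_mult_div_cancel_left[OF d0, of "trace (matrix_inv (A s) ** A')"] by (simp only: divide_inverse)
  moreover have "r s = 1" using d0 by (simp add: r_def)
  hence "(Ln has_field_derivative inverse 1) (at (r s))" by (auto intro: derivative_eq_intros)
  ultimately have L: "((Ln \<circ> r) has_vector_derivative (trace (matrix_inv (A s) ** A') * inverse 1)) (at s)"
    by (intro field_vector_diff_chain_at)
  have "(A \<longlongrightarrow> A s) (at s)"
    using has_vector_derivative_continuous[OF A] by (simp add: continuous_at)
  hence l: "((\<lambda>t. logdet (A t)) \<longlongrightarrow> logdet (A s)) (at s)"
    using continuous_on_tendsto_compose[OF continuous_on_logdet _ U(2) U(1)] by blast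
  hence "((\<lambda>t. Im (logdet (A t) - logdet (A s))) \<longlongrightarrow> Im (logdet (A s) - logdet (A s))) (at s)"
    by (intro tendsto_intros)
  hence "\<forall>\<^sub>F t in at s. dist (Im (logdet (A t) - logdet (A s))) 0 < pi"
    using tendstoD[of _ _ _ pi] by fastforce
  with U(1) have "\<forall>\<^sub>F t in at s. ((Ln \<circ> r) t - (Ln \<circ> r) s) /\<^sub>R (t - s) = (logdet (A t) - logdet (A s)) /\<^sub>R (t - s)"
  proof eventually_elim
    case (elim t)
    have "exp (logdet (A t) - logdet (A s)) = r t" using elim U(2) by (simp add: exp_diff exp_logdet r_def)
    hence "Ln (r t) = logdet (A t) - logdet (A s)"
      using elim Ln_exp[of "logdet (A t) - logdet (A s)"] by (simp add: abs_less_iff)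
    thus ?case by (simp add: \<open>r s = 1\<close>)
  qed
  from Lim_transform_eventually[OF L[unfolded has_vector_derivative_iff_quotient] this]
  show ?thesis by (simp add: has_vector_derivative_iff_quotient)
qed

text \<open>The diagonal blocks of \<open>E + i s - H\<close>.\<close>

definition site :: "real \<Rightarrow> (nat \<Rightarrow> complex^'m^'m) \<Rightarrow> real \<Rightarrow> nat \<Rightarrow> complex^'m^'m" where
  "site E F s j = mat (Complex E s) - F j"

lemma site_im_ge:
  assumes "\<And>j. hermitian (F j)" shows "im_ge s (site E F s j)"
  using im_ge_add[OF im_ge_mat[of "Complex E s"] im_ge_hermitian(2)[OF assms[of j]]] by (simp add: site_def)

lemma mat_has_vector_derivative: "((\<lambda>s. mat (Complex E s) - F) has_vector_derivative mat \<i>) (at s)" for F :: "complex^'m^'m"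
proof -
  have "((\<lambda>t. mat \<i>) \<longlongrightarrow> (mat \<i> :: complex^'m^'m)) (at s)" by simp
  moreover have "\<forall>\<^sub>F t in at s. mat \<i> = ((mat (Complex E t) - F) - (mat (Complex E s) - F)) /\<^sub>R (t - s)"
    unfolding eventually_at_filter
    by (intro always_eventually allI impI) (auto simp: vec_eq_iff mat_def complex_eq_iff)
  ultimately show ?thesis unfolding has_vector_derivative_iff_quotient by (rule Lim_transform_eventually)
qed

lemma riccati_has_vector_derivative:
  fixes C :: "complex^'m^'m" and E :: real
  assumes F: "\<And>j. hermitian (F j)" and s: "0 < s"
  defines "L \<equiv> \<lambda>t. riccati C (site E F t) (site E F t 0)"
  shows "((\<lambda>t. L t j) has_vector_derivative mat \<i> ** driccati C (L s) j) (at s)"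
proof (induction j)
  case 0
  show ?case using mat_has_vector_derivative[of E "F 0" s] by (simp add: L_def site_def)
next
  case (Suc j)
  have U: "L t j \<in> Upper" if "t > 0" for t
    unfolding L_def using that F by (intro riccati_Upper im_ge_Upper[OF site_im_ge]) auto
  have "\<forall>\<^sub>F t in at s. t > 0" using s by (intro order_tendstoD tendsto_ident_at) auto
  hence "\<forall>\<^sub>F t in at s. invertible (L t j)" by eventually_elim (intro Upper_invertible U)
  from matrix_inv_has_vector_derivative[OF Suc this Upper_invertible[OF U[OF s]]]
  have "((\<lambda>t. matrix_inv (L t j)) has_vector_derivative
     - (matrix_inv (L s j) ** (mat \<i> ** driccati C (L s) j) ** matrix_inv (L s j))) (at s)" .
  from has_vector_derivative_diff[OF mat_has_vector_derivative[of E "F (Suc j)" s]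
      bounded_linear.has_vector_derivative[OF bounded_linear_matrix_mult[of "adjoint_mat C" C] this]]
  have "((\<lambda>t. L t (Suc j)) has_vector_derivative mat \<i> -
     adjoint_mat C ** - (matrix_inv (L s j) ** (mat \<i> ** driccati C (L s) j) ** matrix_inv (L s j)) ** C) (at s)"
    by (simp add: L_def site_def)
  also have "mat \<i> - adjoint_mat C ** - (matrix_inv (L s j) ** (mat \<i> ** driccati C (L s) j) ** matrix_inv (L s j)) ** C
     = mat \<i> + (adjoint_mat C ** matrix_inv (L s j)) ** mat \<i> ** (driccati C (L s) j ** (matrix_inv (L s j) ** C))"
    by (simp add: matrix_mult_uminus_left matrix_mult_uminus_right matrix_mul_assoc)
  also have "\<dots> = mat \<i> ** driccati C (L s) (Suc j)"
    by (simp add: mult_mat_commute[of "adjoint_mat C ** _"] matrix_add_ldistrib matrix_mul_assoc)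
  finally show ?case .
qed

lemma trace_mat_mult: "trace (mat c ** A) = c * trace (A :: complex^'n^'n)"
  by (simp add: trace_def mat_mult_component sum_distrib_left)

text \<open>In direction \<open>s\<close> each block moves with derivative \<open>\<i>\<close>, so the derivative of the
  logarithmic determinant is \<open>\<i>\<close> times the trace of the inverse, and its imaginary part is the
  real part of that trace.\<close>

lemma phase_sum_has_derivative:
  fixes C :: "complex^'m^'m"
  assumes F: "\<And>j. hermitian (F j)" and s: "0 < s"
  shows "((\<lambda>t. phase_sum C (site E F t) (site E F t 0) n) has_real_derivative
    (\<Sum>l<n. Re (trace (green C (riccati C (site E F s) (site E F s 0)) l (n - Suc l))))) (at s)"
proof -
  define L where "L = (\<lambda>t. riccati C (site E F t) (site E F t 0))"
  have U: "L t j \<in> Upper" if "t > 0" for t j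
    unfolding L_def using that F by (intro riccati_Upper im_ge_Upper[OF site_im_ge]) auto
  have ev: "\<forall>\<^sub>F t in at s. t > 0" using s by (intro order_tendstoD tendsto_ident_at) auto
  have "((\<lambda>t. logdet (L t j)) has_vector_derivative trace (matrix_inv (L s j) ** (mat \<i> ** driccati C (L s) j))) (at s)" for j
  proof (rule logdet_has_vector_derivative)
    show "((\<lambda>t. L t j) has_vector_derivative mat \<i> ** driccati C (L s) j) (at s)"
      unfolding L_def by (rule riccati_has_vector_derivative[OF F s])
    show "\<forall>\<^sub>F t in at s. L t j \<in> Upper" using ev by eventually_elim (rule U)
  qed (use U s in auto)
  also have "trace (matrix_inv (L s j) ** (mat \<i> ** driccati C (L s) j)) = \<i> * trace (matrix_inv (L s j) ** driccati C (L s) j)" for j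
    by (simp add: matrix_mul_assoc mult_mat_commute) (simp add: matrix_mul_assoc[symmetric] trace_mat_mult)
  finally have d: "((\<lambda>t. logdet (L t j)) has_vector_derivative \<i> * trace (matrix_inv (L s j) ** driccati C (L s) j)) (at s)" for j .
  have "((\<lambda>t. Im (logdet (L t j))) has_vector_derivative Im (\<i> * trace (matrix_inv (L s j) ** driccati C (L s) j))) (at s)" for j
    by (rule bounded_linear.has_vector_derivative[OF bounded_linear_Im d])
  hence "((\<lambda>t. \<Sum>j<n. Im (logdet (L t j))) has_real_derivative (\<Sum>j<n. Re (trace (matrix_inv (L s j) ** driccati C (L s) j)))) (at s)"
    by (intro DERIV_sum) (simp add: has_real_derivative_iff_has_vector_derivative)
  also have "(\<Sum>j<n. Re (trace (matrix_inv (L s j) ** driccati C (L s) j))) =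
     (\<Sum>l<n. Re (trace (green C (L s) l (n - Suc l))))"
    using trace_green_sum_0[of "L s" C n] by (simp add: Re_sum[symmetric] del: Re_sum)
  finally show ?thesis by (simp add: phase_sum_def L_def)
qed

text \<open>For large \<open>s\<close> the pivots are \<open>\<i> s\<close> up to an error that is bounded uniformly in
  \<open>j\<close> and in the potential. Division by \<open>s\<close> does not change the phase.\<close>

lemma riccati_phase_asymptotic:
  fixes C :: "complex^'m^'m"
  assumes "0 < \<epsilon>"
  shows "\<exists>S>0. \<forall>s\<ge>S. \<forall>F j. (\<forall>j. hermitian (F j)) \<longrightarrow> (\<forall>j. norm (F j) \<le> B) \<longrightarrow>
    \<bar>Im (logdet (riccati C (site E F s) (site E F s 0) j)) - real CARD('m) * pi / 2\<bar> < \<epsilon>"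
proof -
  have iU: "mat \<i> \<in> (Upper :: (complex^'m^'m) set)" by (simp add: mat_Upper)
  have "\<exists>d>0. \<forall>A\<in>Upper. dist A (mat \<i> :: complex^'m^'m) < d \<longrightarrow> dist (logdet A) (logdet (mat \<i> :: complex^'m^'m)) < \<epsilon>"
    by (rule continuous_on_logdet[unfolded continuous_on_iff, THEN bspec, OF iU, THEN spec, THEN mp, OF assms])
  then obtain \<delta> where \<delta>: "\<delta> > 0" "\<And>A. A \<in> Upper \<Longrightarrow> dist A (mat \<i> :: complex^'m^'m) < \<delta> \<Longrightarrow> dist (logdet A) (logdet (mat \<i> :: complex^'m^'m)) < \<epsilon>"
    by auto
  define c where "c = real (CARD('m) * CARD('m))"
  define KC where "KC = c * norm C"
  define KC' where "KC' = c * norm (adjoint_mat C)"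
  have KC: "norm (C *v v) \<le> KC * norm v" for v unfolding KC_def c_def by (rule norm_matrix_vector_le)
  have KC': "norm (adjoint_mat C *v v) \<le> KC' * norm v" for v unfolding KC'_def c_def by (rule norm_matrix_vector_le)
  have nn: "0 \<le> c" "0 \<le> KC" "0 \<le> KC'" by (auto simp: c_def KC_def KC'_def)
  define K where "K = norm (mat (of_real E) :: complex^'m^'m) + \<bar>B\<bar> + c * (KC' * KC)"
  define S where "S = max 1 (K / \<delta> + 1)"
  have "\<bar>Im (logdet (riccati C (site E F s) (site E F s 0) j)) - real CARD('m) * pi / 2\<bar> < \<epsilon>"
    if s: "s \<ge> S" and F: "\<forall>j. hermitian (F j)" "\<forall>j. norm (F j) \<le> B" for s F j
  proof -
    define L where "L = riccati C (site E F s) (site E F s 0)"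
    have s1: "s \<ge> 1" "K / \<delta> < s" using s by (auto simp: S_def)
    have im: "im_ge s (L i)" for i
      unfolding L_def using s1 F by (intro riccati_im_ge site_im_ge) auto
    have U: "L i \<in> Upper" for i using im_ge_Upper[OF im] s1 by auto
    define R where "R = L j - mat (of_real s * \<i>)"
    have "norm R \<le> K"
    proof (cases j)
      case 0
      have "R = mat (of_real E) - F 0" by (simp add: R_def L_def 0 site_def vec_eq_iff mat_def complex_eq_iff)
      hence "norm R \<le> norm (mat (of_real E) :: complex^'m^'m) + norm (F 0)" by (simp add: norm_triangle_ineq4)
      moreover have "norm (F 0) \<le> \<bar>B\<bar>" using F(2)[rule_format, of 0] by linarith
      moreover have "0 \<le> c * (KC' * KC)" using nn by simp
      ultimately show ?thesis unfolding K_def by linarith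
    next
      case (Suc i)
      define X where "X = adjoint_mat C ** matrix_inv (L i) ** C"
      have "norm (X *v v) \<le> (KC' * KC) * norm v" for v
      proof -
        have "norm (X *v v) = norm (adjoint_mat C *v (matrix_inv (L i) *v (C *v v)))"
          by (simp add: X_def matrix_vector_mul_assoc matrix_mul_assoc)
        also have "\<dots> \<le> KC' * norm (matrix_inv (L i) *v (C *v v))" by (rule KC')
        also have "\<dots> \<le> KC' * (norm (C *v v) / s)" using nn s1 by (intro mult_left_mono im_ge_inv_norm_le[OF im]) auto
        also have "\<dots> \<le> KC' * norm (C *v v)" 
          using nn s1 mult_right_mono[of 1 s "norm (C *v v)"] by (intro mult_left_mono) (auto simp: field_simps)
        also have "\<dots> \<le> KC' * (KC * norm v)" using nn KC by (intro mult_left_mono) auto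
        finally show ?thesis by simp
      qed
      hence X: "norm X \<le> c * (KC' * KC)" unfolding c_def by (rule norm_matrix_le)
      have "R = (mat (of_real E) - F j) - X"
        by (simp add: R_def L_def Suc site_def X_def vec_eq_iff mat_def complex_eq_iff)
      hence "norm R \<le> norm (mat (of_real E) :: complex^'m^'m) + norm (F j) + norm X"
        by (metis add_right_mono norm_triangle_ineq4 order_trans)
      moreover have "norm (F j) \<le> \<bar>B\<bar>" using F(2)[rule_format, of j] by linarith
      ultimately show ?thesis unfolding K_def using X by linarith
    qed
    define A where "A = inverse s *\<^sub>R L j"
    have AU: "A \<in> Upper" unfolding A_def using s1 by (intro Upper_scaleR U) auto
    have "A - mat \<i> = inverse s *\<^sub>R R"
      using s1 by (simp add: A_def R_def vec_eq_iff mat_def scaleR_conv_of_real[where 'a=complex] algebra_simps)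
    hence "dist A (mat \<i>) = norm R / s" using s1 by (simp add: dist_norm divide_inverse mult.commute)
    also have "\<dots> \<le> K / s" using \<open>norm R \<le> K\<close> s1 by (intro divide_right_mono) auto
    also have "\<dots> < \<delta>" using s1 \<delta>(1) by (simp add: field_simps)
    finally have "dist (logdet A) (logdet (mat \<i> :: complex^'m^'m)) < \<epsilon>" by (rule \<delta>(2)[OF AU])
    hence "\<bar>Im (logdet A - logdet (mat \<i> :: complex^'m^'m))\<bar> < \<epsilon>"
      using abs_Im_le_cmod[of "logdet A - logdet (mat \<i> :: complex^'m^'m)"] by (simp add: dist_norm)
    moreover have "L j = s *\<^sub>R A" using s1 by (simp add: A_def)
    hence "Im (logdet (L j)) = Im (logdet A)" using s1 by (simp add: logdet_scaleR[OF AU])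
    ultimately show ?thesis by (simp add: L_def logdet_i)
  qed
  moreover have "S > 0" by (simp add: S_def)
  ultimately show ?thesis by blast
qed

lemma continuous_on_riccati:
  fixes C :: "complex^'m^'m" and a :: "'b::topological_space \<Rightarrow> nat \<Rightarrow> complex^'m^'m"
  assumes "\<And>j. continuous_on S (\<lambda>x. a x j)" "\<And>x j. x \<in> S \<Longrightarrow> a x j \<in> Upper"
  shows "continuous_on S (\<lambda>x. riccati C (a x) (a x 0) j)"
proof (induction j)
  case (Suc j)
  show ?case
    unfolding riccati.simps
    by (intro continuous_on_diff continuous_on_matrix_mult continuous_on_matrix_inv continuous_on_const
        assms(1) Suc Upper_invertible riccati_Upper assms(2))
qed (use assms in simp)

lemma continuous_on_green:
  fixes L :: "'b::topological_space \<Rightarrow> nat \<Rightarrow> complex^'m^'m"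
  assumes "\<And>j. continuous_on S (\<lambda>x. L x j)" "\<And>x j. x \<in> S \<Longrightarrow> invertible (L x j)"
  shows "continuous_on S (\<lambda>x. green C (L x) j d)"
proof (induction d arbitrary: j)
  case 0
  show ?case unfolding green.simps by (intro continuous_on_matrix_inv assms)
next
  case (Suc d)
  show ?case unfolding green.simps
    by (intro continuous_on_add continuous_on_matrix_mult continuous_on_matrix_inv continuous_on_const assms Suc)
qed

section \<open>The resolvent as a square summable solution\<close>

lemma ell2_comparison:
  assumes "(\<lambda>n. c n) summable_on (UNIV :: int set)" "\<And>n. (norm (u n))\<^sup>2 \<le> c n"
  shows "u \<in> ell2"
  unfolding ell2_def mem_Collect_eq by (rule summable_on_comparison_test[OF assms(1)]) (use assms(2) in auto)

lemma ell2_add: 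
  assumes "u \<in> ell2" "v \<in> ell2" shows "(\<lambda>n. u n + v n) \<in> ell2"
proof (rule ell2_comparison)
  show "(\<lambda>n. 2 * (norm (u n))\<^sup>2 + 2 * (norm (v n))\<^sup>2) summable_on UNIV"
    using assms by (intro summable_on_add summable_on_cmult_right) (auto simp: ell2_def)
  fix n
  have "(norm (u n + v n))\<^sup>2 \<le> (norm (u n) + norm (v n))\<^sup>2" by (intro power_mono norm_triangle_ineq) auto
  also have "\<dots> \<le> 2 * (norm (u n))\<^sup>2 + 2 * (norm (v n))\<^sup>2"
    using sum_squares_bound[of "norm (u n)" "norm (v n)"] by (simp add: power2_sum)
  finally show "(norm (u n + v n))\<^sup>2 \<le> 2 * (norm (u n))\<^sup>2 + 2 * (norm (v n))\<^sup>2" .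
qed

lemma ell2_matrix:
  fixes A :: "int \<Rightarrow> complex^'m^'k"
  assumes "u \<in> ell2" "\<And>n. norm (A n) \<le> B" shows "(\<lambda>n. A n *v u n) \<in> ell2"
proof (rule ell2_comparison)
  define K where "K = real (CARD('k) * CARD('m)) * B"
  show "(\<lambda>n. K\<^sup>2 * (norm (u n))\<^sup>2) summable_on UNIV"
    using assms by (intro summable_on_cmult_right) (auto simp: ell2_def)
  fix n
  have "norm (A n *v u n) \<le> real (CARD('k) * CARD('m)) * norm (A n) * norm (u n)" by (rule norm_matrix_vector_le)
  also have "\<dots> \<le> K * norm (u n)" unfolding K_def using assms(2) by (intro mult_right_mono mult_left_mono) auto
  finally have "(norm (A n *v u n))\<^sup>2 \<le> (K * norm (u n))\<^sup>2" by (intro power_mono) auto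
  thus "(norm (A n *v u n))\<^sup>2 \<le> K\<^sup>2 * (norm (u n))\<^sup>2" by (simp add: power_mult_distrib)
qed

lemma ell2_shift:
  assumes "u \<in> ell2" shows "(\<lambda>n. u (n + k)) \<in> ell2"
proof -
  have "bij_betw (\<lambda>n. n + k) UNIV (UNIV :: int set)" by (rule bij_betwI[of _ _ _ "\<lambda>n. n - k"]) auto
  from summable_on_reindex_bij_betw[OF this, of "\<lambda>n. (norm (u n))\<^sup>2"] assms
  show ?thesis by (simp add: ell2_def)
qed

lemma ell2_diff: "u \<in> ell2 \<Longrightarrow> v \<in> ell2 \<Longrightarrow> (\<lambda>n. u n - v n) \<in> ell2"
  using ell2_add[of u "\<lambda>n. - v n"] by (simp add: ell2_def)

lemma norm_le_ell2_norm:
  assumes "u \<in> ell2" shows "norm (u j) \<le> ell2_norm u"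
proof -
  have "sum (\<lambda>n. (norm (u n))\<^sup>2) {j} \<le> (\<Sum>\<^sub>\<infinity>n. (norm (u n))\<^sup>2)"
    using assms by (intro finite_sum_le_infsum) (auto simp: ell2_def)
  thus ?thesis unfolding ell2_norm_def by (intro real_le_rsqrt) simp
qed

lemma ell2_norm_tendsto_pointwise:
  assumes "\<And>n. (\<lambda>j. U n j - v j) \<in> ell2" "(\<lambda>n. ell2_norm (\<lambda>j. U n j - v j)) \<longlonglongrightarrow> 0"
  shows "(\<lambda>n. U n j) \<longlonglongrightarrow> v j"
proof -
  have "(\<lambda>n. U n j - v j) \<longlonglongrightarrow> 0"
    by (rule Lim_null_comparison[OF _ assms(2)]) (auto intro!: always_eventually norm_le_ell2_norm[OF assms(1)])
  thus ?thesis by (simp add: LIM_zero_iff)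
qed

lemma ell2_tendsto_0:
  assumes u: "u \<in> ell2" and h: "inj (h :: nat \<Rightarrow> int)"
  shows "(\<lambda>k. norm (u (h k))) \<longlonglongrightarrow> 0"
proof -
  have "(\<lambda>n. (norm (u n))\<^sup>2) summable_on range h"
    using u by (auto simp: ell2_def intro: summable_on_subset_banach)
  hence "((\<lambda>n. (norm (u n))\<^sup>2) \<circ> h) summable_on UNIV" by (rule summable_on_reindex[OF h, THEN iffD1])
  hence "summable (\<lambda>k. (norm (u (h k)))\<^sup>2)"
    by (simp add: summable_on_UNIV_nonneg_real_iff o_def)
  hence "(\<lambda>k. (norm (u (h k)))\<^sup>2) \<longlonglongrightarrow> 0" by (rule summable_LIMSEQ_zero)
  from tendsto_real_sqrt[OF this] show ?thesis by simp
qed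

lemma delta0_ell2: "delta0 i \<in> ell2"
proof -
  have "(\<lambda>n. (norm (delta0 i n))\<^sup>2) summable_on {0}" by simp
  hence "(\<lambda>n. (norm (delta0 i n))\<^sup>2) summable_on UNIV"
    by (rule summable_on_cong_neutral[THEN iffD1, rotated -1]) (auto simp: delta0_def)
  thus ?thesis by (simp add: ell2_def)
qed

lemma ell2_inner_delta0: "ell2_inner (delta0 i) v = v 0 $ i"
proof -
  have z: "(\<Sum>l\<in>UNIV. cnj (delta0 i n $ l) * v n $ l) = (if n = 0 then v 0 $ i else 0)" for n
    by (simp add: delta0_def axis_def if_distrib[of cnj] if_distrib[of "\<lambda>x. x * _"] cong: if_cong)
  have "ell2_inner (delta0 i) v = infsum (\<lambda>n. if n = 0 then v 0 $ i else 0) (UNIV :: int set)"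
    unfolding ell2_inner_def z ..
  also have "\<dots> = infsum (\<lambda>n. if n = 0 then v 0 $ i else 0) {0::int}"
    by (rule infsum_cong_neutral) auto
  finally show ?thesis by simp
qed

definition resolvent_fun :: "complex \<Rightarrow> real \<Rightarrow> complex" where
  "resolvent_fun z x = 1 / (z - of_real x)"

lemma bounded_borelI:
  assumes "g \<in> borel_measurable borel" "\<And>x. norm (g x) \<le> K" shows "g \<in> bounded_borel"
  using assms by (auto simp: bounded_borel_def bounded_iff)

lemma norm_resolvent_fun_le:
  assumes "0 < Im z" shows "norm (resolvent_fun z x) \<le> 1 / Im z" "norm (of_real x * resolvent_fun z x) \<le> norm z / Im z + 1"
proof -
  have i: "Im z \<le> norm (z - of_real x)" using abs_Im_le_cmod[of "z - of_real x"] by simp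
  thus 1: "norm (resolvent_fun z x) \<le> 1 / Im z"
    using assms by (simp add: resolvent_fun_def norm_divide frac_le)
  have "z - of_real x \<noteq> 0" using i assms by force
  hence "of_real x * resolvent_fun z x = z * resolvent_fun z x - 1" by (simp add: resolvent_fun_def field_simps)
  hence "norm (of_real x * resolvent_fun z x) \<le> norm z * norm (resolvent_fun z x) + 1"
    by (metis norm_mult norm_one norm_triangle_ineq4)
  also have "\<dots> \<le> norm z * (1 / Im z) + 1" using 1 by (intro add_right_mono mult_left_mono) auto
  finally show "norm (of_real x * resolvent_fun z x) \<le> norm z / Im z + 1" by simp
qed

lemma resolvent_fun_measurable: "resolvent_fun z \<in> borel_measurable borel"
  unfolding resolvent_fun_def[abs_def] by measurable

text \<open>The functional calculus knows the unbounded function \<open>x\<close> only through its truncations. Their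
  products with the resolvent function are bounded uniformly and converge to
  \<open>x / (z - x) = z / (z - x) - 1\<close>, which gives the resolvent equation.\<close>

lemma resolvent_solution:
  fixes H :: "(int \<Rightarrow> complex^'m) \<Rightarrow> (int \<Rightarrow> complex^'m)"
  assumes fc: "borel_functional_calculus H \<Phi>" and H: "\<And>u. u \<in> ell2 \<Longrightarrow> H u \<in> ell2"
    and z: "0 < Im z" and w: "w \<in> ell2"
  shows "\<Phi> (resolvent_fun z) w \<in> ell2"
    and "z *s \<Phi> (resolvent_fun z) w n - H (\<Phi> (resolvent_fun z) w) n = w n"
proof -
  define g where "g = resolvent_fun z"
  define g' where "g' x = of_real x * g x" for x :: real
  define idn where "idn n x = (if \<bar>x\<bar> \<le> real n then complex_of_real x else 0)" for n x
  define G where "G n x = idn n x * g x" for n x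
  have bd: "g \<in> bounded_borel" "g' \<in> bounded_borel"
    unfolding g_def g'_def using norm_resolvent_fun_le[OF z] resolvent_fun_measurable
    by (auto intro!: bounded_borelI borel_measurable_times)
  have m: "idn n \<in> borel_measurable borel" for n unfolding idn_def by measurable
  have bi: "idn n \<in> bounded_borel" for n
    by (rule bounded_borelI[of _ "real n"]) (use m in \<open>auto simp: idn_def\<close>)
  have Gle: "norm (G n x) \<le> norm z / Im z + 1" for n x
    using norm_resolvent_fun_le(2)[OF z, of x] z by (auto simp: G_def idn_def g_def)
  have bG: "G n \<in> bounded_borel" for n
    by (rule bounded_borelI[OF _ Gle]) (use m bd in \<open>auto simp: G_def bounded_borel_def intro!: borel_measurable_times\<close>)
  have c1: "(\<lambda>x. c) \<in> bounded_borel" for c :: complex by (rule bounded_borelI) auto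
  note fc' = fc[unfolded borel_functional_calculus_def]
  note p1 = fc'[THEN conjunct1] and p2 = fc'[THEN conjunct2, THEN conjunct1]
    and p3 = fc'[THEN conjunct2, THEN conjunct2, THEN conjunct1]
    and p4 = fc'[THEN conjunct2, THEN conjunct2, THEN conjunct2, THEN conjunct1]
    and p67 = fc'[THEN conjunct2, THEN conjunct2, THEN conjunct2, THEN conjunct2, THEN conjunct2]
  have bop: "\<And>h u. h \<in> bounded_borel \<Longrightarrow> u \<in> ell2 \<Longrightarrow> \<Phi> h u \<in> ell2"
    using p1 by (simp add: bounded_operator_def)
  have lin: "\<And>g h a u. g \<in> bounded_borel \<Longrightarrow> h \<in> bounded_borel \<Longrightarrow> u \<in> ell2 \<Longrightarrow>
    \<Phi> (\<lambda>x. a * g x + h x) u = (\<lambda>n. a *s \<Phi> g u n + \<Phi> h u n)" by (rule p2[rule_format])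
  have mul: "\<And>g h u. g \<in> bounded_borel \<Longrightarrow> h \<in> bounded_borel \<Longrightarrow> u \<in> ell2 \<Longrightarrow>
    \<Phi> (\<lambda>x. g x * h x) u = \<Phi> g (\<Phi> h u)" by (rule p3[rule_format])
  have one: "\<Phi> (\<lambda>x. 1) w = w" by (rule p4[rule_format, OF w])
  define v where "v = \<Phi> g w"
  have v: "v \<in> ell2" unfolding v_def by (rule bop[OF bd(1) w])
  show "\<Phi> (resolvent_fun z) w \<in> ell2" using v by (simp add: v_def g_def)
  have "(\<lambda>n. ell2_norm (\<lambda>j. \<Phi> (idn n) v j - H v j)) \<longlonglongrightarrow> 0"
    unfolding idn_def by (rule p67[THEN conjunct2, rule_format, OF v])
  hence A: "(\<lambda>n. \<Phi> (idn n) v j) \<longlonglongrightarrow> H v j" for j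
    by (rule ell2_norm_tendsto_pointwise[rotated]) (intro ell2_diff bop bi v H)
  have conv: "(\<lambda>n. G n x) \<longlonglongrightarrow> g' x" for x
  proof (rule tendsto_eventually)
    obtain N where "\<bar>x\<bar> \<le> real N" using real_arch_simple by blast
    thus "\<forall>\<^sub>F n in sequentially. G n x = g' x"
      unfolding eventually_sequentially by (intro exI[of _ N]) (auto simp: G_def idn_def g'_def)
  qed
  have "(\<forall>n. G n \<in> bounded_borel) \<and> g' \<in> bounded_borel \<and>
        (\<exists>K. \<forall>n x. norm (G n x) \<le> K) \<and> (\<forall>x. (\<lambda>n::nat. G n x) \<longlonglongrightarrow> g' x)"
    using bG bd(2) Gle conv by blast
  hence "(\<lambda>n. ell2_norm (\<lambda>j. \<Phi> (G n) w j - \<Phi> g' w j)) \<longlonglongrightarrow> 0"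
    by (rule p67[THEN conjunct1, rule_format, OF _ w])
  hence B: "(\<lambda>n. \<Phi> (G n) w j) \<longlonglongrightarrow> \<Phi> g' w j" for j
    by (rule ell2_norm_tendsto_pointwise[rotated]) (intro ell2_diff bop bG bd w)
  have "\<Phi> (G n) w = \<Phi> (idn n) v" for n
    unfolding G_def v_def by (rule mul[OF bi bd(1) w])
  hence Hv: "H v j = \<Phi> g' w j" for j using LIMSEQ_unique[OF A[of j]] B[of j] by simp
  have z0: "z - of_real x \<noteq> 0" for x using z by (metis Im_complex_of_real eq_iff_diff_eq_0 less_irrefl)
  have zero: "\<Phi> (\<lambda>x. 0) w = (\<lambda>n. 0)"
    using lin[OF c1[of 1] c1[of 1] w, of "-1"] one by (simp add: vec_eq_iff)
  have neg: "\<Phi> (\<lambda>x. - 1) w = (\<lambda>n. - w n)"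
    using lin[OF c1[of 1] c1[of 0] w, of "-1"] one zero by (simp add: vec_eq_iff fun_eq_iff)
  have "g' = (\<lambda>x. z * g x + - 1)" unfolding g'_def g_def resolvent_fun_def using z0 by (auto simp: field_simps)
  hence "\<Phi> g' w = (\<lambda>n. z *s \<Phi> g w n + - w n)" using lin[OF bd(1) c1[of "-1"] w, of z] neg by simp
  thus "z *s \<Phi> (resolvent_fun z) w n - H (\<Phi> (resolvent_fun z) w) n = w n"
    using Hv[of n] by (simp add: v_def g_def)
qed

lemma schrodinger_ell2:
  fixes C :: "complex^'m^'m"
  assumes "\<And>\<theta>. norm (f0 \<theta>) \<le> B" "u \<in> ell2"
  shows "schrodinger_operator T C f0 \<theta> u \<in> ell2"
  unfolding schrodinger_operator_def
proof (intro ell2_add)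
  show "(\<lambda>n. adjoint_mat C *v u (n - 1)) \<in> ell2"
    using ell2_matrix[OF ell2_shift[OF assms(2), of "-1"], of "\<lambda>_. adjoint_mat C" "norm (adjoint_mat C)"] by simp
  show "(\<lambda>n. f0 (int_iterate T n \<theta>) *v u n) \<in> ell2"
    using ell2_matrix[OF assms(2), of "\<lambda>n. f0 (int_iterate T n \<theta>)" B] assms(1) by simp
  show "(\<lambda>n. C *v u (n + 1)) \<in> ell2"
    using ell2_matrix[OF ell2_shift[OF assms(2), of 1], of "\<lambda>_. C" "norm C"] by simp
qed

section \<open>Averages over the base\<close>

text \<open>All but \<open>2 N\<close> of the \<open>n\<close> positions are at distance at least \<open>N\<close> from
  both ends of the box.\<close>

lemma cesaro_two_sided:
  fixes x :: "nat \<Rightarrow> nat \<Rightarrow> real"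
  assumes lim: "\<And>\<epsilon>. 0 < \<epsilon> \<Longrightarrow> \<exists>N. \<forall>k\<ge>N. \<forall>d\<ge>N. \<bar>x k d - l\<bar> < \<epsilon>"
    and bd: "\<And>k d. \<bar>x k d\<bar> \<le> B"
  shows "(\<lambda>n. (\<Sum>k<n. x k (n - Suc k)) / real n) \<longlonglongrightarrow> l"
proof (rule LIMSEQ_I)
  fix r :: real assume r: "0 < r"
  obtain N where N: "\<And>k d. k \<ge> N \<Longrightarrow> d \<ge> N \<Longrightarrow> \<bar>x k d - l\<bar> < r / 2" using lim[of "r/2"] r by auto
  define D where "D = B + \<bar>l\<bar>"
  have D: "\<bar>x k d - l\<bar> \<le> D" for k d 
    using bd[of k d] abs_triangle_ineq4[of "x k d" l] by (simp add: D_def)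
  have D0: "0 \<le> D" using D[of 0 0] abs_ge_zero order_trans by blast
  obtain n0 :: nat where n0: "4 * real N * D / r < real n0" using reals_Archimedean2 by blast
  have "norm ((\<Sum>k<n. x k (n - Suc k)) / real n - l) < r" if n: "n \<ge> Suc n0" for n
  proof -
    have n1: "0 < real n" "4 * real N * D / r < real n" using n n0 by auto
    have "\<bar>x k (n - Suc k) - l\<bar> \<le> r / 2 + (if k < N then D else 0) + (if n - Suc k < N then D else 0)" if "k < n" for k
    proof (cases "k < N \<or> n - Suc k < N")
      case True
      thus ?thesis using D[of k "n - Suc k"] D0 r by auto
    next
      case False
      thus ?thesis using N[of k "n - Suc k"] by auto
    qed
    hence "(\<Sum>k<n. \<bar>x k (n - Suc k) - l\<bar>) \<le> (\<Sum>k<n. r / 2 + (if k < N then D else 0) + (if n - Suc k < N then D else 0))"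
      by (intro sum_mono) auto
    also have "\<dots> = real n * (r / 2) + (\<Sum>k<n. if k < N then D else 0) + (\<Sum>k<n. if n - Suc k < N then D else 0)"
      by (simp add: sum.distrib)
    also have "(\<Sum>k<n. if n - Suc k < N then D else 0) = (\<Sum>k<n. if k < N then D else 0)"
      using sum.nat_diff_reindex[of "\<lambda>k. if k < N then D else 0" n] by simp
    also have "(\<Sum>k<n. if k < N then D else 0) = (\<Sum>k\<in>{..<n} \<inter> {k. k < N}. D)"
      using sum.inter_restrict[of "{..<n}" "\<lambda>_. D" "{k. k < N}"] by simp
    also have "\<dots> \<le> real N * D"
    proof -
      have "card ({..<n} \<inter> {k. k < N}) \<le> card {..<N}" by (intro card_mono) auto
      thus ?thesis using D0 by (simp add: mult_right_mono)
    qed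
    finally have "(\<Sum>k<n. \<bar>x k (n - Suc k) - l\<bar>) \<le> real n * (r / 2) + 2 * (real N * D)" by (simp add: algebra_simps)
    also have "\<dots> < real n * r" using n1 r by (simp add: field_simps)
    finally have 1: "(\<Sum>k<n. \<bar>x k (n - Suc k) - l\<bar>) < real n * r" .
    have "(\<Sum>k<n. x k (n - Suc k)) / real n - l = (\<Sum>k<n. x k (n - Suc k) - l) / real n"
      using n1 by (simp add: sum_subtractf field_simps)
    hence "norm ((\<Sum>k<n. x k (n - Suc k)) / real n - l) = \<bar>\<Sum>k<n. x k (n - Suc k) - l\<bar> / real n" by simp
    also have "\<dots> \<le> (\<Sum>k<n. \<bar>x k (n - Suc k) - l\<bar>) / real n" by (intro divide_right_mono sum_abs) auto
    also have "\<dots> < r" using 1 n1 by (simp add: field_simps)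
    finally show ?thesis .
  qed
  thus "\<exists>no. \<forall>n\<ge>no. norm ((\<Sum>k<n. x k (n - Suc k)) / real n - l) < r" by blast
qed

text \<open>Difference quotients are bounded by the derivative through the mean value theorem, so dominated convergence
  applies.\<close>

lemma derivative_under_integral:
  fixes g :: "real \<Rightarrow> 'a \<Rightarrow> real"
  assumes M: "finite_measure M"
    and meas: "\<And>s. 0 < s \<Longrightarrow> g s \<in> borel_measurable M"
    and int: "\<And>s. 0 < s \<Longrightarrow> integrable M (g s)"
    and der: "\<And>s x. 0 < s \<Longrightarrow> ((\<lambda>s. g s x) has_real_derivative g' s x) (at s)"
    and bd: "\<And>s0 s x. 0 < s0 \<Longrightarrow> s0 \<le> s \<Longrightarrow> \<bar>g' s x\<bar> \<le> K s0"
    and s: "0 < s"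
  shows "g' s \<in> borel_measurable M"
    and "((\<lambda>s. \<integral>x. g s x \<partial>M) has_real_derivative (\<integral>x. g' s x \<partial>M)) (at s)"
proof -
  interpret finite_measure M by (rule M)
  have quot: "(\<lambda>i. (g (X i) x - g s x) / (X i - s)) \<longlonglongrightarrow> g' s x"
    if X: "\<And>i. X i \<noteq> s" "X \<longlonglongrightarrow> s" for X :: "nat \<Rightarrow> real" and x
  proof -
    have "((\<lambda>y. (g y x - g s x) / (y - s)) \<longlongrightarrow> g' s x) (at s)" using der[OF s] by (simp add: has_field_derivative_iff)
    from this[unfolded tendsto_at_iff_sequentially, rule_format, of X] X show ?thesis by (simp add: o_def)
  qed
  define Y where "Y i = s + inverse (real (Suc i))" for i
  have Y: "Y i \<noteq> s" "0 < Y i" for i using s by (auto simp: Y_def intro: add_pos_pos)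
  have Ylim: "Y \<longlonglongrightarrow> s" unfolding Y_def by (rule LIMSEQ_inverse_real_of_nat_add)
  show meas': "g' s \<in> borel_measurable M"
  proof (rule borel_measurable_LIMSEQ_real)
    show "(\<lambda>i. (g (Y i) x - g s x) / (Y i - s)) \<longlonglongrightarrow> g' s x" for x
      by (rule quot[OF Y(1) Ylim])
    show "(\<lambda>x. (g (Y i) x - g s x) / (Y i - s)) \<in> borel_measurable M" for i
      by (rule borel_measurable_divide[OF borel_measurable_diff[OF meas[OF Y(2)] meas[OF s]] borel_measurable_const])
  qed
  have mv: "\<bar>(g t x - g s x) / (t - s)\<bar> \<le> K (s/2)" if t: "t \<noteq> s" "s/2 < t" for t x
  proof -
    have "norm (g t x - g s x) \<le> K (s/2) * norm (t - s)"
    proof (rule field_differentiable_bound[of "{s/2..}" "\<lambda>s. g s x" "\<lambda>s. g' s x"])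
      show "((\<lambda>s. g s x) has_real_derivative g' z x) (at z within {s / 2..})" if "z \<in> {s/2..}" for z
        by (rule has_field_derivative_at_within[OF der]) (use that s in auto)
      show "norm (g' z x) \<le> K (s / 2)" if "z \<in> {s/2..}" for z
        using that s bd[of "s/2" z x] by auto
    qed (use t s in auto)
    thus ?thesis using t by (simp add: abs_divide divide_le_eq)
  qed
  show "((\<lambda>s. \<integral>x. g s x \<partial>M) has_real_derivative (\<integral>x. g' s x \<partial>M)) (at s)"
    unfolding has_field_derivative_iff tendsto_at_iff_sequentially
  proof (intro allI impI)
    fix X :: "nat \<Rightarrow> real" assume X: "\<forall>i. X i \<in> UNIV - {s}" "X \<longlonglongrightarrow> s"
    have "\<forall>\<^sub>F i in sequentially. s/2 < X i" using X(2) s by (intro order_tendstoD(1)) auto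
    then obtain N where N: "\<And>i. i \<ge> N \<Longrightarrow> s/2 < X i" by (auto simp: eventually_sequentially)
    have "(\<lambda>i. \<integral>x. (g (X (i + N)) x - g s x) / (X (i + N) - s) \<partial>M) \<longlonglongrightarrow> (\<integral>x. g' s x \<partial>M)"
    proof (rule integral_dominated_convergence[where w = "\<lambda>_. K (s/2)"])
      show "AE x in M. (\<lambda>i. (g (X (i + N)) x - g s x) / (X (i + N) - s)) \<longlonglongrightarrow> g' s x"
        using X by (intro AE_I2 quot LIMSEQ_ignore_initial_segment) auto
      show "AE x in M. norm ((g (X (i + N)) x - g s x) / (X (i + N) - s)) \<le> K (s/2)" for i
        using X N[of "i + N"] mv by (intro AE_I2) auto
      show "(\<lambda>x. (g (X (i + N)) x - g s x) / (X (i + N) - s)) \<in> borel_measurable M" for i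
      proof -
        have "0 < X (i + N)" using N[of "i + N"] s by auto
        thus ?thesis
          by (rule borel_measurable_divide[OF borel_measurable_diff[OF meas meas[OF s]] borel_measurable_const])
      qed
    qed (use meas' in auto)
    moreover have "(\<integral>x. (g (X (i + N)) x - g s x) / (X (i + N) - s) \<partial>M) =
       ((\<integral>x. g (X (i + N)) x \<partial>M) - (\<integral>x. g s x \<partial>M)) / (X (i + N) - s)" for i
    proof -
      have "0 < X (i + N)" using N[of "i + N"] s by auto
      thus ?thesis using s by (simp add: int Bochner_Integration.integral_diff)
    qed
    ultimately have "(\<lambda>i. ((\<integral>x. g (X (i + N)) x \<partial>M) - (\<integral>x. g s x \<partial>M)) / (X (i + N) - s)) \<longlonglongrightarrow> (\<integral>x. g' s x \<partial>M)"
      by (simp only:)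
    from LIMSEQ_offset[where f = "\<lambda>i. ((\<integral>x. g (X i) x \<partial>M) - (\<integral>x. g s x \<partial>M)) / (X i - s)", OF this]
    show "((\<lambda>y. ((\<integral>x. g y x \<partial>M) - (\<integral>x. g s x \<partial>M)) / (y - s)) \<circ> X) \<longlonglongrightarrow> (\<integral>x. g' s x \<partial>M)"
      by (simp add: o_def)
  qed
qed

locale stationary_family =
  fixes T :: "'t::metric_space \<Rightarrow> 't" and M :: "'t measure"
    and C :: "complex^'m^'m" and f0 :: "'t \<Rightarrow> complex^'m^'m"
  assumes compact_base: "compact (UNIV :: 't set)"
    and homeo: "homeomorphism UNIV UNIV T (inv T)"
    and prob: "prob_space M" and sets_M: "sets M = sets borel"
    and invariant: "distr M M T = M"
    and invertible_C: "invertible C"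
    and continuous_f0: "continuous_on UNIV f0"
    and hermitian_f0: "\<And>\<theta>. hermitian (f0 \<theta>)"
begin

sublocale prob_space M by (rule prob)

lemma T_cancel: "inv T (T \<theta>) = \<theta>" "T (inv T \<theta>) = \<theta>"
  using homeo by (auto simp: homeomorphism_def)

lemma iterate_cancel: "(T ^^ k) ((inv T ^^ k) \<theta>) = \<theta>" "(inv T ^^ k) ((T ^^ k) \<theta>) = \<theta>"
proof (induction k arbitrary: \<theta>)
  case (Suc k)
  { case 1 show ?case by (subst funpow_Suc_right) (simp add: Suc T_cancel del: funpow.simps add: funpow.simps(2)[of k "inv T"]) }
  { case 2 show ?case by (subst funpow_Suc_right) (simp add: Suc T_cancel del: funpow.simps add: funpow.simps(2)[of k T]) }
qed auto

lemma continuous_iterate: "continuous_on UNIV (T ^^ k)" "continuous_on UNIV (inv T ^^ k)"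
proof -
  have c: "continuous_on UNIV T" "continuous_on UNIV (inv T)" using homeo by (auto simp: homeomorphism_def)
  show "continuous_on UNIV (T ^^ k)"
    by (induction k) (auto intro!: continuous_intros intro: continuous_on_compose2[OF c(1)] simp: o_def)
  show "continuous_on UNIV (inv T ^^ k)"
    by (induction k) (auto intro!: continuous_intros intro: continuous_on_compose2[OF c(2)] simp: o_def)
qed

lemma int_iterate_shift: "int_iterate T (int j - int k) \<theta> = (T ^^ j) ((inv T ^^ k) \<theta>)"
proof (cases "k \<le> j")
  case True
  then obtain i where j: "j = i + k" by (metis le_add_diff_inverse2)
  have "(T ^^ j) ((inv T ^^ k) \<theta>) = (T ^^ i) ((T ^^ k) ((inv T ^^ k) \<theta>))" by (simp add: j funpow_add)
  thus ?thesis by (simp add: int_iterate_def j iterate_cancel)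
next
  case False
  then obtain i where k: "k = j + i" by (metis le_add_diff_inverse nat_le_linear)
  have "(T ^^ j) ((inv T ^^ k) \<theta>) = (T ^^ j) ((inv T ^^ j) ((inv T ^^ i) \<theta>))" by (simp add: k funpow_add)
  moreover have "i > 0" using False k by simp
  ultimately show ?thesis by (simp add: int_iterate_def k iterate_cancel)
qed

lemma measurable_continuous: "continuous_on UNIV (h :: 't \<Rightarrow> 'b::{second_countable_topology,topological_space}) \<Longrightarrow> h \<in> borel_measurable M"
  using borel_measurable_continuous_onI measurable_cong_sets[OF sets_M refl] by blast

lemma T_measurable: "T \<in> measurable M M"
proof -
  have "continuous_on UNIV T" using homeo by (auto simp: homeomorphism_def)
  hence "T \<in> measurable borel borel" by (rule borel_measurable_continuous_onI)
  thus ?thesis using measurable_cong_sets[OF sets_M sets_M] by simp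
qed

lemma integral_T: "h \<in> borel_measurable M \<Longrightarrow> (\<integral>\<theta>. h (T \<theta>) \<partial>M) = (\<integral>\<theta>. h \<theta> \<partial>M)"
  for h :: "'t \<Rightarrow> real"
  using integral_distr[OF T_measurable, of h] invariant by simp

lemma integral_iterate: "h \<in> borel_measurable M \<Longrightarrow> (\<integral>\<theta>. h ((T ^^ k) \<theta>) \<partial>M) = (\<integral>\<theta>. h \<theta> \<partial>M)"
  for h :: "'t \<Rightarrow> real"
proof (induction k arbitrary: h)
  case (Suc k)
  have "(\<lambda>\<theta>. h (T \<theta>)) \<in> borel_measurable M" using T_measurable Suc.prems by (rule measurable_compose)
  from Suc.IH[OF this] show ?case using integral_T[OF Suc.prems] by simp
qed simp

lemma bounded_f0: "\<exists>B. \<forall>\<theta>. norm (f0 \<theta>) \<le> B"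
proof -
  have "compact (range f0)" using compact_continuous_image[OF continuous_f0 compact_base] .
  thus ?thesis using compact_imp_bounded bounded_iff by (metis rangeI)
qed

definition orbit :: "real \<Rightarrow> real \<Rightarrow> 't \<Rightarrow> nat \<Rightarrow> complex^'m^'m" where
  "orbit E s \<theta> = site E (\<lambda>j. f0 ((T ^^ j) \<theta>)) s"

definition rotation_sum :: "real \<Rightarrow> real \<Rightarrow> nat \<Rightarrow> 't \<Rightarrow> real" where
  "rotation_sum E s n \<theta> = phase_sum C (orbit E s \<theta>) (orbit E s \<theta> 0) n"

definition box_green :: "real \<Rightarrow> real \<Rightarrow> 't \<Rightarrow> nat \<Rightarrow> nat \<Rightarrow> complex" where
  "box_green E s \<theta> k d = trace (green C (riccati C (orbit E s \<theta>) (orbit E s \<theta> 0)) k d)"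

lemma orbit_im_ge: "im_ge s (orbit E s \<theta> j)"
  unfolding orbit_def by (rule site_im_ge) (rule hermitian_f0)

lemma orbit_Upper: "0 < s \<Longrightarrow> orbit E s \<theta> j \<in> Upper"
  using im_ge_Upper orbit_im_ge by blast

lemma continuous_orbit: "continuous_on UNIV (\<lambda>\<theta>. orbit E s \<theta> j)"
  unfolding orbit_def site_def
  by (intro continuous_intros continuous_on_compose2[OF continuous_f0 continuous_iterate(1)]) auto

lemma orbit_shift: "orbit E s \<theta> (n + j) = orbit E s ((T ^^ n) \<theta>) j"
  unfolding orbit_def site_def by (simp add: funpow_add funpow_swap1 add.commute[of n])

lemma continuous_rotation_sum: "0 < s \<Longrightarrow> continuous_on UNIV (rotation_sum E s n)"
  unfolding rotation_sum_def[abs_def] phase_sum_def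
  by (intro continuous_intros continuous_on_riccati continuous_orbit riccati_Upper orbit_Upper)

lemma continuous_box_green: "0 < s \<Longrightarrow> continuous_on UNIV (\<lambda>\<theta>. box_green E s \<theta> k d)"
  unfolding box_green_def
  by (intro continuous_on_trace continuous_on_green continuous_on_riccati continuous_orbit Upper_invertible riccati_Upper orbit_Upper)

lemma rotation_sum_bound: "0 < s \<Longrightarrow> \<bar>rotation_sum E s n \<theta>\<bar> \<le> real n * (2 * pi * CARD('m))"
  unfolding rotation_sum_def by (intro phase_sum_bound orbit_Upper)

lemma box_green_bound: "0 < s \<Longrightarrow> norm (box_green E s \<theta> k d) \<le> real CARD('m) / s"
  unfolding box_green_def
  using norm_trace_le[of "green C (riccati C (orbit E s \<theta>) (orbit E s \<theta> 0)) k d" "1 / s"]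
    green_norm_le[where a = "orbit E s \<theta>", OF orbit_im_ge] by simp

text \<open>After \<open>n\<close> steps the recursion is in a state that depends on the past; restarting it with
  \<open>a n\<close> costs a bounded error by \<open>phase_sum_indep\<close>.\<close>

lemma rotation_sum_quasi_additive:
  assumes s: "0 < s"
  shows "\<bar>rotation_sum E s (n + j) \<theta> - rotation_sum E s n \<theta> - rotation_sum E s j ((T ^^ n) \<theta>)\<bar> \<le> 4 * pi * CARD('m)"
proof -
  have "rotation_sum E s (n + j) \<theta> = rotation_sum E s n \<theta> +
    phase_sum C (orbit E s ((T ^^ n) \<theta>)) (riccati C (orbit E s \<theta>) (orbit E s \<theta> 0) n) j"
    by (simp add: rotation_sum_def phase_sum_add orbit_shift)
  moreover have "\<bar>phase_sum C (orbit E s ((T ^^ n) \<theta>)) (riccati C (orbit E s \<theta>) (orbit E s \<theta> 0) n) j -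
    phase_sum C (orbit E s ((T ^^ n) \<theta>)) (orbit E s ((T ^^ n) \<theta>) 0) j\<bar> \<le> 4 * pi * CARD('m)"
    by (intro phase_sum_indep invertible_C orbit_Upper riccati_Upper s)
  ultimately show ?thesis by (simp add: rotation_sum_def)
qed

definition mean_rotation :: "real \<Rightarrow> real \<Rightarrow> nat \<Rightarrow> real" where
  "mean_rotation E s n = (\<integral>\<theta>. rotation_sum E s n \<theta> \<partial>M)"

lemma integrable_bounded_continuous:
  fixes h :: "'t \<Rightarrow> real"
  assumes "continuous_on UNIV h" "\<And>\<theta>. \<bar>h \<theta>\<bar> \<le> K" shows "integrable M h"
  by (rule integrable_const_bound[of _ K]) (use assms measurable_continuous in auto)

lemma integrable_rotation_sum: "0 < s \<Longrightarrow> integrable M (rotation_sum E s n)"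
  by (rule integrable_bounded_continuous[OF continuous_rotation_sum rotation_sum_bound])

lemma mean_rotation_quasi_additive:
  assumes s: "0 < s"
  shows "\<bar>mean_rotation E s (n + j) - mean_rotation E s n - mean_rotation E s j\<bar> \<le> 4 * pi * CARD('m)"
proof -
  have c: "continuous_on UNIV (\<lambda>\<theta>. rotation_sum E s j ((T ^^ n) \<theta>))"
    by (rule continuous_on_compose2[OF continuous_rotation_sum[OF s] continuous_iterate(1)]) auto
  have i: "integrable M (\<lambda>\<theta>. rotation_sum E s j ((T ^^ n) \<theta>))"
    by (rule integrable_bounded_continuous[OF c rotation_sum_bound[OF s]])
  have "mean_rotation E s j = (\<integral>\<theta>. rotation_sum E s j ((T ^^ n) \<theta>) \<partial>M)"
    unfolding mean_rotation_def by (rule integral_iterate[symmetric]) (intro measurable_continuous continuous_rotation_sum s)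
  define D where "D \<theta> = rotation_sum E s (n + j) \<theta> - rotation_sum E s n \<theta> - rotation_sum E s j ((T ^^ n) \<theta>)" for \<theta>
  note ir = integrable_rotation_sum[OF s, of E]
  have iD: "integrable M D"
    unfolding D_def by (rule Bochner_Integration.integrable_diff[OF Bochner_Integration.integrable_diff[OF ir ir] i])
  have "mean_rotation E s (n + j) - mean_rotation E s n - mean_rotation E s j = (\<integral>\<theta>. D \<theta> \<partial>M)"
    unfolding D_def \<open>mean_rotation E s j = _\<close> unfolding mean_rotation_def
    by (simp add: Bochner_Integration.integral_diff ir i Bochner_Integration.integrable_diff)
  also have "\<bar>\<dots>\<bar> \<le> (\<integral>\<theta>. \<bar>D \<theta>\<bar> \<partial>M)" by (rule integral_abs_bound)
  also have "\<dots> \<le> (\<integral>\<theta>. 4 * pi * CARD('m) \<partial>M)"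
    by (rule integral_mono[OF integrable_abs[OF iD]]) (auto simp: D_def intro: rotation_sum_quasi_additive[OF s])
  finally show ?thesis by (simp add: prob_space)
qed

text \<open>Quasi-additivity along multiples of \<open>n\<close>: the mean of length \<open>q n\<close> is
  \<open>q\<close> times the mean of length \<open>n\<close> up to \<open>q\<close> times the constant.
  Division by \<open>q\<close> and \<open>q \<rightarrow> \<infinity>\<close> give an error that does not grow
  with \<open>n\<close>.\<close>

lemma mean_rotation_limit_rate:
  assumes s: "0 < s" and lim: "(\<lambda>n. mean_rotation E s n / real n) \<longlonglongrightarrow> l"
  shows "\<bar>mean_rotation E s n - real n * l\<bar> \<le> 4 * pi * CARD('m)"
proof (cases "n = 0")
  case True
  thus ?thesis by (simp add: mean_rotation_def rotation_sum_def phase_sum_def)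
next
  case False
  define c where "c = 4 * pi * CARD('m)"
  have q: "\<bar>mean_rotation E s (q * n) - real q * mean_rotation E s n\<bar> \<le> real q * c" for q
  proof (induction q)
    case 0
    show ?case by (simp add: mean_rotation_def rotation_sum_def phase_sum_def)
  next
    case (Suc q)
    have "\<bar>mean_rotation E s (q * n + n) - mean_rotation E s (q * n) - mean_rotation E s n\<bar> \<le> c"
      unfolding c_def by (rule mean_rotation_quasi_additive[OF s])
    with Suc show ?case by (simp add: algebra_simps abs_le_iff)
  qed
  have "filterlim (\<lambda>q. Suc q * n) at_top sequentially"
    using False by (intro filterlim_subseq strict_monoI) auto
  from filterlim_compose[OF lim this]
  have "(\<lambda>q. real n * (mean_rotation E s (Suc q * n) / real (Suc q * n))) \<longlonglongrightarrow> real n * l" by (intro tendsto_mult_left)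
  moreover have "real n * (mean_rotation E s (Suc q * n) / real (Suc q * n)) = mean_rotation E s (Suc q * n) / real (Suc q)" for q
    using False by (simp only: of_nat_mult) (simp add: field_simps del: of_nat_Suc)
  ultimately have "(\<lambda>q. mean_rotation E s n - mean_rotation E s (Suc q * n) / real (Suc q)) \<longlonglongrightarrow> mean_rotation E s n - real n * l"
    by (intro tendsto_diff tendsto_const) simp
  hence "(\<lambda>q. \<bar>mean_rotation E s n - mean_rotation E s (Suc q * n) / real (Suc q)\<bar>) \<longlonglongrightarrow> \<bar>mean_rotation E s n - real n * l\<bar>"
    by (rule tendsto_rabs)
  moreover have "\<bar>mean_rotation E s n - mean_rotation E s (Suc q * n) / real (Suc q)\<bar> \<le> c" for q
  proof -
    have "mean_rotation E s n - mean_rotation E s (Suc q * n) / real (Suc q) =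
      - ((mean_rotation E s (Suc q * n) - real (Suc q) * mean_rotation E s n) / real (Suc q))"
      by (simp only: diff_divide_distrib) simp
    hence "\<bar>mean_rotation E s n - mean_rotation E s (Suc q * n) / real (Suc q)\<bar> =
      \<bar>mean_rotation E s (Suc q * n) - real (Suc q) * mean_rotation E s n\<bar> / real (Suc q)"
      by (simp only: abs_minus_cancel abs_divide abs_of_nat)
    also have "\<dots> \<le> real (Suc q) * c / real (Suc q)" by (intro divide_right_mono q) auto
    finally show ?thesis by simp
  qed
  ultimately show ?thesis unfolding c_def by (intro LIMSEQ_le_const2) auto
qed

end

section \<open>The density of states as a mean phase\<close>

text \<open>The contribution of a spectral point \<open>x\<close> to the phase at energy \<open>E + i s\<close>.\<close>

definition arg_shift :: "real \<Rightarrow> real \<Rightarrow> real \<Rightarrow> real" where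
  "arg_shift E s x = Im (Ln (Complex E s - of_real x))"

lemma arg_shift_bounds:
  assumes "0 < s" shows "0 < arg_shift E s x" "arg_shift E s x < pi"
proof -
  have 1: "Complex E s - of_real x \<noteq> 0" using assms by (simp add: complex_eq_iff)
  have "0 < Im (Complex E s - complex_of_real x)" using assms by simp
  with Im_Ln_pos_lt_imp[OF this] show "0 < arg_shift E s x" "arg_shift E s x < pi"
    by (auto simp: arg_shift_def)
qed

lemma arg_shift_has_derivative:
  assumes "0 < s"
  shows "((\<lambda>s. arg_shift E s x) has_real_derivative Re (resolvent_fun (Complex E s) x)) (at s)"
proof -
  have np: "Complex E s - of_real x \<notin> \<real>\<^sub>\<le>\<^sub>0" using assms by (simp add: complex_nonpos_Reals_iff)
  have "((\<lambda>t. Complex E t - of_real x) has_vector_derivative \<i>) (at s)"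
    unfolding has_vector_derivative_iff_quotient
  proof (rule Lim_transform_eventually[OF tendsto_const])
    show "\<forall>\<^sub>F t in at s. \<i> = (Complex E t - of_real x - (Complex E s - of_real x)) /\<^sub>R (t - s)"
      unfolding eventually_at_filter by (intro always_eventually allI impI) (simp add: complex_eq_iff)
  qed
  from field_vector_diff_chain_at[OF this has_field_derivative_Ln[OF np]]
  have "((\<lambda>t. Ln (Complex E t - of_real x)) has_vector_derivative \<i> * inverse (Complex E s - of_real x)) (at s)"
    by (simp add: o_def)
  from bounded_linear.has_vector_derivative[OF bounded_linear_Im this]
  moreover have "Im (\<i> * w) = Re w" for w by simp
  ultimately show ?thesis
    by (simp only: arg_shift_def resolvent_fun_def has_real_derivative_iff_has_vector_derivative inverse_eq_divide)
qed

lemma arg_shift_measurable: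
  assumes "0 < s" shows "arg_shift E s \<in> borel_measurable borel"
proof (rule borel_measurable_continuous_onI)
  show "continuous_on UNIV (arg_shift E s)"
    unfolding arg_shift_def[abs_def] using assms
    by (intro continuous_intros) (auto simp: complex_nonpos_Reals_iff)
qed

lemma arg_shift_tendsto_large: "((\<lambda>s. arg_shift E s x) \<longlongrightarrow> pi / 2) at_top"
proof -
  have ev: "\<forall>\<^sub>F s in at_top. Im (Ln (Complex ((E - x) / s) 1)) = arg_shift E s x"
    using eventually_gt_at_top[of 0]
  proof eventually_elim
    case (elim s)
    have "Complex E s - of_real x = of_real s * Complex ((E - x) / s) 1" using elim by (simp add: complex_eq_iff)
    moreover have "Complex ((E - x) / s) 1 \<noteq> 0" by (simp add: complex_eq_iff)
    ultimately show ?case using elim Ln_times_of_real[of s "Complex ((E - x) / s) 1"] by (simp add: arg_shift_def)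
  qed
  have "((\<lambda>s. (E - x) / s) \<longlongrightarrow> 0) at_top" by real_asymp
  hence "((\<lambda>s. Complex ((E - x) / s) 1) \<longlongrightarrow> Complex 0 1) at_top" by (intro tendsto_intros)
  moreover have "Complex 0 1 \<notin> \<real>\<^sub>\<le>\<^sub>0" by (simp add: complex_nonpos_Reals_iff)
  ultimately have "((\<lambda>s. Im (Ln (Complex ((E - x) / s) 1))) \<longlongrightarrow> Im (Ln (Complex 0 1))) at_top"
    by (intro tendsto_Im tendsto_Ln)
  also have "Complex 0 1 = \<i>" by (simp add: complex_eq_iff)
  also have "Im (Ln \<i>) = pi / 2" by simp
  finally show ?thesis by (rule Lim_transform_eventually[OF _ ev])
qed

locale density_family = stationary_family T M C f0
  for T :: "'t::metric_space \<Rightarrow> 't" and M and C :: "complex^'m^'m" and f0 +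
  fixes dk :: "real measure" and \<Phi>
  assumes sets_k: "sets dk = sets borel"
    and calculus: "\<And>\<theta>. borel_functional_calculus (schrodinger_operator T C f0 \<theta>) (\<Phi> \<theta>)"
    and density: "\<And>g. g \<in> bounded_borel \<Longrightarrow> (\<integral>x. g x \<partial>dk) =
           (\<integral>\<theta>. (1 / of_nat CARD('m)) *
              (\<Sum>i\<in>UNIV. ell2_inner (delta0 i) (\<Phi> \<theta> g (delta0 i))) \<partial>M)"
begin

lemma space_k: "space dk = UNIV"
  using sets_eq_imp_space_eq[OF sets_k] by simp

lemma prob_k: "prob_space dk"
proof
  have one: "(\<lambda>x. 1) \<in> bounded_borel" by (rule bounded_borelI[of _ 1]) auto
  have P: "\<Phi> \<theta> (\<lambda>x. 1) (delta0 i) = delta0 i" for \<theta> i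
    by (rule calculus[of \<theta>, unfolded borel_functional_calculus_def, THEN conjunct2, THEN conjunct2, THEN conjunct2,
          THEN conjunct1, rule_format, OF delta0_ell2])
  have "(\<integral>x. (1::complex) \<partial>dk) = (\<integral>\<theta>. 1 \<partial>M)"
    unfolding density[OF one] P ell2_inner_delta0 by (simp add: delta0_def)
  hence "complex_of_real (measure dk UNIV) = 1" by (simp add: prob_space space_k scaleR_conv_of_real)
  hence "measure dk UNIV = 1" by (simp only: of_real_eq_1_iff)
  hence "emeasure dk UNIV = 1" by (metis emeasure_eq_ennreal_measure ennreal_1 measure_zero_top zero_neq_one)
  thus "emeasure dk (space dk) = 1" by (simp add: space_k)
qed

text \<open>The trace of the diagonal block at the origin of the resolvent.\<close>

definition tau :: "real \<Rightarrow> real \<Rightarrow> 't \<Rightarrow> complex" where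
  "tau E s \<theta> = (\<Sum>i\<in>UNIV. \<Phi> \<theta> (resolvent_fun (Complex E s)) (delta0 i) 0 $ i)"

text \<open>The box reaches from \<open>-k\<close> to \<open>d\<close> around the origin; the orbit is therefore started
  at \<open>T^(-k) \<theta>\<close>. The resolvent column is square summable, hence small at both ends, and
  \<open>green_approx\<close> applies.\<close>

lemma box_green_approx:
  assumes s: "0 < s" and \<epsilon>: "0 < \<epsilon>"
  shows "\<exists>N. \<forall>k\<ge>N. \<forall>d\<ge>N. norm (tau E s \<theta> - box_green E s ((inv T ^^ k) \<theta>) k d) < \<epsilon>"
proof -
  define z where "z = Complex E s"
  define u where "u i = \<Phi> \<theta> (resolvent_fun z) (delta0 i)" for i
  obtain B where B: "\<And>\<theta>. norm (f0 \<theta>) \<le> B" using bounded_f0 by blast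
  have z: "0 < Im z" using s by (simp add: z_def)
  note sol = resolvent_solution[OF calculus[of \<theta>] schrodinger_ell2[OF B] z delta0_ell2, folded u_def]
  define K where "K = real (CARD('m) * CARD('m)) * (norm C + norm (adjoint_mat C))"
  have K: "norm (C *v v) \<le> K * norm v" "norm (adjoint_mat C *v v) \<le> K * norm v" for v
    using norm_matrix_vector_le[of C v] norm_matrix_vector_le[of "adjoint_mat C" v]
    by (auto simp: K_def algebra_simps intro: add_increasing add_increasing2)
  \<comment> \<open>The sizes of the resolvent column at the sites just outside the box on the left and on the right.\<close>
  define \<eta> where "\<eta> i n = K * norm (u i (- 1 - int n)) / s" for i n
  define \<eta>' where "\<eta>' i n = K * norm (u i (int n + 1)) / s" for i n
  have lim: "(\<lambda>n. \<Sum>i\<in>UNIV. \<eta> i n) \<longlonglongrightarrow> 0" "(\<lambda>n. \<Sum>i\<in>UNIV. \<eta>' i n) \<longlonglongrightarrow> 0"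
  proof -
    have "(\<lambda>n. \<eta> i n) \<longlonglongrightarrow> K * 0 / s" "(\<lambda>n. \<eta>' i n) \<longlonglongrightarrow> K * 0 / s" for i
      unfolding \<eta>_def \<eta>'_def
      by (intro tendsto_divide tendsto_mult tendsto_const ell2_tendsto_0 sol(1); use s in \<open>auto intro!: injI\<close>)+
    from tendsto_sum[where I = UNIV, OF this(1)] tendsto_sum[where I = UNIV, OF this(2)]
    show "(\<lambda>n. \<Sum>i\<in>UNIV. \<eta> i n) \<longlonglongrightarrow> 0" "(\<lambda>n. \<Sum>i\<in>UNIV. \<eta>' i n) \<longlonglongrightarrow> 0" by simp_all
  qed
  have main: "norm (tau E s \<theta> - box_green E s ((inv T ^^ k) \<theta>) k d) \<le> (\<Sum>i\<in>UNIV. \<eta> i k) + (\<Sum>i\<in>UNIV. \<eta>' i d)" for k d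
  proof -
    define G where "G = green C (riccati C (orbit E s ((inv T ^^ k) \<theta>)) (orbit E s ((inv T ^^ k) \<theta>) 0)) k d"
    have c: "norm ((u i 0 - G *v axis i 1) $ i) \<le> \<eta> i k + \<eta>' i d" for i
    proof -
      define U where "U j = u i (int j - 1 - int k)" for j
      have eq: "orbit E s ((inv T ^^ k) \<theta>) j *v U (Suc j) - adjoint_mat C *v U j - C *v U (Suc (Suc j)) =
        (if j = k then axis i 1 else 0)" for j
      proof -
        define n where "n = int j - int k"
        have o: "orbit E s ((inv T ^^ k) \<theta>) j = mat z - f0 (int_iterate T n \<theta>)"
          by (simp add: orbit_def site_def z_def n_def int_iterate_shift)
        have U: "U (Suc j) = u i n" "U j = u i (n - 1)" "U (Suc (Suc j)) = u i (n + 1)"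
          by (simp_all add: U_def n_def algebra_simps)
        have "z *s u i n - (adjoint_mat C *v u i (n - 1) + f0 (int_iterate T n \<theta>) *v u i n + C *v u i (n + 1)) = delta0 i n"
          using sol(2)[of i n] by (simp add: schrodinger_operator_def)
        moreover have "delta0 i n = (if j = k then axis i 1 else 0)" by (simp add: delta0_def n_def)
        ultimately show ?thesis unfolding o U
          by (simp add: matrix_vector_mult_diff_rdistrib mat_vector_mult algebra_simps)
      qed
      have "norm (U (Suc k) - G *v axis i 1) \<le> K * (norm (U 0) + norm (U (k + d + 2))) / s"
        unfolding G_def by (rule green_approx[OF orbit_im_ge s K eq])
      moreover have "U (Suc k) = u i 0" "U 0 = u i (- 1 - int k)" "U (k + d + 2) = u i (int d + 1)"
        by (simp_all add: U_def algebra_simps)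
      ultimately have "norm (u i 0 - G *v axis i 1) \<le> \<eta> i k + \<eta>' i d"
        by (simp add: \<eta>_def \<eta>'_def distrib_left add_divide_distrib)
      thus ?thesis using Finite_Cartesian_Product.norm_nth_le order_trans by blast
    qed
    have "tau E s \<theta> - box_green E s ((inv T ^^ k) \<theta>) k d = (\<Sum>i\<in>UNIV. (u i 0 - G *v axis i 1) $ i)"
      by (simp add: tau_def box_green_def u_def z_def G_def[symmetric] trace_def matrix_vector_mult_axis sum_subtractf)
    also have "norm \<dots> \<le> (\<Sum>i\<in>UNIV. \<eta> i k + \<eta>' i d)" by (rule sum_norm_le) (rule c)
    finally show ?thesis by (simp add: sum.distrib)
  qed
  from LIMSEQ_D[OF lim(1), of "\<epsilon>/2"] LIMSEQ_D[OF lim(2), of "\<epsilon>/2"] \<epsilon>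
  obtain N1 N2 where N: "\<And>n. n \<ge> N1 \<Longrightarrow> \<bar>\<Sum>i\<in>UNIV. \<eta> i n\<bar> < \<epsilon>/2" "\<And>n. n \<ge> N2 \<Longrightarrow> \<bar>\<Sum>i\<in>UNIV. \<eta>' i n\<bar> < \<epsilon>/2"
    by auto
  have "norm (tau E s \<theta> - box_green E s ((inv T ^^ k) \<theta>) k d) < \<epsilon>" if "k \<ge> max N1 N2" "d \<ge> max N1 N2" for k d
    using main[of k d] N(1)[of k] N(2)[of d] that by force
  thus ?thesis by blast
qed

lemma tau_limit:
  assumes s: "0 < s" shows "(\<lambda>k. box_green E s ((inv T ^^ k) \<theta>) k k) \<longlonglongrightarrow> tau E s \<theta>"
proof (rule LIMSEQ_I)
  fix r :: real assume "0 < r"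
  from box_green_approx[OF s this, of E \<theta>] show "\<exists>no. \<forall>n\<ge>no. norm (box_green E s ((inv T ^^ n) \<theta>) n n - tau E s \<theta>) < r"
    by (simp add: norm_minus_commute) blast
qed

lemma tau_bound: "0 < s \<Longrightarrow> norm (tau E s \<theta>) \<le> real CARD('m) / s"
  using tendsto_norm[OF tau_limit] box_green_bound
  by (intro LIMSEQ_le_const2[of "\<lambda>k. norm (box_green E s ((inv T ^^ k) \<theta>) k k)"]) auto

lemma continuous_box_green_shift: "0 < s \<Longrightarrow> continuous_on UNIV (\<lambda>\<theta>. box_green E s ((inv T ^^ l) \<theta>) k d)"
  by (rule continuous_on_compose2[OF continuous_box_green continuous_iterate(2)]) auto

lemma tau_measurable: "0 < s \<Longrightarrow> tau E s \<in> borel_measurable M"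
  by (rule borel_measurable_LIMSEQ_metric[OF _ tau_limit])
     (auto intro!: measurable_continuous continuous_box_green_shift)

text \<open>The definition of the density of states for the function \<open>1 / (z - x)\<close>.\<close>

lemma integral_tau:
  assumes s: "0 < s"
  shows "real CARD('m) * (\<integral>x. Re (resolvent_fun (Complex E s) x) \<partial>dk) = (\<integral>\<theta>. Re (tau E s \<theta>) \<partial>M)"
proof -
  interpret k: prob_space dk by (rule prob_k)
  define g where "g = resolvent_fun (Complex E s)"
  have gb: "g \<in> bounded_borel"
    unfolding g_def using norm_resolvent_fun_le(1)[of "Complex E s"] s
    by (intro bounded_borelI resolvent_fun_measurable) auto
  have m: "g \<in> borel_measurable dk"
    using resolvent_fun_measurable measurable_cong_sets[OF sets_k refl] unfolding g_def by blast
  have ik: "integrable dk g"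
    by (rule k.integrable_const_bound[of _ "1/s"]) (use norm_resolvent_fun_le(1)[of "Complex E s"] s m in \<open>auto simp: g_def\<close>)
  have iM: "integrable M (tau E s)"
    by (rule integrable_const_bound[of _ "real CARD('m)/s"]) (use tau_bound tau_measurable s in auto)
  have "(\<integral>x. g x \<partial>dk) = (\<integral>\<theta>. (1 / of_nat CARD('m)) * tau E s \<theta> \<partial>M)"
    unfolding density[OF gb] by (simp add: ell2_inner_delta0 tau_def g_def)
  also have "\<dots> = (1 / of_nat CARD('m)) * (\<integral>\<theta>. tau E s \<theta> \<partial>M)" using iM by simp
  finally have "of_nat CARD('m) * (\<integral>x. g x \<partial>dk) = (\<integral>\<theta>. tau E s \<theta> \<partial>M)" by simp
  hence "Re (of_nat CARD('m) * (\<integral>x. g x \<partial>dk)) = Re (\<integral>\<theta>. tau E s \<theta> \<partial>M)" by simp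
  moreover have "Re (\<integral>\<theta>. tau E s \<theta> \<partial>M) = (\<integral>\<theta>. Re (tau E s \<theta>) \<partial>M)" using iM by simp
  moreover have "Re (of_nat CARD('m) * (\<integral>x. g x \<partial>dk)) = real CARD('m) * (\<integral>x. Re (g x) \<partial>dk)" using ik by simp
  ultimately show ?thesis by (simp add: g_def)
qed

definition mean_arg :: "real \<Rightarrow> real \<Rightarrow> real" where
  "mean_arg E s = real CARD('m) * (\<integral>x. arg_shift E s x \<partial>dk)"

definition mean_green :: "real \<Rightarrow> real \<Rightarrow> nat \<Rightarrow> real" where
  "mean_green E s n = (\<integral>\<theta>. (\<Sum>l<n. Re (box_green E s \<theta> l (n - Suc l))) / real n \<partial>M)"

lemma green_average_bound:
  assumes s: "0 < s" shows "\<bar>(\<Sum>l<n. Re (box_green E s (\<theta> l) l (n - Suc l))) / real n\<bar> \<le> real CARD('m) / s"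
proof (cases "n = 0")
  case False
  have "\<bar>\<Sum>l<n. Re (box_green E s (\<theta> l) l (n - Suc l))\<bar> \<le> (\<Sum>l<n. real CARD('m) / s)"
  proof (rule order_trans[OF sum_abs], rule sum_mono)
    show "\<bar>Re (box_green E s (\<theta> l) l (n - Suc l))\<bar> \<le> real CARD('m) / s" for l
      using abs_Re_le_cmod box_green_bound[OF s] order_trans by blast
  qed
  thus ?thesis using False by (simp add: field_simps)
qed (use s in simp)

lemma continuous_green_average:
  "0 < s \<Longrightarrow> continuous_on UNIV (\<lambda>\<theta>. (\<Sum>l<n. Re (box_green E s ((inv T ^^ h l) \<theta>) l (n - Suc l))) / real n)"
  unfolding divide_inverse by (intro continuous_intros continuous_box_green_shift)

lemma mean_green_bound:
  assumes s: "0 < s" shows "\<bar>mean_green E s n\<bar> \<le> real CARD('m) / s"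
proof -
  define h where "h \<theta> = (\<Sum>l<n. Re (box_green E s \<theta> l (n - Suc l))) / real n" for \<theta>
  have b: "\<bar>h \<theta>\<bar> \<le> real CARD('m) / s" for \<theta> unfolding h_def by (rule green_average_bound[OF s])
  have "continuous_on UNIV h" using continuous_green_average[OF s, where n = n and E = E and h = "\<lambda>_. 0"] by (simp add: h_def[abs_def])
  hence i: "integrable M h" by (rule integrable_bounded_continuous[OF _ b])
  have "\<bar>\<integral>\<theta>. h \<theta> \<partial>M\<bar> \<le> (\<integral>\<theta>. \<bar>h \<theta>\<bar> \<partial>M)" by (rule integral_abs_bound)
  also have "\<dots> \<le> (\<integral>\<theta>. real CARD('m) / s \<partial>M)" by (rule integral_mono[OF integrable_abs[OF i]]) (auto intro: b)
  finally show ?thesis by (simp add: mean_green_def h_def prob_space)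
qed

text \<open>By invariance of the measure each site of the box can be moved to the origin. Then the average over the sites
  of the box is a two-sided Cesaro mean.\<close>

lemma mean_green_limit:
  assumes s: "0 < s" shows "mean_green E s \<longlonglongrightarrow> (\<integral>\<theta>. Re (tau E s \<theta>) \<partial>M)"
proof -
  define h where "h l d \<theta> = Re (box_green E s ((inv T ^^ l) \<theta>) l d)" for l d \<theta>
  have hb: "\<bar>h l d \<theta>\<bar> \<le> real CARD('m) / s" for l d \<theta>
    unfolding h_def using abs_Re_le_cmod box_green_bound[OF s] order_trans by blast
  have hc: "continuous_on UNIV (h l d)" for l d
    unfolding h_def by (intro continuous_intros continuous_box_green_shift s)
  have hi: "integrable M (h l d)" for l d by (rule integrable_bounded_continuous[OF hc hb])
  have T1: "(\<integral>\<theta>. Re (box_green E s \<theta> l d) \<partial>M) = (\<integral>\<theta>. h l d \<theta> \<partial>M)" for l d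
    using integral_iterate[where k = l and h = "h l d", OF measurable_continuous[OF hc]] by (simp add: h_def iterate_cancel)
  have bi: "integrable M (\<lambda>\<theta>. Re (box_green E s \<theta> l d))" for l d
  proof (rule integrable_bounded_continuous)
    show "continuous_on UNIV (\<lambda>\<theta>. Re (box_green E s \<theta> l d))" by (intro continuous_intros continuous_box_green s)
    show "\<bar>Re (box_green E s \<theta> l d)\<bar> \<le> real CARD('m) / s" for \<theta>
      using abs_Re_le_cmod box_green_bound[OF s] order_trans by blast
  qed
  have eq: "mean_green E s n = (\<integral>\<theta>. (\<Sum>l<n. h l (n - Suc l) \<theta>) / real n \<partial>M)" for n
    unfolding mean_green_def by (simp add: Bochner_Integration.integral_sum bi hi T1)
  have "(\<lambda>n. \<integral>\<theta>. (\<Sum>l<n. h l (n - Suc l) \<theta>) / real n \<partial>M) \<longlonglongrightarrow> (\<integral>\<theta>. Re (tau E s \<theta>) \<partial>M)"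
  proof (rule integral_dominated_convergence[where w = "\<lambda>_. real CARD('m) / s"])
    show "(\<lambda>\<theta>. Re (tau E s \<theta>)) \<in> borel_measurable M" using tau_measurable[OF s] by measurable
    show "(\<lambda>\<theta>. (\<Sum>l<n. h l (n - Suc l) \<theta>) / real n) \<in> borel_measurable M" for n
      unfolding h_def by (intro measurable_continuous continuous_green_average s)
    show "AE \<theta> in M. norm ((\<Sum>l<n. h l (n - Suc l) \<theta>) / real n) \<le> real CARD('m) / s" for n
      unfolding h_def real_norm_def by (intro AE_I2 green_average_bound s)
    show "AE \<theta> in M. (\<lambda>n. (\<Sum>l<n. h l (n - Suc l) \<theta>) / real n) \<longlonglongrightarrow> Re (tau E s \<theta>)"
    proof (intro AE_I2 cesaro_two_sided[OF _ hb])
      fix \<theta> and \<epsilon> :: real assume "0 < \<epsilon>"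
      from box_green_approx[OF s this, of E \<theta>] obtain N where
        N: "\<And>k d. k \<ge> N \<Longrightarrow> d \<ge> N \<Longrightarrow> norm (tau E s \<theta> - box_green E s ((inv T ^^ k) \<theta>) k d) < \<epsilon>" by blast
      have "\<bar>h k d \<theta> - Re (tau E s \<theta>)\<bar> < \<epsilon>" if "k \<ge> N" "d \<ge> N" for k d
        using abs_Re_le_cmod[of "tau E s \<theta> - box_green E s ((inv T ^^ k) \<theta>) k d"] N[OF that]
        by (simp add: h_def abs_minus_commute)
      thus "\<exists>N. \<forall>k\<ge>N. \<forall>d\<ge>N. \<bar>h k d \<theta> - Re (tau E s \<theta>)\<bar> < \<epsilon>" by blast
    qed
  qed auto
  moreover have "mean_green E s = (\<lambda>n. \<integral>\<theta>. (\<Sum>l<n. h l (n - Suc l) \<theta>) / real n \<partial>M)" by (rule ext) (rule eq)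
  ultimately show ?thesis by simp
qed

lemma mean_rotation_derivative:
  assumes s: "0 < s"
  shows "((\<lambda>s. mean_rotation E s n / real n) has_real_derivative mean_green E s n) (at s)"
proof -
  have d: "((\<lambda>s. \<integral>\<theta>. rotation_sum E s n \<theta> \<partial>M) has_real_derivative
      (\<integral>\<theta>. (\<Sum>l<n. Re (box_green E s \<theta> l (n - Suc l))) \<partial>M)) (at s)"
  proof (rule derivative_under_integral(2)[where K = "\<lambda>s0. real n * (real CARD('m) / s0)"])
    show "finite_measure M" by (rule finite_measure_axioms)
    show "rotation_sum E s n \<in> borel_measurable M" if "0 < s" for s
      using that by (intro measurable_continuous continuous_rotation_sum)
    show "((\<lambda>s. rotation_sum E s n x) has_real_derivative (\<Sum>l<n. Re (box_green E s x l (n - Suc l)))) (at s)"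
      if "0 < s" for s x
      unfolding rotation_sum_def box_green_def orbit_def by (rule phase_sum_has_derivative[OF hermitian_f0 that])
    show "\<bar>\<Sum>l<n. Re (box_green E s x l (n - Suc l))\<bar> \<le> real n * (real CARD('m) / s0)" if "0 < s0" "s0 \<le> s" for s0 s x
    proof -
      have "\<bar>\<Sum>l<n. Re (box_green E s x l (n - Suc l))\<bar> \<le> (\<Sum>l<n. real CARD('m) / s0)"
      proof (rule order_trans[OF sum_abs], rule sum_mono)
        fix l
        have "\<bar>Re (box_green E s x l (n - Suc l))\<bar> \<le> norm (box_green E s x l (n - Suc l))" by (rule abs_Re_le_cmod)
        also have "\<dots> \<le> real CARD('m) / s" using that by (intro box_green_bound) auto
        also have "\<dots> \<le> real CARD('m) / s0" using that by (intro divide_left_mono) auto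
        finally show "\<bar>Re (box_green E s x l (n - Suc l))\<bar> \<le> real CARD('m) / s0" .
      qed
      thus ?thesis by simp
    qed
  qed (use integrable_rotation_sum s in auto)
  have "(\<integral>\<theta>. (\<Sum>l<n. Re (box_green E s \<theta> l (n - Suc l))) / real n \<partial>M) = (\<integral>\<theta>. (\<Sum>l<n. Re (box_green E s \<theta> l (n - Suc l))) \<partial>M) / real n"
    by simp
  with DERIV_cdivide[OF d, of "real n"] show ?thesis
    by (simp add: mean_rotation_def mean_green_def)
qed

lemma mean_arg_derivative:
  assumes s: "0 < s"
  shows "((\<lambda>s. mean_arg E s) has_real_derivative (\<integral>\<theta>. Re (tau E s \<theta>) \<partial>M)) (at s)"
proof -
  interpret k: prob_space dk by (rule prob_k)
  have m: "arg_shift E s \<in> borel_measurable dk" if "0 < s" for s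
    using arg_shift_measurable[OF that] measurable_cong_sets[OF sets_k refl] by blast
  have "((\<lambda>s. \<integral>x. arg_shift E s x \<partial>dk) has_real_derivative (\<integral>x. Re (resolvent_fun (Complex E s) x) \<partial>dk)) (at s)"
  proof (rule derivative_under_integral(2)[where K = "\<lambda>s0. 1 / s0"])
    show "finite_measure dk" by (rule k.finite_measure_axioms)
    show "integrable dk (arg_shift E s)" if "0 < s" for s
    proof (rule k.integrable_const_bound[OF AE_I2 m[OF that]])
      show "norm (arg_shift E s x) \<le> pi" for x
        using arg_shift_bounds[OF that, of E x] pi_gt_zero by (simp add: abs_le_iff)
    qed
    show "\<bar>Re (resolvent_fun (Complex E s) x)\<bar> \<le> 1 / s0" if "0 < s0" "s0 \<le> s" for s0 s x
    proof -
      have "\<bar>Re (resolvent_fun (Complex E s) x)\<bar> \<le> norm (resolvent_fun (Complex E s) x)" by (rule abs_Re_le_cmod)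
      also have "\<dots> \<le> 1 / s" using norm_resolvent_fun_le(1)[of "Complex E s" x] that by simp
      also have "\<dots> \<le> 1 / s0" using that by (intro divide_left_mono) auto
      finally show ?thesis .
    qed
  qed (use arg_shift_has_derivative s m in auto)
  from DERIV_cmult[OF this, of "real CARD('m)"] show ?thesis
    by (simp only: mean_arg_def[abs_def] integral_tau[OF s])
qed

lemma mean_rotation_large:
  assumes "0 < \<epsilon>"
  shows "\<exists>S>0. \<forall>s\<ge>S. \<forall>n>0. \<bar>mean_rotation E s n / real n - real CARD('m) * pi / 2\<bar> \<le> \<epsilon>"
proof -
  obtain B where B: "\<And>\<theta>. norm (f0 \<theta>) \<le> B" using bounded_f0 by blast
  obtain S where S: "S > 0" "\<And>s F j. s \<ge> S \<Longrightarrow> (\<forall>j. hermitian (F j)) \<Longrightarrow> (\<forall>j. norm (F j) \<le> B) \<Longrightarrow>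
    \<bar>Im (logdet (riccati C (site E F s) (site E F s 0) j)) - real CARD('m) * pi / 2\<bar> < \<epsilon>"
    using riccati_phase_asymptotic[OF assms, of B C E] by blast
  have "\<bar>mean_rotation E s n / real n - real CARD('m) * pi / 2\<bar> \<le> \<epsilon>" if s: "s \<ge> S" and n: "n > 0" for s n
  proof -
    have s0: "0 < s" using s S(1) by linarith
    have b: "\<bar>rotation_sum E s n \<theta> - real n * (real CARD('m) * pi / 2)\<bar> \<le> real n * \<epsilon>" for \<theta>
    proof -
      have "\<bar>rotation_sum E s n \<theta> - real n * (real CARD('m) * pi / 2)\<bar> =
        \<bar>\<Sum>j<n. Im (logdet (riccati C (orbit E s \<theta>) (orbit E s \<theta> 0) j)) - real CARD('m) * pi / 2\<bar>"
        by (simp add: rotation_sum_def phase_sum_def sum_subtractf)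
      also have "\<dots> \<le> (\<Sum>j<n. \<epsilon>)"
        unfolding orbit_def
        by (rule order_trans[OF sum_abs], rule sum_mono, rule less_imp_le, rule S(2)[OF s]) (auto simp: B hermitian_f0)
      finally show ?thesis by simp
    qed
    have i: "integrable M (\<lambda>\<theta>. rotation_sum E s n \<theta> - real n * (real CARD('m) * pi / 2))"
      using integrable_rotation_sum[OF s0] by simp
    have "mean_rotation E s n - real n * (real CARD('m) * pi / 2) = (\<integral>\<theta>. rotation_sum E s n \<theta> - real n * (real CARD('m) * pi / 2) \<partial>M)"
      using integrable_rotation_sum[OF s0] by (simp add: mean_rotation_def prob_space)
    also have "\<bar>\<dots>\<bar> \<le> (\<integral>\<theta>. \<bar>rotation_sum E s n \<theta> - real n * (real CARD('m) * pi / 2)\<bar> \<partial>M)" by (rule integral_abs_bound)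
    also have "\<dots> \<le> (\<integral>\<theta>. real n * \<epsilon> \<partial>M)" by (rule integral_mono[OF integrable_abs[OF i] _ b]) simp
    finally have "\<bar>mean_rotation E s n - real n * (real CARD('m) * pi / 2)\<bar> \<le> real n * \<epsilon>" by (simp add: prob_space)
    moreover have "mean_rotation E s n / real n - real CARD('m) * pi / 2 = (mean_rotation E s n - real n * (real CARD('m) * pi / 2)) / real n"
      using n by (simp add: diff_divide_distrib)
    ultimately show ?thesis using n by (simp add: abs_divide divide_le_eq mult.commute)
  qed
  with S(1) show ?thesis by blast
qed

lemma mean_arg_large: "(\<lambda>n. mean_arg E (real (Suc n))) \<longlonglongrightarrow> real CARD('m) * pi / 2"
proof -
  interpret k: prob_space dk by (rule prob_k)
  have "(\<lambda>n. \<integral>x. arg_shift E (real (Suc n)) x \<partial>dk) \<longlonglongrightarrow> (\<integral>x. pi / 2 \<partial>dk)"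
  proof (rule integral_dominated_convergence[where w = "\<lambda>_. pi"])
    show "arg_shift E (real (Suc n)) \<in> borel_measurable dk" for n
      using arg_shift_measurable[of "real (Suc n)" E] measurable_cong_sets[OF sets_k refl] by auto
    show "AE x in dk. norm (arg_shift E (real (Suc n)) x) \<le> pi" for n
    proof (rule AE_I2)
      show "norm (arg_shift E (real (Suc n)) x) \<le> pi" for x
        using arg_shift_bounds[of "real (Suc n)" E x] pi_gt_zero by (simp add: abs_le_iff del: of_nat_Suc)
    qed
    have "filterlim (\<lambda>n. real (Suc n)) at_top sequentially"
      by (rule filterlim_compose[OF filterlim_real_sequentially filterlim_Suc])
    from filterlim_compose[OF arg_shift_tendsto_large this]
    show "AE x in dk. (\<lambda>n. arg_shift E (real (Suc n)) x) \<longlonglongrightarrow> pi / 2" by (intro AE_I2)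
  qed auto
  from tendsto_mult_left[OF this, of "real CARD('m)"] show ?thesis
    by (simp add: mean_arg_def k.prob_space)
qed

text \<open>Both sides have derivatives in \<open>s\<close>, those of the left side converge boundedly to that of the
  right side, and the two sides agree in the limit of large \<open>s\<close>. Integration from
  \<open>s\<close> to a large \<open>s1\<close> gives the convergence.\<close>

lemma mean_rotation_limit:
  assumes s: "0 < s" shows "(\<lambda>n. mean_rotation E s n / real n) \<longlonglongrightarrow> mean_arg E s"
proof (rule LIMSEQ_I)
  fix r :: real assume r: "0 < r"
  define l where "l = real CARD('m) * pi / 2"
  obtain S where S: "S > 0" "\<And>s n. s \<ge> S \<Longrightarrow> n > 0 \<Longrightarrow> \<bar>mean_rotation E s n / real n - l\<bar> \<le> r/4"
    using mean_rotation_large[of "r/4" E] r unfolding l_def by auto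
  obtain N where N: "\<And>n. n \<ge> N \<Longrightarrow> \<bar>mean_arg E (real (Suc n)) - l\<bar> < r/4"
    using LIMSEQ_D[OF mean_arg_large[of E], of "r/4"] r unfolding l_def by auto
  obtain N' :: nat where N': "max S s < real N'" using reals_Archimedean2 by blast
  \<comment> \<open>An integer height, as the limit of \<open>mean_arg\<close> is stated along the integers.\<close>
  define s1 where "s1 = real (Suc (max N N'))"
  have "real N' \<le> s1" by (simp add: s1_def)
  hence s1: "S \<le> s1" "s \<le> s1" "\<bar>mean_arg E s1 - l\<bar> < r/4" using N' N[of "max N N'"] by (auto simp: s1_def)
  have pos: "0 < t" if "t \<in> {s..s1}" for t using that s by auto
  have ft: "((\<lambda>t. mean_green E t n) has_integral (mean_rotation E s1 n / real n - mean_rotation E s n / real n)) {s..s1}" for n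
    using s1 by (intro fundamental_theorem_of_calculus)
      (auto intro!: has_field_derivative_at_within mean_rotation_derivative pos simp flip: has_real_derivative_iff_has_vector_derivative)
  have fa: "((\<lambda>t. \<integral>\<theta>. Re (tau E t \<theta>) \<partial>M) has_integral (mean_arg E s1 - mean_arg E s)) {s..s1}"
    using s1 by (intro fundamental_theorem_of_calculus)
      (auto intro!: has_field_derivative_at_within mean_arg_derivative pos simp flip: has_real_derivative_iff_has_vector_derivative)
  have "(\<lambda>n. integral {s..s1} (\<lambda>t. mean_green E t n)) \<longlonglongrightarrow> integral {s..s1} (\<lambda>t. \<integral>\<theta>. Re (tau E t \<theta>) \<partial>M)"
  proof (rule dominated_convergence(2))
    show "(\<lambda>t. mean_green E t n) integrable_on {s..s1}" for n using ft by blast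
    show "(\<lambda>t. real CARD('m) / s) integrable_on {s..s1}" by (rule integrable_const_ivl)
    show "norm (mean_green E t n) \<le> real CARD('m) / s" if "t \<in> {s..s1}" for n t
    proof -
      have "norm (mean_green E t n) \<le> real CARD('m) / t" using mean_green_bound[OF pos[OF that]] by simp
      also have "\<dots> \<le> real CARD('m) / s" using that s by (intro divide_left_mono) auto
      finally show ?thesis .
    qed
    show "(\<lambda>n. mean_green E t n) \<longlonglongrightarrow> (\<integral>\<theta>. Re (tau E t \<theta>) \<partial>M)" if "t \<in> {s..s1}" for t
      by (rule mean_green_limit[OF pos[OF that]])
  qed
  hence "(\<lambda>n. mean_rotation E s1 n / real n - mean_rotation E s n / real n) \<longlonglongrightarrow> mean_arg E s1 - mean_arg E s"
    by (simp only: integral_unique[OF ft] integral_unique[OF fa])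
  from LIMSEQ_D[OF this, of "r/4"] r obtain n0 where n0:
    "\<And>n. n \<ge> n0 \<Longrightarrow> \<bar>mean_rotation E s1 n / real n - mean_rotation E s n / real n - (mean_arg E s1 - mean_arg E s)\<bar> < r/4" by auto
  have "norm (mean_rotation E s n / real n - mean_arg E s) < r" if "n \<ge> Suc n0" for n
  proof -
    define a b c d where "a = mean_rotation E s n / real n" and "b = mean_arg E s"
      and "c = mean_rotation E s1 n / real n" and "d = mean_arg E s1"
    have "\<bar>c - a - (d - b)\<bar> < r/4" "\<bar>c - l\<bar> \<le> r/4" "\<bar>d - l\<bar> < r/4"
      unfolding a_def b_def c_def d_def using n0[of n] S(2)[OF s1(1), of n] s1(3) that by auto
    hence "\<bar>a - b\<bar> < r" by arith
    thus ?thesis by (simp add: a_def b_def)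
  qed
  thus "\<exists>no. \<forall>n\<ge>no. norm (mean_rotation E s n / real n - mean_arg E s) < r" by blast
qed

lemma mean_rotation_rate:
  assumes s: "0 < s"
  shows "\<bar>mean_rotation E s n - real n * mean_arg E s\<bar> \<le> 4 * pi * CARD('m)"
  by (rule mean_rotation_limit_rate[OF s mean_rotation_limit[OF s]])

end

section \<open>The Moebius action on contractions\<close>

text \<open>The closed unit ball for the operator norm. It is the closure of the set of Cayley transforms of matrices in
  \<^const>\<open>Upper\<close>, and its boundary contains the unitary group.\<close>

definition contractions :: "(complex^'m^'m) set" where
  "contractions = {V. \<forall>x. norm (V *v x) \<le> norm x}"

lemma convex_contractions: "convex (contractions :: (complex^'m^'m) set)"
proof (rule convexI)
  fix x y :: "complex^'m^'m" and u v :: real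
  assume xy: "x \<in> contractions" "y \<in> contractions" and uv: "0 \<le> u" "0 \<le> v" "u + v = 1"
  have "norm ((u *\<^sub>R x + v *\<^sub>R y) *v w) \<le> norm w" for w
  proof -
    have "norm ((u *\<^sub>R x + v *\<^sub>R y) *v w) \<le> u * norm (x *v w) + v * norm (y *v w)"
      using uv norm_triangle_ineq[of "u *\<^sub>R (x *v w)" "v *\<^sub>R (y *v w)"]
      by (simp add: matrix_vector_mult_add_rdistrib matrix_vector_scaleR_left)
    also have "\<dots> \<le> u * norm w + v * norm w"
      using xy uv by (intro add_mono mult_left_mono) (auto simp: contractions_def)
    also have "\<dots> = norm w" using uv by (simp flip: distrib_right)
    finally show ?thesis .
  qed
  thus "u *\<^sub>R x + v *\<^sub>R y \<in> contractions" by (simp add: contractions_def)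
qed

lemma scalar_contraction: "0 \<le> t \<Longrightarrow> t \<le> 1 \<Longrightarrow> t *\<^sub>R mat 1 \<in> contractions"
  by (simp add: contractions_def matrix_vector_scaleR_left mult_left_le_one_le)

lemma mat_1_contraction: "mat 1 \<in> contractions"
  by (simp add: contractions_def)

definition half_plus :: "complex^'m^'m \<Rightarrow> complex^'m^'m" where
  "half_plus V = (1/2) *\<^sub>R (mat 1 + V)"

definition half_minus :: "complex^'m^'m \<Rightarrow> complex^'m^'m" where
  "half_minus V = (1/2) *\<^sub>R (mat 1 - V)"

lemma half_plus_minus: "half_plus V + half_minus V = mat 1"
  by (simp add: half_plus_def half_minus_def scaleR_add_right[symmetric] vec_eq_iff)

text \<open>The form that measures the defect of \<open>V\<close> from being an isometry.\<close>

lemma inner_half_plus_minus: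
  "inner (half_plus V *v x) (half_minus V *v x) = ((norm x)\<^sup>2 - (norm (V *v x))\<^sup>2) / 4"
  by (simp add: half_plus_def half_minus_def matrix_vector_scaleR_left matrix_vector_mult_add_rdistrib
      matrix_vector_mult_diff_rdistrib inner_add_left inner_add_right inner_diff_left inner_diff_right
      power2_norm_eq_inner inner_commute)

text \<open>The step \<open>Z \<mapsto> z - f - C* Z^(-1) C\<close> in the coordinate
  \<open>V = 1 - 2 i (Z + i)^(-1)\<close>, for which \<open>Z\<close> is \<open>half_plus V\<close> divided by
  \<open>half_minus V / i\<close>. This is the denominator of the new value of \<open>V\<close>; unlike
  \<open>Z\<close> and its inverse it makes sense for every contraction.\<close>

definition numer :: "complex^'m^'m \<Rightarrow> complex^'m^'m \<Rightarrow> complex \<Rightarrow> complex^'m^'m \<Rightarrow> complex^'m^'m" where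
  "numer C f z V = (mat (z + \<i>) - f) ** (matrix_inv C ** half_plus V) + mat \<i> ** (adjoint_mat C ** half_minus V)"

definition moebius_step :: "complex^'m^'m \<Rightarrow> complex^'m^'m \<Rightarrow> complex \<Rightarrow> complex^'m^'m \<Rightarrow> complex^'m^'m" where
  "moebius_step C f z V = mat 1 - mat (2 * \<i>) ** ((matrix_inv C ** half_plus V) ** matrix_inv (numer C f z V))"

text \<open>The extra \<open>\<i>\<close> in \<open>z + \<i>\<close> makes the first term positive on the real axis too,
  which gives invertibility on the closed region.\<close>

lemma numer_inner:
  assumes C: "invertible C" and f: "hermitian f"
  defines "y \<equiv> \<lambda>V x. matrix_inv C *v (half_plus V *v x)"
  shows "inner (\<i> *s y V x) (numer C f z V *v x) =
    (Im z + 1) * (norm (y V x))\<^sup>2 + ((norm x)\<^sup>2 - (norm (V *v x))\<^sup>2) / 4"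
proof -
  have "numer C f z V *v x = (z + \<i>) *s y V x - f *v y V x + \<i> *s (adjoint_mat C *v (half_minus V *v x))"
    by (simp add: numer_def y_def matrix_vector_mult_add_rdistrib matrix_vector_mult_diff_rdistrib
        matrix_vector_mul_assoc[symmetric] mat_vector_mult)
  hence "inner (\<i> *s y V x) (numer C f z V *v x) =
     (Im z + 1) * (norm (y V x))\<^sup>2 + inner (y V x) (adjoint_mat C *v (half_minus V *v x))"
    by (simp add: inner_add_right inner_diff_right inner_i_scalar hermitian_inner[OF f] distrib_right)
  also have "inner (y V x) (adjoint_mat C *v (half_minus V *v x)) = inner (half_plus V *v x) (half_minus V *v x)"
    by (simp add: inner_adjoint_mat[symmetric] y_def matrix_inv_cancel[OF C])
  finally show ?thesis by (simp add: inner_half_plus_minus)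
qed

lemma numer_invertible:
  assumes C: "invertible C" and f: "hermitian f" and z: "0 \<le> Im z" and V: "V \<in> contractions"
  shows "invertible (numer C f z V)"
proof (rule invertible_injI)
  fix x assume x: "numer C f z V *v x = 0"
  define y where "y = matrix_inv C *v (half_plus V *v x)"
  have "(norm (V *v x))\<^sup>2 \<le> (norm x)\<^sup>2" using V by (intro power_mono) (auto simp: contractions_def)
  moreover have "(Im z + 1) * (norm y)\<^sup>2 + ((norm x)\<^sup>2 - (norm (V *v x))\<^sup>2) / 4 = 0"
    using numer_inner[OF C f, of V x z] by (simp add: y_def x)
  moreover have "a \<le> 0" if "b \<le> c" "a + (c - b) / 4 = 0" for a b c :: real using that by (simp add: field_simps)
  ultimately have "(Im z + 1) * (norm y)\<^sup>2 \<le> 0" by blast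
  with z have "norm y = 0" by (simp add: mult_le_0_iff)
  hence y0: "y = 0" by simp
  hence P: "half_plus V *v x = 0" using matrix_inv_cancel(1)[OF C, of "half_plus V *v x"] by (simp add: y_def)
  have "numer C f z V *v x = (mat (z + \<i>) - f) *v y + \<i> *s (adjoint_mat C *v (half_minus V *v x))"
    by (simp add: numer_def y_def matrix_vector_mult_add_rdistrib matrix_vector_mul_assoc[symmetric] mat_vector_mult)
  hence "adjoint_mat C *v (half_minus V *v x) = 0" using x y0 by simp
  hence Q: "half_minus V *v x = 0" using matrix_inv_cancel(2)[OF invertible_adjoint_mat[OF C], of "half_minus V *v x"] by simp
  have "x = (half_plus V + half_minus V) *v x" by (simp add: half_plus_minus)
  thus "x = 0" using P Q by (simp add: matrix_vector_mult_add_rdistrib)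
qed

text \<open>The defect from being an isometry grows by a nonnegative multiple of \<open>Im z\<close>: the ball is mapped
  into itself for \<open>Im z \<ge> 0\<close>, and isometries to isometries for real \<open>z\<close>.\<close>

lemma moebius_norm:
  assumes C: "invertible C" and f: "hermitian f" and z: "0 \<le> Im z" and V: "V \<in> contractions"
  shows "\<exists>x. w = numer C f z V *v x \<and>
    (norm w)\<^sup>2 - (norm (moebius_step C f z V *v w))\<^sup>2 =
      4 * Im z * (norm (matrix_inv C *v (half_plus V *v x)))\<^sup>2 + ((norm x)\<^sup>2 - (norm (V *v x))\<^sup>2)"
proof -
  define x where "x = matrix_inv (numer C f z V) *v w"
  define y where "y = matrix_inv C *v (half_plus V *v x)"
  have w: "w = numer C f z V *v x"
    unfolding x_def by (rule matrix_inv_cancel(1)[OF numer_invertible[OF assms], symmetric])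
  have "moebius_step C f z V *v w = w - (2 * \<i>) *s y"
    by (simp add: moebius_step_def matrix_vector_mult_diff_rdistrib matrix_vector_mul_assoc[symmetric] mat_vector_mult x_def y_def)
  also have "(2 * \<i>) *s y = 2 *\<^sub>R (\<i> *s y)" by (simp add: vec_eq_iff scaleR_conv_of_real[where 'a=complex])
  finally have m: "moebius_step C f z V *v w = w - 2 *\<^sub>R (\<i> *s y)" .
  have "(norm w)\<^sup>2 - (norm (moebius_step C f z V *v w))\<^sup>2 = 4 * inner (\<i> *s y) w - 4 * (norm y)\<^sup>2"
    unfolding m by (simp add: power2_norm_eq_inner inner_diff_left inner_diff_right inner_commute[of w "\<i> *s y"])
  also have "inner (\<i> *s y) w = (Im z + 1) * (norm y)\<^sup>2 + ((norm x)\<^sup>2 - (norm (V *v x))\<^sup>2) / 4"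
    unfolding w y_def by (rule numer_inner[OF C f])
  finally have "(norm w)\<^sup>2 - (norm (moebius_step C f z V *v w))\<^sup>2 =
    4 * ((Im z + 1) * (norm y)\<^sup>2 + ((norm x)\<^sup>2 - (norm (V *v x))\<^sup>2) / 4) - 4 * (norm y)\<^sup>2" .
  moreover have "4 * ((a + 1) * b + c / 4) - 4 * b = 4 * a * b + c" for a b c :: real by (simp add: algebra_simps)
  ultimately show ?thesis using w by (intro exI[of _ x]) (simp only: y_def simp_thms)
qed

lemma moebius_contraction:
  assumes "invertible C" "hermitian f" "0 \<le> Im z" "V \<in> contractions"
  shows "moebius_step C f z V \<in> contractions"
proof -
  have "norm (moebius_step C f z V *v w) \<le> norm w" for w
  proof -
    obtain x where x: "(norm w)\<^sup>2 - (norm (moebius_step C f z V *v w))\<^sup>2 =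
      4 * Im z * (norm (matrix_inv C *v (half_plus V *v x)))\<^sup>2 + ((norm x)\<^sup>2 - (norm (V *v x))\<^sup>2)"
      using moebius_norm[OF assms, of w] by blast
    have "(norm (V *v x))\<^sup>2 \<le> (norm x)\<^sup>2" using assms by (intro power_mono) (auto simp: contractions_def)
    hence "(norm (moebius_step C f z V *v w))\<^sup>2 \<le> (norm w)\<^sup>2"
      using x mult_nonneg_nonneg[OF assms(3) zero_le_power2[of "norm (matrix_inv C *v (half_plus V *v x))"]] by linarith
    thus ?thesis by (rule power2_le_imp_le) simp
  qed
  thus ?thesis by (simp add: contractions_def)
qed

lemma moebius_isometry:
  assumes C: "invertible C" "hermitian f" and z: "Im z = 0" and V: "\<And>x. norm (V *v x) = norm x"
  shows "norm (moebius_step C f z V *v w) = norm w"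
proof -
  have "V \<in> contractions" using V by (simp add: contractions_def)
  from moebius_norm[OF C _ this, of z w] z V have "(norm w)\<^sup>2 - (norm (moebius_step C f z V *v w))\<^sup>2 = 0" by auto
  thus ?thesis by (simp add: power2_eq_iff_nonneg)
qed

lemma unitary_iff_isometry: "U \<in> unitary_group \<longleftrightarrow> (\<forall>x. norm (U *v x) = norm (x :: complex^'m))"
proof
  assume "U \<in> unitary_group"
  hence "adjoint_mat U ** U = mat 1" by (simp add: unitary_group_def)
  hence "inner (U *v x) (U *v x) = inner x x" for x
    by (simp add: inner_adjoint_mat matrix_vector_mul_assoc)
  thus "\<forall>x. norm (U *v x) = norm x" by (simp add: norm_eq)
next
  assume *: "\<forall>x. norm (U *v x) = norm x"
  have i: "inner (U *v x) (U *v y) = inner x y" for x y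
  proof -
    have "inner (U *v (x + y)) (U *v (x + y)) = inner (x + y) (x + y)" "inner (U *v x) (U *v x) = inner x x" "inner (U *v y) (U *v y) = inner y y"
      using * by (simp_all only: norm_eq)
    thus ?thesis by (simp add: matrix_vector_right_distrib inner_add_left inner_add_right inner_commute)
  qed
  have "(adjoint_mat U ** U) *v y = mat 1 *v y" for y
  proof -
    have "\<forall>x. inner x ((adjoint_mat U ** U) *v y) = inner x (mat 1 *v y)"
      using i[of _ y] by (simp add: inner_adjoint_mat matrix_vector_mul_assoc)
    thus ?thesis by (simp only: vector_eq_ldot)
  qed
  thus "U \<in> unitary_group" by (simp add: unitary_group_def matrix_eq)
qed

lemma unitary_inverse:
  assumes "U \<in> unitary_group"
  shows "adjoint_mat U ** U = mat 1" "U ** adjoint_mat U = mat 1" "matrix_inv U = adjoint_mat U" "invertible U"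
proof -
  show 1: "adjoint_mat U ** U = mat 1" using assms by (simp add: unitary_group_def)
  thus 2: "U ** adjoint_mat U = mat 1" by (rule matrix_left_right_inverse[THEN iffD1])
  show "matrix_inv U = adjoint_mat U" "invertible U" using matrix_inv_eqI[OF 2] by auto
qed

lemma adjoint_unitary: "U \<in> unitary_group \<Longrightarrow> adjoint_mat U \<in> unitary_group"
  using unitary_inverse(2) by (simp add: unitary_group_def)

lemma unitary_contraction: "U \<in> unitary_group \<Longrightarrow> U \<in> contractions"
  by (simp add: unitary_iff_isometry contractions_def)

lemma moebius_unitary:
  "invertible C \<Longrightarrow> hermitian f \<Longrightarrow> Im z = 0 \<Longrightarrow> V \<in> unitary_group \<Longrightarrow> moebius_step C f z V \<in> unitary_group"
  using moebius_isometry unfolding unitary_iff_isometry by blast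

definition cayley :: "complex^'m^'m \<Rightarrow> complex^'m^'m" where
  "cayley Z = mat 1 - mat (2 * \<i>) ** matrix_inv (Z + mat \<i>)"

lemma Upper_plus_i: "Z \<in> Upper \<Longrightarrow> Z + mat \<i> \<in> Upper"
  using Upper_add[of Z "mat \<i>"] Upper_im_ge0[OF mat_Upper[of \<i>]] by simp

lemma half_plus_cayley:
  assumes "Z \<in> Upper"
  shows "half_plus (cayley Z) = Z ** matrix_inv (Z + mat \<i>)" "half_minus (cayley Z) = mat \<i> ** matrix_inv (Z + mat \<i>)"
proof -
  define R where "R = matrix_inv (Z + mat \<i>)"
  have "(Z + mat \<i>) ** R = mat 1" unfolding R_def by (intro matrix_inv_left_right Upper_invertible Upper_plus_i assms)
  hence 1: "Z ** R = mat 1 - mat \<i> ** R" by (simp add: matrix_mult_add_left algebra_simps)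
  have 2: "mat (2 * \<i>) ** R = 2 *\<^sub>R (mat \<i> ** R)"
    by (simp add: vec_eq_iff mat_mult_component scaleR_conv_of_real[where 'a=complex])
  show "half_minus (cayley Z) = mat \<i> ** matrix_inv (Z + mat \<i>)"
    by (simp add: half_minus_def cayley_def 2 R_def[symmetric])
  show "half_plus (cayley Z) = Z ** matrix_inv (Z + mat \<i>)"
    unfolding R_def[symmetric] 1
    by (simp add: half_plus_def cayley_def 2 R_def[symmetric] scaleR_diff_right scaleR_add_right)
qed

lemma cayley_contraction:
  assumes Z: "Z \<in> Upper" shows "cayley Z \<in> contractions"
proof -
  have "norm (cayley Z *v x) \<le> norm x" for x
  proof -
    define y where "y = matrix_inv (Z + mat \<i>) *v x"
    have P: "half_plus (cayley Z) *v x = Z *v y" and Q: "half_minus (cayley Z) *v x = \<i> *s y"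
      by (simp_all add: half_plus_cayley[OF Z] y_def matrix_vector_mul_assoc[symmetric] mat_vector_mult)
    have "0 \<le> inner (\<i> *s y) (Z *v y)" using im_geD[OF Upper_im_ge0[OF Z], of y] by simp
    hence "0 \<le> inner (half_plus (cayley Z) *v x) (half_minus (cayley Z) *v x)" by (simp add: P Q inner_commute)
    hence "(norm (cayley Z *v x))\<^sup>2 \<le> (norm x)\<^sup>2" by (simp add: inner_half_plus_minus)
    thus ?thesis by (rule power2_le_imp_le) simp
  qed
  thus ?thesis by (simp add: contractions_def)
qed

lemma numer_cayley:
  assumes C: "invertible C" and Z: "Z \<in> Upper"
  shows "numer C f z (cayley Z) =
    (mat (z + \<i>) - f - adjoint_mat C ** matrix_inv Z ** C) ** (matrix_inv C ** (Z ** matrix_inv (Z + mat \<i>)))"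
proof -
  define R where "R = matrix_inv (Z + mat \<i>)"
  have "mat \<i> ** (adjoint_mat C ** (mat \<i> ** R)) = mat \<i> ** (mat \<i> ** (adjoint_mat C ** R))"
    by (simp add: matrix_mul_assoc mult_mat_commute[of "adjoint_mat C"])
  also have "\<dots> = - (adjoint_mat C ** R)"
    by (simp add: vec_eq_iff mat_mult_component)
  finally have 1: "mat \<i> ** (adjoint_mat C ** (mat \<i> ** R)) = - (adjoint_mat C ** R)" .
  have 2: "adjoint_mat C ** matrix_inv Z ** C ** (matrix_inv C ** (Z ** R)) = adjoint_mat C ** R"
    by (simp add: matrix_mul_assoc[symmetric] matrix_inv_cancel_mult C Upper_invertible[OF Z])
  show ?thesis
    unfolding numer_def half_plus_cayley[OF Z] R_def[symmetric] 1
    by (subst (2) matrix_diff_rdistrib) (simp add: 2)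
qed

lemma shifted_site_Upper:
  assumes "hermitian f" "0 \<le> Im z" shows "mat (z + \<i>) - f \<in> Upper"
  using im_ge_add[OF im_ge_mat[of "z + \<i>"] im_ge_hermitian(2)[OF assms(1)]] assms(2) by (intro im_ge_Upper[of "Im z + 1"]) auto

lemma shifted_step_Upper:
  assumes "hermitian f" "0 \<le> Im z" "Z \<in> Upper"
  shows "mat (z + \<i>) - f - adjoint_mat C ** matrix_inv Z ** C \<in> Upper"
  using Upper_add[OF shifted_site_Upper[OF assms(1,2)] im_ge_neg_inv[OF assms(3), of C]] by simp

lemma moebius_general:
  assumes R: "invertible R" and S: "invertible S" and "numer C f z V = R ** S" "matrix_inv C ** half_plus V = S"
  shows "moebius_step C f z V = mat 1 - mat (2 * \<i>) ** matrix_inv R"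
  using assms by (simp add: moebius_step_def matrix_inv_mult matrix_inv_cancel_mult)

lemma mat_z_plus_i: "mat (z + \<i>) - f = (mat z - f) + mat \<i>" for f :: "complex^'m^'m"
  by (simp add: vec_eq_iff mat_def)

text \<open>The Cayley transform conjugates the Riccati step to the Moebius step.\<close>

lemma moebius_cayley:
  assumes C: "invertible C" and f: "hermitian f" and z: "0 \<le> Im z" and Z: "Z \<in> Upper"
  shows "moebius_step C f z (cayley Z) = cayley (mat z - f - adjoint_mat C ** matrix_inv Z ** C)"
proof -
  have S: "invertible (matrix_inv C ** (Z ** matrix_inv (Z + mat \<i>)))"
    by (intro invertible_mult invertible_matrix_inv C Upper_invertible Z Upper_plus_i)
  have "moebius_step C f z (cayley Z) = mat 1 - mat (2 * \<i>) ** matrix_inv (mat (z + \<i>) - f - adjoint_mat C ** matrix_inv Z ** C)"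
    by (rule moebius_general[OF Upper_invertible[OF shifted_step_Upper[OF f z Z]] S numer_cayley[OF C Z]])
       (simp add: half_plus_cayley[OF Z])
  thus ?thesis unfolding cayley_def mat_z_plus_i by (simp add: algebra_simps)
qed

lemma half_plus_1: "half_plus (mat 1) = mat 1" "half_minus (mat 1) = 0"
  by (simp_all add: half_plus_def half_minus_def vec_eq_iff)

lemma numer_1: "numer C f z (mat 1) = (mat (z + \<i>) - f) ** matrix_inv C"
  by (simp add: numer_def half_plus_1)

lemma moebius_1:
  assumes C: "invertible C" and f: "hermitian f" and z: "0 \<le> Im z"
  shows "moebius_step C f z (mat 1) = cayley (mat z - f)"
  using moebius_general[OF Upper_invertible[OF shifted_site_Upper[OF f z]] invertible_matrix_inv[OF C] numer_1]
  by (simp add: half_plus_1 cayley_def mat_z_plus_i)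

lemma continuous_on_numer [continuous_intros]:
  fixes z :: "'b::topological_space \<Rightarrow> complex"
  assumes "continuous_on S z" "continuous_on S V" shows "continuous_on S (\<lambda>x. numer C f (z x) (V x))"
  unfolding numer_def half_plus_def half_minus_def using assms by (intro continuous_intros)

lemma continuous_on_moebius:
  fixes z :: "'b::topological_space \<Rightarrow> complex"
  assumes "continuous_on S z" "continuous_on S V"
    and "invertible C" "hermitian f" "\<And>x. x \<in> S \<Longrightarrow> 0 \<le> Im (z x)" "\<And>x. x \<in> S \<Longrightarrow> V x \<in> contractions"
  shows "continuous_on S (\<lambda>x. moebius_step C f (z x) (V x))"
  unfolding moebius_step_def half_plus_def
  by (intro continuous_on_diff continuous_on_matrix_mult continuous_on_matrix_inv continuous_on_const
      continuous_on_scaleR continuous_on_add continuous_on_numer numer_invertible assms)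

section \<open>A logarithm for one step of the action\<close>

definition lift_domain :: "(complex \<times> (complex^'m^'m)) set" where
  "lift_domain = {z. 0 \<le> Im z} \<times> contractions"

lemma convex_lift_domain: "convex (lift_domain :: (complex \<times> (complex^'m^'m)) set)"
  unfolding lift_domain_def by (intro convex_Times convex_contractions convex_halfspace_Im_ge[of 0, simplified])

text \<open>The factor \<open>det C\<close> removes \<open>C^(-1)\<close> from the determinant at \<open>V = 1\<close>.
  The value at \<open>(\<i>, 1)\<close> fixes the branch in terms of \<^const>\<open>logdet\<close>, so that
  it depends continuously on \<open>f\<close>.\<close>

definition lift_log :: "complex^'m^'m \<Rightarrow> complex^'m^'m \<Rightarrow> complex \<times> (complex^'m^'m) \<Rightarrow> complex" where
  "lift_log C f = (SOME g. continuous_on lift_domain g \<and>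
     (\<forall>p\<in>lift_domain. exp (g p) = det C * det (numer C f (fst p) (snd p))) \<and>
     g (\<i>, mat 1) = logdet (mat (\<i> + \<i>) - f))"

lemma det_numer_1:
  assumes "invertible C" shows "det C * det (numer C f z (mat 1)) = det (mat (z + \<i>) - f)"
  using assms by (simp add: numer_1 det_mul det_matrix_inv invertible_det_nz)

lemma lift_log_props:
  assumes C: "invertible C" and f: "hermitian f"
  shows "continuous_on lift_domain (lift_log C f) \<and>
     (\<forall>p\<in>lift_domain. exp (lift_log C f p) = det C * det (numer C f (fst p) (snd p))) \<and>
     lift_log C f (\<i>, mat 1) = logdet (mat (\<i> + \<i>) - f)"
proof -
  define h where "h p = det C * det (numer C f (fst p) (snd p))" for p
  have ch: "continuous_on lift_domain h" unfolding h_def by (intro continuous_intros)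
  have nz: "h p \<noteq> 0" if "p \<in> lift_domain" for p
    using numer_invertible[OF C f, of "fst p" "snd p"] that C
    by (auto simp: h_def lift_domain_def invertible_det_nz)
  obtain g where g: "continuous_on lift_domain g" "\<And>p. p \<in> lift_domain \<Longrightarrow> h p = exp (g p)"
    using continuous_logarithm_on_contractible[OF ch convex_imp_contractible[OF convex_lift_domain] nz] by metis
  define c where "c = logdet (mat (\<i> + \<i>) - f) - g (\<i>, mat 1)"
  have p0: "(\<i>, mat 1) \<in> lift_domain" by (simp add: lift_domain_def mat_1_contraction)
  have "exp (logdet (mat (\<i> + \<i>) - f)) = h (\<i>, mat 1)"
    unfolding h_def fst_conv snd_conv det_numer_1[OF C]
    by (rule exp_logdet) (rule shifted_site_Upper[OF f], simp)
  hence "exp c = 1" using g(2)[OF p0] nz[OF p0] by (simp add: c_def exp_diff)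
  hence "continuous_on lift_domain (\<lambda>p. g p + c) \<and> (\<forall>p\<in>lift_domain. exp (g p + c) = det C * det (numer C f (fst p) (snd p))) \<and>
     g (\<i>, mat 1) + c = logdet (mat (\<i> + \<i>) - f)"
    using g by (auto simp: exp_add c_def h_def intro!: continuous_intros)
  thus ?thesis unfolding lift_log_def by (rule someI[where x = "\<lambda>p. g p + c"])
qed

lemma continuous_on_lift_log: "invertible C \<Longrightarrow> hermitian f \<Longrightarrow> continuous_on lift_domain (lift_log C f)"
  using lift_log_props by blast

lemma exp_lift_log: "invertible C \<Longrightarrow> hermitian f \<Longrightarrow> 0 \<le> Im z \<Longrightarrow> V \<in> contractions \<Longrightarrow>
  exp (lift_log C f (z, V)) = det C * det (numer C f z V)"
  using lift_log_props[of C f] unfolding lift_domain_def by force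

lemma continuous_on_lift_log_compose:
  fixes z :: "'b::topological_space \<Rightarrow> complex"
  assumes "invertible C" "hermitian f" "continuous_on S z" "continuous_on S V"
    "\<And>x. x \<in> S \<Longrightarrow> 0 \<le> Im (z x)" "\<And>x. x \<in> S \<Longrightarrow> V x \<in> contractions"
  shows "continuous_on S (\<lambda>x. lift_log C f (z x, V x))"
  by (rule continuous_on_compose2[OF continuous_on_lift_log[OF assms(1,2)] continuous_on_Pair[OF assms(3,4)]])
     (use assms in \<open>auto simp: lift_domain_def\<close>)

lemma lift_log_1:
  assumes C: "invertible C" and f: "hermitian f" and z: "0 \<le> Im z"
  shows "lift_log C f (z, mat 1) = logdet (mat (z + \<i>) - f)"
proof (rule continuous_log_unique[where S = "{z. 0 \<le> Im z}" and a = \<i> and x = z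
      and f = "\<lambda>z. lift_log C f (z, mat 1)" and g = "\<lambda>z. logdet (mat (z + \<i>) - f)"])
  show "connected {z. 0 \<le> Im z}" by (rule convex_connected[OF convex_halfspace_Im_ge[of 0, simplified]])
  show "continuous_on {z. 0 \<le> Im z} (\<lambda>z. lift_log C f (z, mat 1))"
    by (rule continuous_on_lift_log_compose[OF C f]) (auto simp: mat_1_contraction)
  show "continuous_on {z. 0 \<le> Im z} (\<lambda>z. logdet (mat (z + \<i>) - f))"
    by (intro continuous_intros shifted_site_Upper[OF f]) auto
  show "exp (lift_log C f (z, mat 1)) = exp (logdet (mat (z + \<i>) - f))" if "z \<in> {z. 0 \<le> Im z}" for z
    using that by (simp only: mem_Collect_eq exp_lift_log[OF C f _ mat_1_contraction] det_numer_1[OF C] exp_logdet[OF shifted_site_Upper[OF f]])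
  show "lift_log C f (\<i>, mat 1) = logdet (mat (\<i> + \<i>) - f)" using lift_log_props[OF C f] by blast
qed (use z in auto)

lemma half_scalar: "half_plus (t *\<^sub>R mat 1) = ((1 + t) / 2) *\<^sub>R mat 1" "half_minus (t *\<^sub>R mat 1) = ((1 - t) / 2) *\<^sub>R mat 1"
  by (simp_all add: half_plus_def half_minus_def vec_eq_iff mat_def scaleR_conv_of_real[where 'a=complex] field_simps)

lemma im_ge_i_gram: "im_ge 0 (mat \<i> ** (adjoint_mat C ** C))"
proof -
  have "0 \<le> inner (\<i> *s v) ((mat \<i> ** (adjoint_mat C ** C)) *v v)" for v
    by (simp add: matrix_vector_mul_assoc[symmetric] mat_vector_mult inner_adjoint_mat[symmetric])
  thus ?thesis by (simp add: im_ge_def)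
qed

text \<open>Moving from \<open>V = 1\<close> to \<open>V = 0\<close> along real multiples of the identity, where the
  determinant is that of a matrix in \<^const>\<open>Upper\<close>. This fixes the branch at the Cayley
  transform of \<open>\<i>\<close>, which is \<open>0\<close>.\<close>

lemma lift_log_0:
  assumes C: "invertible C" and f: "hermitian f"
  shows "lift_log C f (\<i>, 0) = logdet ((1/2) *\<^sub>R (mat (\<i> + \<i>) - f + mat \<i> ** (adjoint_mat C ** C)))"
proof -
  define G where "G = mat \<i> ** (adjoint_mat C ** C)"
  define R where "R t = ((1 + t) / 2) *\<^sub>R (mat (\<i> + \<i>) - f) + ((1 - t) / 2) *\<^sub>R G" for t :: real
  have U: "R t \<in> Upper" if "t \<in> {0..1}" for t
    unfolding R_def using that im_ge_scaleR[OF im_ge_i_gram[of C], of "(1 - t)/2"]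
    by (intro Upper_add Upper_scaleR shifted_site_Upper[OF f]) (auto simp: G_def)
  have "lift_log C f (\<i>, 0 *\<^sub>R mat 1) = logdet (R 0)"
  proof (rule continuous_log_unique[where S = "{0..1::real}" and a = 1 and x = 0
      and f = "\<lambda>t. lift_log C f (\<i>, t *\<^sub>R mat 1)" and g = "\<lambda>t. logdet (R t)"])
    show "continuous_on {0..1} (\<lambda>t. lift_log C f (\<i>, t *\<^sub>R mat 1))"
      by (rule continuous_on_lift_log_compose[OF C f]) (auto intro!: continuous_intros scalar_contraction)
    show "continuous_on {0..1} (\<lambda>t. logdet (R t))"
      by (rule continuous_on_logdet_compose[OF _ U]) (auto simp: R_def intro!: continuous_intros)
    show "exp (lift_log C f (\<i>, t *\<^sub>R mat 1)) = exp (logdet (R t))" if t: "t \<in> {0..1}" for t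
    proof -
      have "numer C f \<i> (t *\<^sub>R mat 1) ** C = R t"
        using matrix_inv_left_right[OF C]
        by (simp add: numer_def half_scalar R_def G_def matrix_scaleR_left matrix_scaleR_right matrix_mult_add_left
            matrix_mul_assoc[symmetric])
      hence "det C * det (numer C f \<i> (t *\<^sub>R mat 1)) = det (R t)" by (metis det_mul mult.commute)
      moreover have "exp (lift_log C f (\<i>, t *\<^sub>R mat 1)) = det C * det (numer C f \<i> (t *\<^sub>R mat 1))"
        using t by (intro exp_lift_log C f scalar_contraction) auto
      ultimately show ?thesis using exp_logdet[OF U[OF t]] by simp
    qed
    show "lift_log C f (\<i>, 1 *\<^sub>R mat 1) = logdet (R 1)"
      using lift_log_1[OF C f, of \<i>] by (simp add: R_def)
  qed auto
  thus ?thesis by (simp add: R_def G_def scaleR_add_right scaleR_diff_right)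
qed

lemma mat_mult_mat: "mat c ** mat d = (mat (c * d) :: complex^'m^'m)"
  by (simp add: vec_eq_iff mat_mult_component) (simp add: mat_def)

text \<open>The determinant identity behind this is \<open>numer_cayley\<close>. Over the connected set of all pairs
  \<open>(z, Z)\<close> the branches agree because they agree at \<open>(\<i>, \<i>)\<close>.\<close>

lemma lift_log_cayley:
  fixes C f Z :: "complex^'m^'m"
  assumes C: "invertible C" and f: "hermitian f" and z: "0 \<le> Im z" and Z: "Z \<in> Upper"
  shows "lift_log C f (z, cayley Z) =
    logdet Z + logdet (mat (z + \<i>) - f - adjoint_mat C ** matrix_inv Z ** C) - logdet (Z + mat \<i>)"
proof -
  define S where "S = {z. 0 \<le> Im z} \<times> (Upper :: (complex^'m^'m) set)"
  define R where "R p = mat (fst p + \<i>) - f - adjoint_mat C ** matrix_inv (snd p) ** C" for p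
  have RU: "R p \<in> Upper" if "p \<in> S" for p
    unfolding R_def using that by (intro shifted_step_Upper[OF f]) (auto simp: S_def)
  have "lift_log C f (fst (z, Z), cayley (snd (z, Z))) = logdet (snd (z, Z)) + logdet (R (z, Z)) - logdet (snd (z, Z) + mat \<i>)"
  proof (rule continuous_log_unique[where S = S and a = "(\<i>, mat \<i>)" and x = "(z, Z)"
      and f = "\<lambda>p. lift_log C f (fst p, cayley (snd p))" and g = "\<lambda>p. logdet (snd p) + logdet (R p) - logdet (snd p + mat \<i>)"])
    show "connected S" unfolding S_def
      by (intro convex_connected convex_Times convex_Upper convex_halfspace_Im_ge[of 0, simplified])
    have inv: "invertible (snd p)" "invertible (snd p + mat \<i>)" if "p \<in> S" for p
      using that by (auto simp: S_def intro!: Upper_invertible Upper_plus_i)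
    have c1: "continuous_on S (\<lambda>p. cayley (snd p))"
      unfolding cayley_def by (intro continuous_intros inv)
    show "continuous_on S (\<lambda>p. lift_log C f (fst p, cayley (snd p)))"
      by (rule continuous_on_lift_log_compose[OF C f _ c1]) (auto simp: S_def intro!: continuous_intros cayley_contraction)
    have c2: "continuous_on S R" unfolding R_def by (intro continuous_intros inv)
    show "continuous_on S (\<lambda>p. logdet (snd p) + logdet (R p) - logdet (snd p + mat \<i>))"
      by (intro continuous_on_diff continuous_on_add continuous_on_logdet_compose c2 RU)
         (auto simp: S_def intro!: continuous_intros Upper_plus_i)
    show "exp (lift_log C f (fst p, cayley (snd p))) = exp (logdet (snd p) + logdet (R p) - logdet (snd p + mat \<i>))"
      if p: "p \<in> S" for p
    proof -
      have Z: "snd p \<in> Upper" and z: "0 \<le> Im (fst p)" using p by (auto simp: S_def)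
      have "exp (lift_log C f (fst p, cayley (snd p))) = det C * det (numer C f (fst p) (cayley (snd p)))"
        by (intro exp_lift_log C f z cayley_contraction Z)
      also have "\<dots> = det (snd p) * det (R p) / det (snd p + mat \<i>)"
        unfolding numer_cayley[OF C Z] R_def[symmetric]
        using C inv[OF p] by (simp add: det_mul det_matrix_inv invertible_det_nz divide_inverse)
      also have "\<dots> = exp (logdet (snd p) + logdet (R p) - logdet (snd p + mat \<i>))"
        by (simp add: exp_add exp_diff exp_logdet Z RU[OF p] Upper_plus_i[OF Z])
      finally show ?thesis .
    qed
    show "(\<i>, mat \<i>) \<in> S" by (simp add: S_def mat_Upper)
    have 2: "mat \<i> + mat \<i> = (2 *\<^sub>R mat \<i> :: complex^'m^'m)" by (simp add: scaleR_2)
    have 3: "matrix_inv (mat \<i>) = (mat (- \<i>) :: complex^'m^'m)"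
      by (rule matrix_inv_eqI) (simp add: mat_mult_mat)
    have 4: "matrix_inv (2 *\<^sub>R mat \<i> :: complex^'m^'m) = mat (- \<i> / 2)"
      by (rule matrix_inv_eqI) (simp add: matrix_scaleR_left mat_mult_mat, simp add: vec_eq_iff mat_def scaleR_conv_of_real[where 'a=complex])
    \<comment> \<open>The base point \<open>Z = \<i>\<close> is the centre of the ball, where \<open>lift_log_0\<close> gives the value.\<close>
    have 5: "cayley (mat \<i> :: complex^'m^'m) = 0"
      unfolding cayley_def 2 4 by (simp add: mat_mult_mat)
    define A where "A = mat (\<i> + \<i>) - f + mat \<i> ** (adjoint_mat C ** C)"
    have AU: "A \<in> Upper" unfolding A_def by (intro Upper_add shifted_site_Upper[OF f] im_ge_i_gram) simp
    have 6: "R (\<i>, mat \<i>) = A"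
      by (simp add: R_def A_def 3 mult_mat_commute[of "adjoint_mat C"] matrix_mul_assoc[symmetric])
         (simp add: vec_eq_iff mat_mult_component)
    have iU: "mat \<i> \<in> (Upper :: (complex^'m^'m) set)" by (simp add: mat_Upper)
    show "lift_log C f (fst (\<i>, mat \<i>), cayley (snd (\<i>, mat \<i>))) =
      logdet (snd (\<i>, mat \<i> :: complex^'m^'m)) + logdet (R (\<i>, mat \<i>)) - logdet (snd (\<i>, mat \<i> :: complex^'m^'m) + mat \<i>)"
      unfolding fst_conv snd_conv 5 6 2 lift_log_0[OF C f] A_def[symmetric]
      by (simp add: logdet_scaleR[OF AU] logdet_scaleR[OF iU] ln_div)
    show "(z, Z) \<in> S" using z Z by (simp add: S_def)
  qed
  thus ?thesis by (simp add: R_def)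
qed

text \<open>The orbit of the identity matrix. As the identity is the Cayley transform of infinity, the next point is the
  Cayley transform of \<open>z - F 0\<close>, and the orbit follows the Riccati recursion with a shift of one
  index.\<close>

fun moebius_orbit :: "complex^'m^'m \<Rightarrow> (nat \<Rightarrow> complex^'m^'m) \<Rightarrow> complex \<Rightarrow> nat \<Rightarrow> complex^'m^'m" where
  "moebius_orbit C F z 0 = mat 1"
| "moebius_orbit C F z (Suc j) = moebius_step C (F j) z (moebius_orbit C F z j)"

definition lift_sum :: "complex^'m^'m \<Rightarrow> (nat \<Rightarrow> complex^'m^'m) \<Rightarrow> complex \<Rightarrow> nat \<Rightarrow> real" where
  "lift_sum C F z n = (\<Sum>j<n. Im (lift_log C (F j) (z, moebius_orbit C F z j)))"

lemma moebius_orbit_contraction: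
  "invertible C \<Longrightarrow> (\<And>j. hermitian (F j)) \<Longrightarrow> 0 \<le> Im z \<Longrightarrow> moebius_orbit C F z j \<in> contractions"
  by (induction j) (auto simp: mat_1_contraction intro: moebius_contraction)

lemma continuous_on_moebius_orbit:
  assumes "invertible C" "\<And>j. hermitian (F j)"
  shows "continuous_on {z. 0 \<le> Im z} (\<lambda>z. moebius_orbit C F z j)"
proof (induction j)
  case (Suc j)
  show ?case unfolding moebius_orbit.simps
    by (rule continuous_on_moebius) (auto intro!: Suc assms moebius_orbit_contraction continuous_intros)
qed auto

lemma continuous_on_lift_sum:
  assumes "invertible C" "\<And>j. hermitian (F j)"
  shows "continuous_on {z. 0 \<le> Im z} (\<lambda>z. lift_sum C F z n)"
  unfolding lift_sum_def
  by (intro continuous_on_sum continuous_on_Im continuous_on_lift_log_compose continuous_on_moebius_orbit assms continuous_on_id)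
     (auto intro: moebius_orbit_contraction assms)

lemma moebius_orbit_cayley:
  assumes C: "invertible C" and F: "\<And>j. hermitian (F j)" and s: "0 < s"
  shows "moebius_orbit C F (Complex E s) (Suc j) = cayley (riccati C (site E F s) (site E F s 0) j)"
proof (induction j)
  case 0
  show ?case using moebius_1[OF C F, of "Complex E s" 0] s by (simp add: site_def)
next
  case (Suc j)
  have "riccati C (site E F s) (site E F s 0) j \<in> Upper"
    using s F by (intro riccati_Upper im_ge_Upper[OF site_im_ge]) auto
  from moebius_cayley[OF C F _ this, of "Complex E s" "Suc j"] s Suc show ?case
    by (simp add: site_def[of E F s "Suc j"])
qed

text \<open>Along the orbit the terms of \<open>lift_log_cayley\<close> telescope.\<close>

lemma lift_sum_Suc:
  assumes C: "invertible C" and F: "\<And>j. hermitian (F j)" and s: "0 < s"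
  shows "lift_sum C F (Complex E s) (Suc n) = phase_sum C (site E F s) (site E F s 0) n +
    Im (logdet (riccati C (site E F s) (site E F s 0) n + mat \<i>))"
proof (induction n)
  case 0
  have "mat (Complex E s + \<i>) - F 0 = site E F s 0 + mat \<i>" by (simp add: site_def vec_eq_iff mat_def)
  thus ?case using lift_log_1[OF C F, of "Complex E s" 0] s by (simp add: lift_sum_def phase_sum_def)
next
  case (Suc n)
  define L where "L = riccati C (site E F s) (site E F s 0)"
  have U: "L n \<in> Upper" unfolding L_def using s F by (intro riccati_Upper im_ge_Upper[OF site_im_ge]) auto
  have "mat (Complex E s + \<i>) - F (Suc n) - adjoint_mat C ** matrix_inv (L n) ** C = L (Suc n) + mat \<i>"
    by (simp add: L_def site_def vec_eq_iff mat_def)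
  hence "lift_log C (F (Suc n)) (Complex E s, moebius_orbit C F (Complex E s) (Suc n)) =
    logdet (L n) + logdet (L (Suc n) + mat \<i>) - logdet (L n + mat \<i>)"
    using lift_log_cayley[OF C F _ U, of "Complex E s" "Suc n"] s
    unfolding moebius_orbit_cayley[where F = F, OF C F s] L_def[symmetric] by simp
  hence "lift_sum C F (Complex E s) (Suc (Suc n)) = lift_sum C F (Complex E s) (Suc n) +
    Im (logdet (L n)) + Im (logdet (L (Suc n) + mat \<i>)) - Im (logdet (L n + mat \<i>))"
    unfolding lift_sum_def sum.lessThan_Suc[of _ "Suc n"] by simp
  thus ?case using Suc by (simp add: L_def phase_sum_def)
qed

lemma lift_sum_close:
  fixes C :: "complex^'m^'m"
  assumes C: "invertible C" and F: "\<And>j. hermitian (F j)" and s: "0 < s"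
  shows "\<bar>lift_sum C F (Complex E s) n - phase_sum C (site E F s) (site E F s 0) n\<bar> \<le> 4 * pi * CARD('m)"
proof (cases n)
  case (Suc k)
  define L where "L = riccati C (site E F s) (site E F s 0)"
  have U: "L k \<in> Upper" unfolding L_def using s F by (intro riccati_Upper im_ge_Upper[OF site_im_ge]) auto
  have "lift_sum C F (Complex E s) n - phase_sum C (site E F s) (site E F s 0) n = Im (logdet (L k + mat \<i>)) - Im (logdet (L k))"
    unfolding Suc lift_sum_Suc[where F = F, OF C F s] by (simp add: phase_sum_def L_def)
  with Im_logdet_bound[OF U] Im_logdet_bound[OF Upper_plus_i[OF U]] show ?thesis by (simp add: abs_le_iff)
qed (simp add: lift_sum_def phase_sum_def)

text \<open>Put \<open>P = half_plus V\<close> and \<open>Q = half_minus V\<close>. If \<open>P\<close> is invertible,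
  both matrices are products of \<open>a + i B P^(-1) Q C\<close> with a matrix similar to \<open>P\<close>.
  The contractions \<open>t V\<close> with \<open>t < 1\<close> satisfy this and approximate \<open>V\<close>.\<close>

lemma det_swap:
  fixes C a V :: "complex^'m^'m"
  assumes C: "invertible C" and V: "V \<in> contractions"
  defines "B \<equiv> adjoint_mat C"
  shows "det (B ** (half_plus V ** (matrix_inv B ** a)) + mat \<i> ** (B ** (half_minus V ** C))) =
         det (a ** (matrix_inv C ** (half_plus V ** C)) + mat \<i> ** (B ** (half_minus V ** C)))"
proof -
  have B: "invertible B" unfolding B_def by (rule invertible_adjoint_mat[OF C])
  define l where "l V = det (B ** (half_plus V ** (matrix_inv B ** a)) + mat \<i> ** (B ** (half_minus V ** C)))" for V
  define r where "r V = det (a ** (matrix_inv C ** (half_plus V ** C)) + mat \<i> ** (B ** (half_minus V ** C)))" for V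
  have eq: "l V = r V" if P: "invertible (half_plus V)" for V
  proof -
    define P Q where "P = half_plus V" and "Q = half_minus V"
    have PQ: "P ** Q = Q ** P"
      by (simp add: P_def Q_def half_plus_def half_minus_def matrix_scaleR_left matrix_scaleR_right matrix_mult_add_left
          matrix_add_ldistrib matrix_diff_ldistrib matrix_diff_rdistrib scaleR_add_right scaleR_diff_right)
    have "matrix_inv P ** Q = matrix_inv P ** (Q ** (P ** matrix_inv P))" using P by (simp add: P_def matrix_inv_left_right)
    also have "\<dots> = matrix_inv P ** (P ** (Q ** matrix_inv P))" by (simp add: PQ[symmetric] matrix_mul_assoc)
    also have "\<dots> = Q ** matrix_inv P" using P by (simp add: P_def matrix_inv_cancel_mult)
    finally have PQ': "matrix_inv P ** Q = Q ** matrix_inv P" .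
    define X where "X = a + mat \<i> ** (B ** (matrix_inv P ** (Q ** C)))"
    have i: "K ** (mat \<i> ** K') = mat \<i> ** (K ** K')" for K K' :: "complex^'m^'m"
      by (simp add: matrix_mul_assoc mult_mat_commute[of K])
    have 1: "B ** (P ** (matrix_inv B ** a)) + mat \<i> ** (B ** (Q ** C)) = (B ** (P ** matrix_inv B)) ** X"
      using P B unfolding P_def[symmetric] X_def
      by (simp add: matrix_add_ldistrib matrix_mul_assoc[symmetric] i matrix_inv_cancel_mult)
    have X2: "X = a + mat \<i> ** (B ** (Q ** (matrix_inv P ** C)))"
      unfolding X_def by (metis PQ' matrix_mul_assoc)
    have 2: "a ** (matrix_inv C ** (P ** C)) + mat \<i> ** (B ** (Q ** C)) = X ** (matrix_inv C ** (P ** C))"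
      using P C unfolding P_def[symmetric] X2
      by (simp add: matrix_mult_add_left matrix_mul_assoc[symmetric] matrix_inv_cancel_mult)
    show ?thesis unfolding l_def r_def P_def[symmetric] Q_def[symmetric] 1 2
      using B C by (simp add: det_mul det_matrix_inv invertible_det_nz)
  qed
  define t where "t n = 1 - inverse (real (Suc n))" for n
  have t: "0 \<le> t n" "t n < 1" for n by (simp_all add: t_def inverse_le_1_iff)
  have tl: "(\<lambda>n. t n *\<^sub>R V) \<longlonglongrightarrow> V"
  proof -
    have "t \<longlonglongrightarrow> 1 - 0" unfolding t_def by (intro tendsto_diff tendsto_const LIMSEQ_inverse_real_of_nat)
    from tendsto_scaleR[OF this tendsto_const[of V]] show ?thesis by simp
  qed
  have "invertible (half_plus (t n *\<^sub>R V))" for n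
  proof (rule invertible_injI)
    fix v assume "half_plus (t n *\<^sub>R V) *v v = 0"
    hence "v = - (t n *\<^sub>R (V *v v))"
      by (simp add: half_plus_def matrix_vector_scaleR_left matrix_vector_mult_add_rdistrib eq_neg_iff_add_eq_0)
    hence "norm v = t n * norm (V *v v)" using t(1)[of n] by (metis abs_of_nonneg norm_minus_cancel norm_scaleR)
    also have "\<dots> \<le> t n * norm v" using V t(1)[of n] by (intro mult_left_mono) (auto simp: contractions_def)
    finally have "(1 - t n) * norm v \<le> 0" by (simp add: algebra_simps)
    thus "v = 0" using t(2)[of n] by (simp add: mult_le_0_iff)
  qed
  hence e: "l (t n *\<^sub>R V) = r (t n *\<^sub>R V)" for n by (rule eq)
  have "(\<lambda>n. l (t n *\<^sub>R V)) \<longlonglongrightarrow> l V" "(\<lambda>n. r (t n *\<^sub>R V)) \<longlonglongrightarrow> r V"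
    unfolding l_def r_def half_plus_def half_minus_def by (intro tendsto_intros tl)+
  hence "l V = r V" using LIMSEQ_unique by (simp add: e)
  thus ?thesis by (simp add: l_def r_def)
qed

text \<open>Let \<open>N\<close> be the denominator and \<open>D\<close> the numerator of the Moebius step. By
  \<open>det_swap\<close> the complex conjugate of \<open>det C * det N\<close> is
  \<open>det W * det D * det C\<close>, so that \<open>det N / det D\<close> is \<open>det W\<close> times the
  quotient of \<open>exp h\<close> by its conjugate, \<open>h\<close> being \<^const>\<open>lift_log\<close>.\<close>

lemma det_moebius_unitary:
  fixes C f W :: "complex^'m^'m" and E :: real
  assumes C: "invertible C" and f: "hermitian f" and W: "W \<in> unitary_group"
  defines "z \<equiv> complex_of_real E" and "V \<equiv> adjoint_mat W"
  shows "det (adjoint_mat (moebius_step C f z V)) = det W * exp (2 * \<i> * Im (lift_log C f (z, V)))"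
proof -
  define P Q where "P = half_plus V" and "Q = half_minus V"
  define a b where "a = mat (z + \<i>) - f" and "b = mat (z - \<i>) - f"
  define N where "N = numer C f z V"
  define D where "D = b ** (matrix_inv C ** P) + mat \<i> ** (adjoint_mat C ** Q)"
  have V: "V \<in> unitary_group" unfolding V_def by (rule adjoint_unitary[OF W])
  have Vc: "V \<in> contractions" by (rule unitary_contraction[OF V])
  have z: "Im z = 0" by (simp add: z_def)
  have Ni: "invertible N" unfolding N_def by (rule numer_invertible[OF C f _ Vc]) (simp add: z)
  have WV: "W ** V = mat 1" unfolding V_def by (rule unitary_inverse(2)[OF W])
  have NI: "N = a ** (matrix_inv C ** P) + mat \<i> ** (adjoint_mat C ** Q)"
    by (simp add: N_def numer_def a_def P_def Q_def)
  have "a - b = mat (2 * \<i>)" by (simp add: a_def b_def vec_eq_iff mat_def)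
  hence "N - mat (2 * \<i>) ** (matrix_inv C ** P) = D"
    by (simp add: NI D_def flip: matrix_diff_rdistrib) (simp add: matrix_diff_rdistrib flip: \<open>a - b = mat (2 * \<i>)\<close>)
  hence "moebius_step C f z V ** N = D"
    using matrix_inv_left_right[OF Ni]
    by (simp add: moebius_step_def N_def[symmetric] P_def[symmetric] matrix_diff_rdistrib matrix_mul_assoc[symmetric])
  hence dM: "det (moebius_step C f z V) * det N = det D" by (metis det_mul)
  have MU: "moebius_step C f z V \<in> unitary_group" by (rule moebius_unitary[OF C f z V])
  have "det (adjoint_mat (moebius_step C f z V)) * det (moebius_step C f z V) = 1"
    using unitary_inverse(1)[OF MU] by (metis det_I det_mul)
  hence 1: "det (adjoint_mat (moebius_step C f z V)) * det D = det N" using dM by (metis mult.assoc mult_1)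
  have adj_a: "adjoint_mat a = b"
    using f by (simp add: a_def b_def adjoint_mat_diff hermitian_def z_def)
  have adj_P: "adjoint_mat P = W ** P" and adj_Q: "adjoint_mat Q = - (W ** Q)"
    by (simp_all add: P_def Q_def half_plus_def half_minus_def adjoint_mat_scaleR adjoint_mat_add adjoint_mat_diff
        matrix_scaleR_right matrix_add_ldistrib matrix_diff_ldistrib WV) (simp_all add: V_def add.commute flip: scaleR_minus_right)
  define B where "B = adjoint_mat C"
  have Bi: "adjoint_mat (matrix_inv C) = matrix_inv B"
  proof -
    have "B ** adjoint_mat (matrix_inv C) = mat 1"
      unfolding B_def adjoint_mat_mult[symmetric] using matrix_inv_left_right[OF C] by simp
    from matrix_inv_eqI(1)[OF this] show ?thesis by simp
  qed
  have i: "K ** (mat \<i> ** K') = mat \<i> ** (K ** K')" for K K' :: "complex^'m^'m"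
    by (simp add: matrix_mul_assoc mult_mat_commute[of K])
  have "adjoint_mat N = W ** (P ** (matrix_inv B ** b) + mat \<i> ** (Q ** C))"
  proof -
    have "adjoint_mat N = adjoint_mat P ** (matrix_inv B ** b) + adjoint_mat Q ** C ** mat (- \<i>)"
      unfolding NI adjoint_mat_add adjoint_mat_mult Bi adj_a by (simp add: matrix_mul_assoc)
    also have "adjoint_mat Q ** C ** mat (- \<i>) = mat \<i> ** (W ** (Q ** C))"
      unfolding mult_mat_commute[of "adjoint_mat Q ** C"] unfolding adj_Q
      by (simp add: vec_eq_iff mat_mult_component matrix_mult_uminus_left matrix_mul_assoc[symmetric])
    finally show ?thesis unfolding adj_P by (simp add: matrix_add_ldistrib i matrix_mul_assoc[symmetric])
  qed
  hence "adjoint_mat (N ** C) = B ** (W ** (P ** (matrix_inv B ** b) + mat \<i> ** (Q ** C)))"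
    by (simp add: adjoint_mat_mult B_def)
  hence "cnj (det C * det N) = det B * (det W * det (P ** (matrix_inv B ** b) + mat \<i> ** (Q ** C)))"
    by (metis det_adjoint_mat det_mul mult.commute)
  also have "\<dots> = det W * det (B ** (P ** (matrix_inv B ** b)) + mat \<i> ** (B ** (Q ** C)))"
  proof -
    have "B ** (P ** (matrix_inv B ** b)) + mat \<i> ** (B ** (Q ** C)) = B ** (P ** (matrix_inv B ** b) + mat \<i> ** (Q ** C))"
      by (simp add: matrix_add_ldistrib i)
    thus ?thesis by (simp add: det_mul)
  qed
  also have "det (B ** (P ** (matrix_inv B ** b)) + mat \<i> ** (B ** (Q ** C))) =
      det (b ** (matrix_inv C ** (P ** C)) + mat \<i> ** (B ** (Q ** C)))"
    unfolding P_def Q_def B_def by (rule det_swap[OF C Vc])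
  also have "b ** (matrix_inv C ** (P ** C)) + mat \<i> ** (B ** (Q ** C)) = D ** C"
    by (simp add: D_def B_def matrix_mult_add_left matrix_mul_assoc)
  finally have 2: "cnj (det C * det N) = det W * (det D * det C)" by (simp add: det_mul)
  define h where "h = lift_log C f (z, V)"
  have h: "exp h = det C * det N" unfolding h_def N_def by (rule exp_lift_log[OF C f _ Vc]) (simp add: z)
  have "2 * \<i> * Im h = h - cnj h" by (simp add: complex_eq_iff)
  hence "exp (2 * \<i> * Im h) * cnj (exp h) = exp h" by (simp add: exp_diff exp_cnj)
  hence "exp (2 * \<i> * Im h) * (det W * (det D * det C)) = det C * det N" by (simp only: h 2)
  hence "det C * (det W * exp (2 * \<i> * Im h) * det D) = det C * det N" by (simp add: ac_simps)
  moreover have "det C \<noteq> 0" using C invertible_det_nz by blast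
  ultimately have "det W * exp (2 * \<i> * Im h) * det D = det N" by simp
  moreover have "det D \<noteq> 0"
    using 1 Ni by (auto simp: invertible_det_nz)
  ultimately show ?thesis using 1 unfolding h_def[symmetric] by (metis mult_right_cancel)
qed

section \<open>Lagrangian subspaces and the Schroedinger action\<close>

lemma sum_UNIV_sum_type: "(\<Sum>i\<in>(UNIV :: ('m::finite + 'm) set). g i) = (\<Sum>i\<in>UNIV. g (Inl i)) + (\<Sum>i\<in>UNIV. g (Inr i))"
proof -
  have "(\<Sum>i\<in>(UNIV :: ('m + 'm) set). g i) = sum g (range Inl) + sum g (range Inr)"
    unfolding UNIV_sum by (rule sum.union_disjoint) auto
  thus ?thesis by (simp add: sum.reindex)
qed

lemma block_mat_stack_mat:
  fixes P Q R S X Y :: "'a::semiring_1^'m^'m"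
  shows "block_mat P Q R S ** stack_mat X Y = stack_mat (P ** X + Q ** Y) (R ** X + S ** Y)"
  unfolding vec_eq_iff
proof (intro allI)
  fix i j
  show "(block_mat P Q R S ** stack_mat X Y) $ i $ j = stack_mat (P ** X + Q ** Y) (R ** X + S ** Y) $ i $ j"
    by (cases i) (simp_all add: matrix_matrix_mult_def block_mat_def stack_mat_def sum_UNIV_sum_type)
qed

lemma stack_mat_mult:
  fixes X Y K :: "'a::semiring_1^'m^'m"
  shows "stack_mat X Y ** K = stack_mat (X ** K) (Y ** K)"
  unfolding vec_eq_iff
proof (intro allI)
  fix i j
  show "(stack_mat X Y ** K) $ i $ j = stack_mat (X ** K) (Y ** K) $ i $ j"
    by (cases i) (simp_all add: matrix_matrix_mult_def stack_mat_def)
qed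

lemma stack_mat_inject: "stack_mat X Y = stack_mat X' Y' \<longleftrightarrow> X = X' \<and> Y = Y'"
proof
  assume *: "stack_mat X Y = stack_mat X' Y'"
  have "stack_mat X Y $ i $ j = stack_mat X' Y' $ i $ j" for i j using * by simp
  from this[of "Inl _"] this[of "Inr _"] show "X = X' \<and> Y = Y'" by (simp add: stack_mat_def vec_eq_iff)
qed auto

lemma stack_mat_vector_eq_0: "stack_mat X Y *v v = 0 \<longleftrightarrow> X *v v = 0 \<and> Y *v (v :: 'a::semiring_1^'m) = 0"
proof -
  have 1: "(stack_mat X Y *v v) $ Inl i = (X *v v) $ i" "(stack_mat X Y *v v) $ Inr i = (Y *v v) $ i" for i
    by (simp_all add: stack_mat_def matrix_vector_mult_def)
  have "(\<forall>i. (stack_mat X Y *v v) $ i = 0) \<longleftrightarrow> (\<forall>i. (X *v v) $ i = 0) \<and> (\<forall>i. (Y *v v) $ i = 0)"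
    unfolding 1[symmetric] by (rule split_sum_all)
  thus ?thesis by (simp add: vec_eq_iff)
qed

lemma full_column_rank_iff:
  fixes A :: "complex^'m^'k"
  shows "rank A = CARD('m) \<longleftrightarrow> (\<forall>v. A *v v = 0 \<longrightarrow> v = 0)"
proof -
  have "rank A = CARD('m) \<longleftrightarrow> vec.span (rows A) = UNIV"
    unfolding row_rank_def_gen using vec.dim_eq_full[of "rows A"] vec_dim_card[where 'a=complex and 'n='m]
    by (simp add: vec.dimension_def card_cart_basis)
  thus ?thesis using matrix_left_invertible_span_rows_gen[of A] matrix_left_invertible_ker[of A] by simp
qed

lemma span_columns_eq_range:
  fixes A :: "complex^'m^'k"
  shows "vec.span (columns A) = range ((*v) A)"
proof
  show "range ((*v) A) \<subseteq> vec.span (columns A)" using matrix_vector_mult_in_columnspace_gen by blast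
  have "columns A \<subseteq> range ((*v) A)"
  proof
    fix x assume "x \<in> columns A"
    then obtain i where "x = column i A" by (auto simp: columns_def)
    hence "x = A *v axis i 1" by (simp add: vec_eq_iff matrix_vector_mult_axis column_def)
    thus "x \<in> range ((*v) A)" by blast
  qed
  moreover have "vec.subspace (range ((*v) A))"
    by (intro vec.subspaceI) (auto simp: image_iff intro: exI[of _ 0] exI[of _ "_ + _"] exI[of _ "_ *s _"]
        matrix_vector_right_distrib[symmetric] vector_scalar_commute[symmetric])
  ultimately show "vec.span (columns A) \<subseteq> range ((*v) A)" by (rule vec.span_minimal)
qed

lemma lagrangian_frame_iff:
  "lagrangian_frame X Y \<Lambda> \<longleftrightarrow> (\<forall>v. X *v v = 0 \<and> Y *v v = 0 \<longrightarrow> v = 0) \<and>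
     adjoint_mat X ** Y = adjoint_mat Y ** X \<and> \<Lambda> = range ((*v) (stack_mat X Y))"
  unfolding lagrangian_frame_def full_column_rank_iff stack_mat_vector_eq_0 span_columns_eq_range by blast

text \<open>By the symmetry condition a kernel vector \<open>v\<close> satisfies \<open>|X v|^2 + |Y v|^2 = 0\<close>.\<close>

lemma frame_denominator_invertible:
  fixes X Y :: "complex^'m^'m"
  assumes k: "\<And>v. X *v v = 0 \<Longrightarrow> Y *v v = 0 \<Longrightarrow> v = 0" and h: "adjoint_mat X ** Y = adjoint_mat Y ** X"
  shows "invertible (X - scale_mat \<i> Y)"
proof (rule invertible_injI)
  fix v assume "(X - scale_mat \<i> Y) *v v = 0"
  hence e: "X *v v = \<i> *s (Y *v v)"
    by (simp add: scale_mat_eq_mult matrix_vector_mult_diff_rdistrib matrix_vector_mul_assoc[symmetric] mat_vector_mult)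
  have "hermitian (adjoint_mat X ** Y)" by (simp add: hermitian_def adjoint_mat_mult h)
  from hermitian_inner[OF this, of v]
  have "inner (\<i> *s (X *v v)) (Y *v v) = 0"
    by (simp add: matrix_vector_mul_assoc[symmetric] inner_adjoint_mat_right vector_scalar_commute)
  hence "inner (\<i> *s (\<i> *s (Y *v v))) (Y *v v) = 0" by (simp only: e)
  hence "inner (Y *v v) (Y *v v) = 0" by (simp add: inner_i_left[of "\<i> *s _"])
  hence y: "Y *v v = 0" by simp
  with e have "X *v v = 0" by simp
  with y show "v = 0" using k by blast
qed

lemma frame_invertible: "lagrangian_frame X Y \<Lambda> \<Longrightarrow> invertible (X - scale_mat \<i> Y)"
  unfolding lagrangian_frame_iff by (intro frame_denominator_invertible) blast+

text \<open>Two frames of the same subspace differ by an invertible factor on the right, which cancels.\<close>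

lemma lagrangian_unitary_frame:
  fixes X Y :: "complex^'m^'m"
  assumes fr: "lagrangian_frame X Y \<Lambda>"
  shows "lagrangian_unitary \<Lambda> = (X + scale_mat \<i> Y) ** matrix_inv (X - scale_mat \<i> Y)"
  unfolding lagrangian_unitary_def
proof (rule the_equality)
  fix W :: "complex^'m^'m"
  assume "\<exists>X Y. lagrangian_frame X Y \<Lambda> \<and> W = (X + scale_mat \<i> Y) ** matrix_inv (X - scale_mat \<i> Y)"
  then obtain X' Y' :: "complex^'m^'m" where fr': "lagrangian_frame X' Y' \<Lambda>"
    and W: "W = (X' + scale_mat \<i> Y') ** matrix_inv (X' - scale_mat \<i> Y')" by blast
  have "range ((*v) (stack_mat X' Y')) = range ((*v) (stack_mat X Y))"
    using fr[unfolded lagrangian_frame_iff, THEN conjunct2, THEN conjunct2]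
      fr'[unfolded lagrangian_frame_iff, THEN conjunct2, THEN conjunct2] by (rule trans[OF sym, rotated])
  hence "stack_mat X' Y' *v axis j 1 \<in> range ((*v) (stack_mat X Y))" for j by (metis rangeI)
  hence "\<forall>j. \<exists>w. stack_mat X' Y' *v axis j 1 = stack_mat X Y *v w" by (simp add: image_iff)
  then obtain w where w: "\<And>j. stack_mat X' Y' *v axis j 1 = stack_mat X Y *v w j" by metis
  define K :: "complex^'m^'m" where "K = (\<chi> i j. w j $ i)"
  have "stack_mat X' Y' $ i $ j = (stack_mat X Y ** K) $ i $ j" for i j
  proof -
    have "stack_mat X' Y' $ i $ j = (stack_mat X Y *v w j) $ i" unfolding w[symmetric] matrix_vector_mult_axis ..
    thus ?thesis by (simp add: matrix_vector_mult_def matrix_matrix_mult_def K_def)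
  qed
  hence "stack_mat X' Y' = stack_mat X Y ** K" by (simp add: vec_eq_iff)
  hence XK: "X' = X ** K" "Y' = Y ** K" by (simp_all add: stack_mat_mult stack_mat_inject)
  have s: "X' + scale_mat \<i> Y' = (X + scale_mat \<i> Y) ** K" "X' - scale_mat \<i> Y' = (X - scale_mat \<i> Y) ** K"
    by (simp_all add: XK scale_mat_eq_mult matrix_mult_add_left matrix_diff_rdistrib matrix_mul_assoc)
  have i: "invertible (X - scale_mat \<i> Y)" "invertible (X' - scale_mat \<i> Y')"
    by (rule frame_invertible[OF fr], rule frame_invertible[OF fr'])
  hence "invertible K" unfolding s by (auto simp: invertible_det_nz det_mul)
  thus "W = (X + scale_mat \<i> Y) ** matrix_inv (X - scale_mat \<i> Y)"
    unfolding W s using i(1) by (simp add: matrix_inv_mult matrix_mul_assoc[symmetric] matrix_inv_cancel_mult)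
qed (use fr in blast)

text \<open>The frame with \<open>X - i Y = 1\<close> and \<open>X + i Y = W\<close>.\<close>

lemma unitary_has_frame:
  fixes W :: "complex^'m^'m"
  assumes W: "W \<in> unitary_group"
  shows "\<exists>\<Lambda>\<in>lagrangian_grassmannian. lagrangian_unitary \<Lambda> = W"
proof -
  define X where "X = (1/2) *\<^sub>R (mat 1 + W)"
  define Y where "Y = mat (- \<i> / 2) ** (W - mat 1)"
  have iY: "scale_mat \<i> Y = (1/2) *\<^sub>R (W - mat 1)"
  proof -
    have "scale_mat \<i> Y = mat (\<i> * (- \<i> / 2)) ** (W - mat 1)"
      by (simp only: scale_mat_eq_mult Y_def matrix_mul_assoc mat_mult_mat)
    also have "\<i> * (- \<i> / 2) = complex_of_real (1/2)" by simp
    finally show ?thesis by (simp only: mat_of_real_mult)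
  qed
  have p: "X + scale_mat \<i> Y = W" and m: "X - scale_mat \<i> Y = mat 1"
  proof -
    have "(mat 1 + W) + (W - mat 1) = 2 *\<^sub>R W" "(mat 1 + W) - (W - mat 1) = 2 *\<^sub>R mat 1" by (simp_all add: scaleR_2)
    thus "X + scale_mat \<i> Y = W" "X - scale_mat \<i> Y = mat 1"
      unfolding iY X_def scaleR_add_right[symmetric] scaleR_diff_right[symmetric] by simp_all
  qed
  have "v = 0" if "X *v v = 0" "Y *v v = 0" for v
  proof -
    have "(X - scale_mat \<i> Y) *v v = 0"
      using that by (simp add: scale_mat_eq_mult matrix_vector_mult_diff_rdistrib matrix_vector_mul_assoc[symmetric])
    thus ?thesis by (simp add: m)
  qed
  moreover have "adjoint_mat X ** Y = adjoint_mat Y ** X"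
  proof -
    define V where "V = adjoint_mat W"
    have VW: "V ** W = mat 1" unfolding V_def by (rule unitary_inverse(1)[OF W])
    have pr: "(mat 1 + V) ** (W - mat 1) = W - V" "(V - mat 1) ** (mat 1 + W) = - (W - V)"
      by (simp_all add: matrix_mult_add_left matrix_diff_rdistrib matrix_add_ldistrib matrix_diff_ldistrib VW)
    have n: "mat (- \<i> / 2) = (- mat (\<i> / 2) :: complex^'m^'m)" by (simp add: vec_eq_iff mat_def)
    have "adjoint_mat X ** Y = mat (- \<i> / 2) ** ((1/2) *\<^sub>R (W - V))"
      by (simp only: X_def Y_def adjoint_mat_scaleR adjoint_mat_add V_def[symmetric] adjoint_mat_mat complex_cnj_one
          matrix_mul_assoc mult_mat_commute[of "(1/2) *\<^sub>R _"]) (simp only: matrix_mul_assoc[symmetric] matrix_scaleR_left pr)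
    moreover have "adjoint_mat Y = mat (\<i> / 2) ** (V - mat 1)"
      unfolding Y_def adjoint_mat_mult adjoint_mat_diff V_def[symmetric] adjoint_mat_mat mult_mat_commute[of "V - _"] by simp
    hence "adjoint_mat Y ** X = mat (\<i> / 2) ** ((1/2) *\<^sub>R (- (W - V)))"
      by (simp only: X_def matrix_mul_assoc[symmetric] matrix_scaleR_right pr)
    ultimately show ?thesis by (simp only: n matrix_mult_uminus_left matrix_mult_uminus_right scaleR_minus_right)
  qed
  ultimately have fr: "lagrangian_frame X Y (range ((*v) (stack_mat X Y)))" by (simp add: lagrangian_frame_iff)
  hence "range ((*v) (stack_mat X Y)) \<in> lagrangian_grassmannian" unfolding lagrangian_grassmannian_def by blast
  moreover have "lagrangian_unitary (range ((*v) (stack_mat X Y))) = W"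
    unfolding lagrangian_unitary_frame[OF fr] p m using matrix_inv_eqI(1)[of "mat 1 :: complex^'m^'m" "mat 1"] by simp
  ultimately show ?thesis by blast
qed

text \<open>In a frame the cocycle acts by \<open>(X, Y) \<mapsto> ((E - f0) C^(-1) X - C* Y, C^(-1) X)\<close>. For the
  adjoint \<open>V\<close> of \<open>W\<close> the quotient \<open>(X' + i Y') (X' - i Y')^(-1)\<close> is the
  inverse of the Moebius image of \<open>V\<close>.\<close>

lemma schrodinger_action:
  fixes C :: "complex^'m^'m" and f0 :: "'t \<Rightarrow> complex^'m^'m"
  assumes C: "invertible C" and f: "hermitian (f0 \<theta>)" and W: "W \<in> unitary_group"
  shows "symplectic_action (schrodinger_cocycle C f0 E \<theta>) W =
    adjoint_mat (moebius_step C (f0 \<theta>) (complex_of_real E) (adjoint_mat W))"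
proof -
  define f where "f = f0 \<theta>"
  define z where "z = complex_of_real E"
  define V where "V = adjoint_mat W"
  define \<Lambda> where "\<Lambda> = inv_into lagrangian_grassmannian lagrangian_unitary W"
  have WI: "W \<in> lagrangian_unitary ` lagrangian_grassmannian" using unitary_has_frame[OF W] by force
  have L: "\<Lambda> \<in> lagrangian_grassmannian" "lagrangian_unitary \<Lambda> = W"
    unfolding \<Lambda>_def using inv_into_into[OF WI] f_inv_into_f[OF WI] by auto
  obtain X Y :: "complex^'m^'m" where fr: "lagrangian_frame X Y \<Lambda>" using L(1) by (auto simp: lagrangian_grassmannian_def)
  note fr' = fr[unfolded lagrangian_frame_iff]
  define G where "G = X - scale_mat \<i> Y"
  have G: "invertible G" unfolding G_def by (rule frame_invertible[OF fr])
  have "W = (X + scale_mat \<i> Y) ** matrix_inv G" using lagrangian_unitary_frame[OF fr] L(2) by (simp add: G_def)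
  hence WG: "X + scale_mat \<i> Y = W ** G" by (simp add: matrix_mul_assoc[symmetric] matrix_inv_left_right[OF G])
  have VW: "V ** W = mat 1" unfolding V_def by (rule unitary_inverse(1)[OF W])
  have X: "X = half_plus V ** (W ** G)"
  proof -
    have "X = (1/2) *\<^sub>R ((X + scale_mat \<i> Y) + (X - scale_mat \<i> Y))"
      by (simp add: vec_eq_iff scaleR_conv_of_real[where 'a=complex])
    also have "\<dots> = (1/2) *\<^sub>R (W ** G + V ** (W ** G))" by (simp add: WG G_def[symmetric] matrix_mul_assoc VW)
    finally show ?thesis by (simp add: half_plus_def matrix_scaleR_left matrix_mult_add_left)
  qed
  have Y: "Y = - (mat \<i> ** (half_minus V ** (W ** G)))"
  proof -
    have "Y = - (mat \<i> ** ((1/2) *\<^sub>R ((X + scale_mat \<i> Y) - (X - scale_mat \<i> Y))))"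
      by (simp add: vec_eq_iff mat_mult_component scaleR_conv_of_real[where 'a=complex])
    also have "\<dots> = - (mat \<i> ** ((1/2) *\<^sub>R (W ** G - V ** (W ** G))))" by (simp add: WG G_def[symmetric] matrix_mul_assoc VW)
    finally show ?thesis by (simp add: half_minus_def matrix_scaleR_left matrix_diff_rdistrib)
  qed
  define e where "e = mat z - f"
  have eh: "adjoint_mat e = e" using f by (simp add: e_def f_def z_def adjoint_mat_diff hermitian_def)
  define X' where "X' = e ** (matrix_inv C ** X) - adjoint_mat C ** Y"
  define Y' where "Y' = matrix_inv C ** X"
  have AS: "schrodinger_cocycle C f0 E \<theta> ** stack_mat X Y = stack_mat X' Y'"
    unfolding schrodinger_cocycle_def block_mat_stack_mat X'_def Y'_def
    by (simp add: e_def z_def f_def matrix_mul_assoc matrix_mult_uminus_left)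
  have "(*v) (schrodinger_cocycle C f0 E \<theta>) ` \<Lambda> = range ((*v) (stack_mat X' Y'))"
    unfolding AS[symmetric] using fr' by (auto simp: matrix_vector_mul_assoc image_iff)
  moreover have "v = 0" if "X' *v v = 0" "Y' *v v = 0" for v
  proof -
    have y: "matrix_inv C *v (X *v v) = 0" using that by (simp add: Y'_def matrix_vector_mul_assoc)
    hence "X *v v = 0" using matrix_inv_cancel(1)[OF C, of "X *v v"] by simp
    moreover have "adjoint_mat C *v (Y *v v) = 0"
      using that(1) y by (simp add: X'_def matrix_vector_mult_diff_rdistrib matrix_vector_mul_assoc[symmetric])
    hence "Y *v v = 0" using matrix_inv_cancel(2)[OF invertible_adjoint_mat[OF C], of "Y *v v"] by simp
    ultimately show "v = 0" using fr' by blast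
  qed
  moreover have "adjoint_mat X' ** Y' = adjoint_mat Y' ** X'"
  proof -
    have c: "C ** (matrix_inv C ** X) = X" using C by (rule matrix_inv_cancel_mult)
    have c': "adjoint_mat X ** (adjoint_mat (matrix_inv C) ** (adjoint_mat C ** Y)) = adjoint_mat X ** Y"
    proof -
      have "adjoint_mat (matrix_inv C) ** (adjoint_mat C ** Y) = Y"
        by (simp only: matrix_mul_assoc adjoint_mat_mult[symmetric] matrix_inv_left_right[OF C] adjoint_mat_mat
            complex_cnj_one matrix_mul_lid)
      thus ?thesis by simp
    qed
    show ?thesis
      unfolding X'_def Y'_def
      using fr' by (simp add: adjoint_mat_diff adjoint_mat_mult eh matrix_diff_rdistrib matrix_diff_ldistrib
          matrix_mul_assoc[symmetric] c c')
  qed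
  ultimately have fr2: "lagrangian_frame X' Y' ((*v) (schrodinger_cocycle C f0 E \<theta>) ` \<Lambda>)"
    by (simp add: lagrangian_frame_iff)
  define N where "N = numer C f z V"
  define M where "M = moebius_step C f z V"
  have z0: "Im z = 0" by (simp add: z_def)
  have Vu: "V \<in> unitary_group" unfolding V_def by (rule adjoint_unitary[OF W])
  have fh: "hermitian f" using f by (simp add: f_def)
  have Ni: "invertible N" unfolding N_def by (rule numer_invertible[OF C fh _ unitary_contraction[OF Vu]]) (simp add: z0)
  have Mu: "M \<in> unitary_group" unfolding M_def by (rule moebius_unitary[OF C fh z0 Vu])
  have Nx: "X' + scale_mat \<i> Y' = N ** (W ** G)"
  proof -
    have "N ** (W ** G) = (e + mat \<i>) ** (matrix_inv C ** X) + mat \<i> ** (adjoint_mat C ** (half_minus V ** (W ** G)))"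
      unfolding N_def numer_def mat_z_plus_i e_def[symmetric] X
      by (simp add: matrix_mult_add_left matrix_mul_assoc)
    also have "mat \<i> ** (adjoint_mat C ** (half_minus V ** (W ** G))) = - (adjoint_mat C ** Y)"
      unfolding Y by (simp add: matrix_mult_uminus_right matrix_mul_assoc mult_mat_commute[of "adjoint_mat C"])
    finally show ?thesis by (simp add: X'_def Y'_def scale_mat_eq_mult matrix_mult_add_left)
  qed
  have Dx: "X' - scale_mat \<i> Y' = M ** N ** (W ** G)"
  proof -
    have "M ** N = N - mat (2 * \<i>) ** (matrix_inv C ** half_plus V)"
      unfolding M_def moebius_step_def N_def[symmetric]
      by (simp add: matrix_diff_rdistrib matrix_mul_assoc[symmetric] matrix_inv_left_right[OF Ni])
    hence "M ** N ** (W ** G) = N ** (W ** G) - mat (2 * \<i>) ** Y'"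
      by (simp add: Y'_def X matrix_diff_rdistrib matrix_mul_assoc)
    also have "\<dots> = X' + scale_mat \<i> Y' - mat (2 * \<i>) ** Y'" by (simp add: Nx)
    finally show ?thesis by (simp add: vec_eq_iff mat_mult_component)
  qed
  have i: "invertible (W ** G)" using unitary_inverse(4)[OF W] G by (rule invertible_mult)
  have iM: "invertible M" by (rule unitary_inverse(4)[OF Mu])
  have "symplectic_action (schrodinger_cocycle C f0 E \<theta>) W = N ** (W ** G) ** matrix_inv (M ** N ** (W ** G))"
    unfolding symplectic_action_def \<Lambda>_def[symmetric] lagrangian_unitary_frame[OF fr2] Nx Dx ..
  also have "matrix_inv (M ** N ** (W ** G)) = matrix_inv (W ** G) ** (matrix_inv N ** matrix_inv M)"
    using i iM Ni by (simp add: matrix_inv_mult invertible_mult)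
  also have "N ** (W ** G) ** (matrix_inv (W ** G) ** (matrix_inv N ** matrix_inv M)) = matrix_inv M"
    by (simp only: matrix_mul_assoc[symmetric, of N "W ** G"] matrix_inv_cancel_mult[OF i] matrix_inv_cancel_mult[OF Ni])
  finally show ?thesis using unitary_inverse(3)[OF Mu] by (simp add: M_def f_def z_def V_def)
qed

section \<open>Lifts of the cocycle\<close>

lemma scale_mat_unitary:
  assumes "cmod c = 1" "U \<in> unitary_group" shows "mat c ** U \<in> unitary_group"
  using assms unfolding unitary_iff_isometry
  by (simp add: matrix_vector_mul_assoc[symmetric] mat_vector_mult norm_scalar_mult)

text \<open>The determinant is a nonzero polynomial in a parameter \<open>\<tau>\<close> of the circle and has finitely
  many zeros; \<open>c\<close> is the Cayley image of \<open>\<tau>\<close>.\<close>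

lemma unitary_avoid_eigenvalue:
  fixes W :: "complex^'m^'m"
  assumes W: "W \<in> unitary_group"
  shows "\<exists>c. cmod c = 1 \<and> c \<noteq> -1 \<and> invertible (mat 1 + mat c ** W)"
proof -
  define A where "A = mat 1 + W"
  define B where "B = A + mat (- \<i>) ** (mat 1 - W)"
  obtain p where p: "\<And>z. poly p z = det (mat (1 - z) ** A + mat z ** B)" using det_segment_poly[of A B] by blast
  have e: "mat (1 - z) ** A + mat z ** B = A + mat (- \<i> * z) ** (mat 1 - W)" for z
    by (simp add: B_def vec_eq_iff mat_mult_component algebra_simps)
  have "mat (1 - (- \<i>)) ** A + mat (- \<i>) ** B = mat 2 ** W"
    unfolding e by (simp add: A_def vec_eq_iff mat_mult_component)
  hence "poly p (- \<i>) = det (mat 2 ** W)" using p by simp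
  hence "poly p (- \<i>) \<noteq> 0" using unitary_inverse(4)[OF W] by (simp add: det_mul det_mat invertible_det_nz)
  hence "p \<noteq> 0" by auto
  hence "finite {z. poly p z = 0}" by (rule poly_roots_finite)
  hence "finite (complex_of_real -` {z. poly p z = 0})" by (rule finite_vimageI) (auto intro: injI)
  then obtain \<tau> where "poly p (complex_of_real \<tau>) \<noteq> 0"
    using infinite_UNIV_char_0[where 'a=real] by (metis (mono_tags) UNIV_eq_I mem_Collect_eq vimage_eq)
  hence inv: "invertible (A + mat (- \<i> * of_real \<tau>) ** (mat 1 - W))" unfolding invertible_det_nz p e .
  define u where "u = 1 - \<i> * of_real \<tau>"
  define c where "c = cnj u / u"
  have u0: "u \<noteq> 0" by (simp add: u_def complex_eq_iff)
  have "cmod c = 1" using u0 by (simp add: c_def norm_divide)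
  moreover have "c \<noteq> -1"
  proof
    assume "c = -1"
    hence "cnj u = - u" using u0 by (simp add: c_def field_simps)
    hence "Re (cnj u) = Re (- u)" by simp
    thus False by (simp add: u_def)
  qed
  moreover have "A + mat (- \<i> * of_real \<tau>) ** (mat 1 - W) = mat u ** (mat 1 + mat c ** W)"
  proof -
    have "u * c = cnj u" using u0 by (simp add: c_def)
    hence "mat u ** (mat 1 + mat c ** W) = mat u + mat (cnj u) ** W"
      by (simp add: matrix_add_ldistrib matrix_mul_assoc mat_mult_mat)
    also have "\<dots> = A + mat (- \<i> * of_real \<tau>) ** (mat 1 - W)"
    proof -
      have "mat u = mat 1 + (mat (- \<i> * of_real \<tau>) :: complex^'m^'m)" by (simp add: u_def vec_eq_iff mat_def)
      thus ?thesis by (simp add: A_def u_def matrix_diff_ldistrib vec_eq_iff mat_mult_component algebra_simps)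
    qed
    finally show ?thesis by simp
  qed
  with inv have "invertible (mat 1 + mat c ** W)" by (simp add: invertible_det_nz det_mul)
  ultimately show ?thesis by blast
qed

text \<open>Choose \<open>c\<close> with \<open>1 + U\<close> invertible for \<open>U = c W\<close>. The segment
  \<open>A t\<close> from \<open>1 + c\<close> to \<open>1 + U\<close> consists of normal matrices, which are
  invertible since their forms have positive real part on nonzero vectors, so the product of
  \<open>A t\<close> with the inverse of its adjoint is unitary. It runs from \<open>c\<close> to
  \<open>U\<close>, because \<open>1 + U\<close> is \<open>U\<close> times its adjoint for unitary
  \<open>U\<close>; multiplication by the conjugate of \<open>c\<close> gives a path from \<open>1\<close> to
  \<open>W\<close>.\<close>

lemma unitary_path:
  fixes W :: "complex^'m^'m"
  assumes W: "W \<in> unitary_group"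
  shows "\<exists>\<gamma>::real \<Rightarrow> complex^'m^'m. continuous_on {0..1} \<gamma> \<and> \<gamma> 0 = mat 1 \<and> \<gamma> 1 = W \<and> (\<forall>t\<in>{0..1}. \<gamma> t \<in> unitary_group)"
proof -
  obtain c where c: "cmod c = 1" "c \<noteq> -1" and inv: "invertible (mat 1 + mat c ** W)"
    using unitary_avoid_eigenvalue[OF W] by blast
  define U where "U = mat c ** W"
  have U: "U \<in> unitary_group" unfolding U_def by (rule scale_mat_unitary[OF c(1) W])
  define \<alpha> where "\<alpha> = 1 + c"
  have cc: "c * cnj c = 1" using complex_norm_square[of c] c(1) by simp
  have "\<bar>Re c\<bar> \<le> 1" using abs_Re_le_cmod[of c] c(1) by simp
  moreover have "Re c \<noteq> -1"
  proof
    assume r: "Re c = -1"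
    have "(cmod c)\<^sup>2 = (Re c)\<^sup>2 + (Im c)\<^sup>2" by (rule cmod_power2)
    hence "Im c = 0" using c(1) r by simp
    with r c(2) show False by (simp add: complex_eq_iff)
  qed
  ultimately have ra: "0 < Re \<alpha>" by (simp add: \<alpha>_def abs_le_iff)
  define A where "A t = (1 - t) *\<^sub>R mat \<alpha> + t *\<^sub>R (mat 1 + U)" for t :: real
  have inner_A: "inner v (A t *v v) = (1 - t) * (Re \<alpha> * (norm v)\<^sup>2) + t * ((norm ((mat 1 + U) *v v))\<^sup>2 / 2)" for t v
  proof -
    have "inner (U *v v) (U *v v) = inner v v" using U by (simp add: unitary_iff_isometry norm_eq)
    hence "inner v ((mat 1 + U) *v v) = (norm ((mat 1 + U) *v v))\<^sup>2 / 2"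
      by (simp add: power2_norm_eq_inner matrix_vector_mult_add_rdistrib inner_add_left inner_add_right inner_commute)
    moreover have "inner v (\<alpha> *s v) = Re \<alpha> * (norm v)\<^sup>2"
      unfolding power2_norm_eq_inner
      by (simp add: inner_vec_def inner_complex_def sum_distrib_left algebra_simps)
    ultimately show ?thesis
      by (simp add: A_def matrix_vector_mult_add_rdistrib matrix_vector_scaleR_left mat_vector_mult inner_add_right)
  qed
  have Ainv: "invertible (A t)" if t: "t \<in> {0..1}" for t
  proof (rule invertible_injI)
    fix v assume "A t *v v = 0"
    hence z: "(1 - t) * (Re \<alpha> * (norm v)\<^sup>2) + t * ((norm ((mat 1 + U) *v v))\<^sup>2 / 2) = 0" using inner_A[of v t] by simp
    have nn: "0 \<le> (1 - t) * (Re \<alpha> * (norm v)\<^sup>2)" "0 \<le> t * ((norm ((mat 1 + U) *v v))\<^sup>2 / 2)"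
      using t ra by simp_all
    have z1: "(1 - t) * (Re \<alpha> * (norm v)\<^sup>2) = 0" and z2: "t * ((norm ((mat 1 + U) *v v))\<^sup>2 / 2) = 0"
      using z nn by linarith+
    show "v = 0"
    proof (cases "t = 1")
      case True
      hence "(mat 1 + U) *v v = 0" using z2 by simp
      thus ?thesis using matrix_inv_cancel(2)[OF inv[folded U_def], of v] by simp
    next
      case False
      thus ?thesis using z1 ra by simp
    qed
  qed
  have UU: "adjoint_mat U ** U = mat 1" "U ** adjoint_mat U = mat 1" using unitary_inverse[OF U] by auto
  have Aab: "A t = mat (of_real (1 - t) * \<alpha> + of_real t) + t *\<^sub>R U" for t
    by (simp add: A_def vec_eq_iff mat_def scaleR_conv_of_real[where 'a=complex] algebra_simps)
  have normal: "adjoint_mat (A t) ** A t = A t ** adjoint_mat (A t)" for t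
    unfolding Aab by (simp add: adjoint_mat_add adjoint_mat_scaleR matrix_add_ldistrib matrix_mult_add_left
        matrix_scaleR_left matrix_scaleR_right UU mult_mat_commute[of U] mult_mat_commute[of "adjoint_mat U"] mat_mult_mat
        algebra_simps)
  define \<gamma> where "\<gamma> t = mat (cnj c) ** (A t ** matrix_inv (adjoint_mat (A t)))" for t
  have "continuous_on {0..1} \<gamma>"
    unfolding \<gamma>_def using Ainv
    by (intro continuous_intros invertible_adjoint_mat) (auto simp: A_def intro!: continuous_intros)
  moreover have "\<gamma> 0 = mat 1"
  proof -
    have "\<alpha> \<noteq> 0" using ra by auto
    hence "matrix_inv (mat (cnj \<alpha>)) = (mat (inverse (cnj \<alpha>)) :: complex^'m^'m)"
      by (intro matrix_inv_eqI) (simp add: mat_mult_mat)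
    moreover have "cnj c * \<alpha> = cnj \<alpha>" using cc by (simp add: \<alpha>_def algebra_simps)
    moreover from this have "cnj c * (\<alpha> * inverse (cnj \<alpha>)) = 1"
      using \<open>\<alpha> \<noteq> 0\<close> by (simp only: mult.assoc[symmetric]) simp
    ultimately show ?thesis by (simp add: \<gamma>_def A_def mat_mult_mat)
  qed
  moreover have "\<gamma> 1 = W"
  proof -
    have "A 1 = U ** adjoint_mat (A 1)" by (simp add: A_def adjoint_mat_add matrix_add_ldistrib UU add.commute)
    hence "A 1 ** matrix_inv (adjoint_mat (A 1)) = U ** (adjoint_mat (A 1) ** matrix_inv (adjoint_mat (A 1)))"
      by (metis matrix_mul_assoc)
    also have "\<dots> = U" using matrix_inv_left_right[OF invertible_adjoint_mat[OF Ainv[of 1]]] by simp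
    finally show ?thesis using cc by (simp add: \<gamma>_def U_def matrix_mul_assoc mat_mult_mat mult.commute)
  qed
  moreover have "\<gamma> t \<in> unitary_group" if t: "t \<in> {0..1}" for t
    unfolding \<gamma>_def
  proof (rule scale_mat_unitary)
    have "norm ((A t ** matrix_inv (adjoint_mat (A t))) *v x) = norm x" for x
    proof -
      define y where "y = matrix_inv (adjoint_mat (A t)) *v x"
      have x: "adjoint_mat (A t) *v y = x" unfolding y_def by (intro matrix_inv_cancel invertible_adjoint_mat Ainv t)
      have "inner (A t *v y) (A t *v y) = inner y ((adjoint_mat (A t) ** A t) *v y)"
        by (simp add: inner_adjoint_mat matrix_vector_mul_assoc)
      also have "\<dots> = inner (adjoint_mat (A t) *v y) (adjoint_mat (A t) *v y)"
        unfolding normal by (simp add: inner_adjoint_mat matrix_vector_mul_assoc)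
      finally have "norm (A t *v y) = norm (adjoint_mat (A t) *v y)" by (simp add: norm_eq)
      moreover have "(A t ** matrix_inv (adjoint_mat (A t))) *v x = A t *v y" by (simp only: y_def matrix_vector_mul_assoc)
      ultimately show ?thesis by (simp only: x)
    qed
    thus "A t ** matrix_inv (adjoint_mat (A t)) \<in> unitary_group" by (simp only: unitary_iff_isometry simp_thms)
    show "cmod (cnj c) = 1" by (simp only: complex_mod_cnj c(1))
  qed
  ultimately show ?thesis by blast
qed

lemma cmod_det_unitary: "U \<in> unitary_group \<Longrightarrow> cmod (det U) = 1"
proof -
  assume "U \<in> unitary_group"
  hence "det (adjoint_mat U) * det U = 1" by (metis det_I det_mul unitary_inverse(1))
  hence "cmod (cnj (det U) * det U) = 1" by (simp add: det_adjoint_mat)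
  hence "(cmod (det U))\<^sup>2 = 1" by (simp add: norm_mult power2_eq_square)
  thus ?thesis using power2_eq_iff_nonneg[of "cmod (det U)" 1] by simp
qed

text \<open>A continuous argument of the determinant along the path, divided by the dimension.\<close>

lemma unitary_path_lift:
  fixes \<gamma> :: "real \<Rightarrow> complex^'m^'m"
  assumes c: "continuous_on {0..1} \<gamma>" and U: "\<And>t. t \<in> {0..1} \<Longrightarrow> \<gamma> t \<in> unitary_group"
  shows "\<exists>x S. continuous_on {0..1} x \<and> continuous_on {0..1} S \<and>
    (\<forall>t\<in>{0..1}. S t \<in> special_unitary_group \<and> scale_mat (exp (2 * pi * \<i> * complex_of_real (x t))) (S t) = \<gamma> t)"
proof -
  have nz: "det (\<gamma> t) \<noteq> 0" if "t \<in> {0..1}" for t using cmod_det_unitary[OF U[OF that]] by auto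
  have "contractible {0..1::real}" by (simp add: convex_imp_contractible)
  then obtain l where l: "continuous_on {0..1} l" "\<And>t. t \<in> {0..1} \<Longrightarrow> det (\<gamma> t) = exp (l t)"
    using continuous_logarithm_on_contractible[OF continuous_on_det[OF c] _ nz] by metis
  have Re0: "Re (l t) = 0" if "t \<in> {0..1}" for t
  proof -
    have "exp (Re (l t)) = 1" using cmod_det_unitary[OF U[OF that]] l(2)[OF that] by simp
    thus ?thesis by simp
  qed
  define x where "x t = Im (l t) / (2 * pi * CARD('m))" for t
  define S where "S t = mat (exp (- (2 * pi * \<i> * complex_of_real (x t)))) ** \<gamma> t" for t
  have "continuous_on {0..1} x" unfolding x_def using l(1) by (intro continuous_intros) auto
  moreover from this have "continuous_on {0..1} S" unfolding S_def using c by (intro continuous_intros)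
  moreover have "S t \<in> special_unitary_group" if t: "t \<in> {0..1}" for t
  proof -
    have "cmod (exp (- (2 * pi * \<i> * complex_of_real (x t)))) = 1" by simp
    hence "S t \<in> unitary_group" unfolding S_def using U[OF t] by (rule scale_mat_unitary)
    moreover have "det (S t) = 1"
    proof -
      have "of_nat CARD('m) * (- (2 * pi * \<i> * complex_of_real (x t))) = - l t"
        using Re0[OF t] by (simp add: x_def complex_eq_iff)
      hence "exp (- (2 * pi * \<i> * complex_of_real (x t))) ^ CARD('m) = exp (- l t)"
        by (simp only: exp_of_nat_mult[symmetric])
      thus ?thesis by (simp add: S_def det_mul det_mat l(2)[OF t] exp_minus)
    qed
    ultimately show ?thesis by (simp add: special_unitary_group_def)
  qed
  moreover have "scale_mat (exp (2 * pi * \<i> * complex_of_real (x t))) (S t) = \<gamma> t" for t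
    unfolding scale_mat_eq_mult S_def matrix_mul_assoc mat_mult_mat by (simp add: exp_minus)
  ultimately show ?thesis by blast
qed

lemma two_pi_i_cancel:
  "complex_of_real (2 * pi) * \<i> * complex_of_real a = complex_of_real (2 * pi) * \<i> * complex_of_real b \<Longrightarrow> a = b"
  by simp

lemma exp_2pi_i_diff_int:
  assumes "exp (2 * pi * \<i> * complex_of_real a) = exp (2 * pi * \<i> * complex_of_real b)"
  shows "\<exists>n::int. a = b + of_int n"
proof -
  define u v where "u = complex_of_real (2 * pi) * \<i> * complex_of_real a" and "v = complex_of_real (2 * pi) * \<i> * complex_of_real b"
  have "exp u = exp v" using assms by (simp only: u_def v_def)
  then obtain n :: int where "u = v + of_real (of_int (2 * n) * pi) * \<i>" unfolding exp_eq by blast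
  hence n: "complex_of_real (2 * pi) * \<i> * complex_of_real a = complex_of_real (2 * pi) * \<i> * complex_of_real b + of_real (of_int (2 * n) * pi) * \<i>"
    by (simp only: u_def v_def)
  have "(2 * pi) * a = Im (2 * pi * \<i> * complex_of_real a)" by simp
  also have "\<dots> = (2 * pi) * (b + of_int n)" unfolding n by (simp add: distrib_left)
  finally show ?thesis by (intro exI[of _ n]) simp
qed

lemma continuous_int_valued:
  fixes p :: "'t::topological_space \<Rightarrow> int"
  assumes "continuous_on UNIV (\<lambda>x. real_of_int (p x))" shows "continuous_on UNIV p"
  unfolding continuous_on_open_vimage[OF open_UNIV]
proof (intro allI impI)
  fix B :: "int set" assume "open B"
  have 1: "open (p -` {n})" for n
  proof -
    have "p x = n" if "real_of_int n - 1/2 < real_of_int (p x)" "real_of_int (p x) < real_of_int n + 1/2" for x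
    proof -
      have "real_of_int (p x) < real_of_int (n + 1)" "real_of_int n < real_of_int (p x + 1)" using that by simp_all
      thus ?thesis by (simp only: of_int_less_iff)
    qed
    hence "p -` {n} = (\<lambda>x. real_of_int (p x)) -` {real_of_int n - 1/2 <..< real_of_int n + 1/2}" by auto
    thus ?thesis using assms open_vimage[of "{real_of_int n - 1/2 <..< real_of_int n + 1/2}" "\<lambda>x. real_of_int (p x)"] by simp
  qed
  have "p -` B = (\<Union>n\<in>B. p -` {n})" by auto
  thus "open (p -` B \<inter> UNIV)" using 1 by (simp add: open_UN)
qed

context stationary_family begin

abbreviation potential :: "'t \<Rightarrow> nat \<Rightarrow> complex^'m^'m" where
  "potential \<theta> j \<equiv> f0 ((T ^^ j) \<theta>)"

text \<open>The determinant of \<open>e^(2 pi i x) S\<close> with \<open>det S = 1\<close> is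
  \<open>e^(2 pi i m x)\<close>. Comparing determinants before and after one step gives the displacement up to
  an integer.\<close>

lemma lift_exp:
  fixes x E :: real
  assumes lift: "cocycle_lift T (schrodinger_cocycle C f0 E) F" and S: "S \<in> special_unitary_group"
  defines "W \<equiv> scale_mat (exp (2 * pi * \<i> * complex_of_real x)) S"
  shows "W \<in> unitary_group"
    and "exp (2 * pi * \<i> * complex_of_real (real CARD('m) * (fst (snd (F (\<theta>, x, S))) - x))) =
      exp (2 * pi * \<i> * complex_of_real (Im (lift_log C (f0 \<theta>) (complex_of_real E, adjoint_mat W)) / pi))"
proof -
  define e where "e y = exp (2 * pi * \<i> * complex_of_real y)" for y
  have eU: "cmod (e y) = 1" for y by (simp add: e_def)
  have WU: "W \<in> unitary_group"
    using S scale_mat_unitary[OF eU, of S x] unfolding W_def scale_mat_eq_mult e_def special_unitary_group_def by simp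
  thus "W \<in> unitary_group" .
  obtain \<theta>' x' S' where F: "F (\<theta>, x, S) = (\<theta>', x', S')" by (metis prod_cases3)
  have D: "(\<theta>, x, S) \<in> UNIV \<times> UNIV \<times> special_unitary_group" using S by simp
  note L = lift[unfolded cocycle_lift_def Let_def]
  have "F (\<theta>, x, S) \<in> UNIV \<times> UNIV \<times> special_unitary_group"
    using L[THEN conjunct2, THEN conjunct1] imageI[OF D] by (rule subsetD)
  hence S': "S' \<in> special_unitary_group" by (simp add: F)
  have q: "covering_q (\<theta>', x', S') = cocycle_map T (schrodinger_cocycle C f0 E) (covering_q (\<theta>, x, S))"
    using L[THEN conjunct2, THEN conjunct2, rule_format, OF D] by (simp only: F)
  define V where "V = symplectic_action (schrodinger_cocycle C f0 E \<theta>) W"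
  have "scale_mat (e x') S' = V"
    using q by (simp add: covering_q_def cocycle_map_def V_def W_def e_def)
  hence "det V = e x' ^ CARD('m)" using S' by (auto simp: scale_mat_eq_mult det_mul det_mat special_unitary_group_def)
  moreover have "det W = e x ^ CARD('m)" using S by (auto simp: W_def scale_mat_eq_mult det_mul det_mat special_unitary_group_def e_def)
  moreover have "e x' ^ CARD('m) = e x ^ CARD('m) * e (real CARD('m) * (x' - x))"
    by (simp add: e_def exp_of_nat_mult[symmetric] exp_add[symmetric] algebra_simps)
  moreover have "det V = det W * exp (2 * \<i> * Im (lift_log C (f0 \<theta>) (complex_of_real E, adjoint_mat W)))"
    unfolding V_def schrodinger_action[where ?f0.0 = f0 and \<theta> = \<theta>, OF invertible_C hermitian_f0 WU]
    by (rule det_moebius_unitary[OF invertible_C hermitian_f0 WU])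
  ultimately have "e (real CARD('m) * (x' - x)) = exp (2 * \<i> * Im (lift_log C (f0 \<theta>) (complex_of_real E, adjoint_mat W)))"
    by (simp add: e_def)
  also have "2 * \<i> * Im (lift_log C (f0 \<theta>) (complex_of_real E, adjoint_mat W)) =
     2 * pi * \<i> * complex_of_real (Im (lift_log C (f0 \<theta>) (complex_of_real E, adjoint_mat W)) / pi)" by simp
  finally show "exp (2 * pi * \<i> * complex_of_real (real CARD('m) * (fst (snd (F (\<theta>, x, S))) - x))) =
      exp (2 * pi * \<i> * complex_of_real (Im (lift_log C (f0 \<theta>) (complex_of_real E, adjoint_mat W)) / pi))"
    by (simp add: e_def F)
qed

text \<open>By \<open>lift_exp\<close> the difference of \<open>f\<close> and \<open>Im lift_log / pi\<close> is an
  integer. It is constant along paths in \<open>U(m)\<close>, so it is its value at \<open>W = 1\<close>,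
  which is continuous in \<open>\<theta>\<close>.\<close>

lemma lift_decomposition:
  assumes lift: "cocycle_lift T (schrodinger_cocycle C f0 E) F"
    and f: "\<And>\<theta> x S. S \<in> special_unitary_group \<Longrightarrow>
           f (covering_q (\<theta>, x, S)) = real CARD('m) * (fst (snd (F (\<theta>, x, S))) - x)"
  shows "\<exists>p :: 't \<Rightarrow> int. continuous_on UNIV p \<and> (\<forall>\<theta>. \<forall>W\<in>unitary_group.
     f (\<theta>, W) = of_int (p \<theta>) + Im (lift_log C (f0 \<theta>) (complex_of_real E, adjoint_mat W)) / pi)"
proof -
  define h where "h \<theta> W = Im (lift_log C (f0 \<theta>) (complex_of_real E, adjoint_mat W)) / pi" for \<theta> W
  define I where "I = (mat 1 :: complex^'m^'m)"
  have IS: "I \<in> special_unitary_group" by (simp add: I_def special_unitary_group_def unitary_group_def)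
  have qI: "covering_q (\<theta>, 0, I) = (\<theta>, I)" for \<theta> :: 't by (simp add: covering_q_def scale_mat_eq_mult)
  have qe: "covering_q (\<theta>, x, S) = (\<theta>, scale_mat (exp (2 * pi * \<i> * complex_of_real x)) S)" for \<theta> :: 't and x and S :: "complex^'m^'m"
    by (simp add: covering_q_def)
  have contF: "continuous_on (UNIV \<times> UNIV \<times> special_unitary_group) F"
    by (rule lift[unfolded cocycle_lift_def Let_def, THEN conjunct1])
  have hI: "h \<theta> I = Im (logdet (mat (complex_of_real E + \<i>) - f0 \<theta>)) / pi" for \<theta>
    unfolding h_def I_def using lift_log_1[OF invertible_C hermitian_f0] by simp
  define d where "d \<theta> = f (\<theta>, I) - h \<theta> I" for \<theta>
  have d: "\<exists>n::int. d \<theta> = of_int n" for \<theta>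
  proof -
    have "exp (2 * pi * \<i> * complex_of_real (f (\<theta>, I))) = exp (2 * pi * \<i> * complex_of_real (h \<theta> I))"
      using lift_exp(2)[OF lift IS, of \<theta> 0] f[OF IS, of \<theta> 0] unfolding qI h_def by (simp add: scale_mat_eq_mult)
    from exp_2pi_i_diff_int[OF this] show ?thesis by (auto simp: d_def)
  qed
  define p where "p \<theta> = \<lfloor>d \<theta>\<rfloor>" for \<theta>
  have p: "real_of_int (p \<theta>) = d \<theta>" for \<theta> using d[of \<theta>] by (auto simp: p_def)
  have "continuous_on UNIV (\<lambda>\<theta>. f (\<theta>, I))"
  proof -
    have "continuous_on UNIV (\<lambda>\<theta>. F (\<theta>, 0, I))"
      by (rule continuous_on_compose2[OF contF]) (use IS in \<open>auto intro!: continuous_intros\<close>)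
    hence "continuous_on UNIV (\<lambda>\<theta>. real CARD('m) * (fst (snd (F (\<theta>, 0, I))) - 0))" by (intro continuous_intros)
    thus ?thesis using f[OF IS, of _ 0] by (simp only: qI)
  qed
  moreover have "continuous_on UNIV (\<lambda>\<theta>. h \<theta> I)"
    unfolding hI by (intro continuous_intros continuous_f0 shifted_site_Upper hermitian_f0) auto
  ultimately have "continuous_on UNIV d" unfolding d_def by (intro continuous_intros)
  hence pc: "continuous_on UNIV p" by (intro continuous_int_valued) (simp add: p)
  have "f (\<theta>, W) = of_int (p \<theta>) + h \<theta> W" if W: "W \<in> unitary_group" for \<theta> W
  proof -
    obtain \<gamma> :: "real \<Rightarrow> complex^'m^'m" where \<gamma>: "continuous_on {0..1} \<gamma>" "\<gamma> 0 = mat 1" "\<gamma> 1 = W"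
      "\<And>t. t \<in> {0..1} \<Longrightarrow> \<gamma> t \<in> unitary_group" using unitary_path[OF W] by blast
    obtain x S where xS: "continuous_on {0..1} x" "continuous_on {0..1} S"
      "\<And>t. t \<in> {0..1} \<Longrightarrow> S t \<in> special_unitary_group"
      "\<And>t. t \<in> {0..1} \<Longrightarrow> scale_mat (exp (2 * pi * \<i> * complex_of_real (x t))) (S t) = \<gamma> t"
      using unitary_path_lift[OF \<gamma>(1,4)] by blast
    define g where "g t = real CARD('m) * (fst (snd (F (\<theta>, x t, S t))) - x t)" for t
    have fg: "f (\<theta>, \<gamma> t) = g t" if t: "t \<in> {0..1}" for t
      using f[OF xS(3)[OF t], of \<theta> "x t"] unfolding qe xS(4)[OF t] by (simp add: g_def)
    have "continuous_on {0..1} (\<lambda>t. F (\<theta>, x t, S t))"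
      by (rule continuous_on_compose2[OF contF]) (use xS in \<open>auto intro!: continuous_intros\<close>)
    hence gc: "continuous_on {0..1} g" unfolding g_def using xS(1) by (intro continuous_intros)
    have hc: "continuous_on {0..1} (\<lambda>t. h \<theta> (\<gamma> t))"
      unfolding h_def using \<gamma>
      by (intro continuous_intros continuous_on_lift_log_compose invertible_C hermitian_f0)
         (auto intro!: continuous_intros unitary_contraction adjoint_unitary)
    have "2 * pi * \<i> * complex_of_real (g 1) = 2 * pi * \<i> * complex_of_real (of_int (p \<theta>) + h \<theta> (\<gamma> 1))"
    proof (rule continuous_log_unique[where S = "{0..1::real}" and a = 0 and x = 1
          and f = "\<lambda>t. 2 * pi * \<i> * complex_of_real (g t)" and g = "\<lambda>t. 2 * pi * \<i> * complex_of_real (of_int (p \<theta>) + h \<theta> (\<gamma> t))"])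
      show "continuous_on {0..1} (\<lambda>t. 2 * pi * \<i> * complex_of_real (g t))" using gc by (intro continuous_intros)
      show "continuous_on {0..1} (\<lambda>t. 2 * pi * \<i> * complex_of_real (of_int (p \<theta>) + h \<theta> (\<gamma> t)))" using hc by (intro continuous_intros)
      show "exp (2 * pi * \<i> * complex_of_real (g t)) = exp (2 * pi * \<i> * complex_of_real (of_int (p \<theta>) + h \<theta> (\<gamma> t)))"
        if t: "t \<in> {0..1}" for t
      proof -
        have "exp (2 * pi * \<i> * complex_of_real (g t)) = exp (2 * pi * \<i> * complex_of_real (h \<theta> (\<gamma> t)))"
          using lift_exp(2)[OF lift xS(3)[OF t], of \<theta> "x t"] unfolding xS(4)[OF t] by (simp add: g_def h_def)
        moreover have "exp (2 * pi * \<i> * complex_of_real (of_int (p \<theta>) + h \<theta> (\<gamma> t))) =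
          exp (2 * pi * \<i> * complex_of_real (h \<theta> (\<gamma> t))) * exp (of_real (of_int (2 * p \<theta>) * pi) * \<i>)"
          by (simp add: exp_add[symmetric] algebra_simps)
        moreover have "exp (of_real (of_int (2 * p \<theta>) * pi) * \<i>) = 1" unfolding exp_eq_1 by auto
        ultimately show ?thesis by simp
      qed
      show "2 * pi * \<i> * complex_of_real (g 0) = 2 * pi * \<i> * complex_of_real (of_int (p \<theta>) + h \<theta> (\<gamma> 0))"
        using fg[of 0] p[of \<theta>] by (simp add: \<gamma>(2) d_def I_def)
    qed auto
    hence "g 1 = of_int (p \<theta>) + h \<theta> (\<gamma> 1)" by (rule two_pi_i_cancel)
    thus ?thesis using fg[of 1] by (simp add: \<gamma>(3))
  qed
  with pc show ?thesis unfolding h_def by blast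
qed

lemma cocycle_orbit:
  "(cocycle_map T (schrodinger_cocycle C f0 E) ^^ j) (\<theta>, mat 1) =
     ((T ^^ j) \<theta>, adjoint_mat (moebius_orbit C (potential \<theta>) (complex_of_real E) j)) \<and>
   moebius_orbit C (potential \<theta>) (complex_of_real E) j \<in> unitary_group"
proof (induction j)
  case 0
  show ?case by (simp add: unitary_group_def)
next
  case (Suc j)
  hence U: "moebius_orbit C (potential \<theta>) (complex_of_real E) j \<in> unitary_group" by simp
  have "symplectic_action (schrodinger_cocycle C f0 E ((T ^^ j) \<theta>)) (adjoint_mat (moebius_orbit C (potential \<theta>) (complex_of_real E) j)) =
    adjoint_mat (moebius_orbit C (potential \<theta>) (complex_of_real E) (Suc j))"
    using schrodinger_action[where ?f0.0 = f0 and \<theta> = "(T ^^ j) \<theta>", OF invertible_C hermitian_f0 adjoint_unitary[OF U]] by simp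
  moreover have "moebius_orbit C (potential \<theta>) (complex_of_real E) (Suc j) \<in> unitary_group"
    using moebius_unitary[OF invertible_C hermitian_f0 _ U] by simp
  ultimately show ?case using Suc by (simp add: cocycle_map_def)
qed

end

section \<open>From the mean phase to the rotation number\<close>

context stationary_family begin

text \<open>Above the real axis the sum is expressed through the Riccati iterates, which depend continuously on
  \<open>\<theta>\<close>.\<close>

lemma lift_sum_continuous_base:
  assumes s: "0 < s"
  shows "continuous_on UNIV (\<lambda>\<theta>. lift_sum C (potential \<theta>) (Complex E s) n)"
proof (cases n)
  case 0
  thus ?thesis by (simp add: lift_sum_def)
next
  case (Suc k)
  have "lift_sum C (potential \<theta>) (Complex E s) n = rotation_sum E s k \<theta> +
      Im (logdet (riccati C (orbit E s \<theta>) (orbit E s \<theta> 0) k + mat \<i>))" for \<theta>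
    unfolding Suc rotation_sum_def orbit_def by (rule lift_sum_Suc[OF invertible_C hermitian_f0 s])
  moreover have "continuous_on UNIV (\<lambda>\<theta>. rotation_sum E s k \<theta> +
      Im (logdet (riccati C (orbit E s \<theta>) (orbit E s \<theta> 0) k + mat \<i>)))"
    by (intro continuous_on_add continuous_on_Im continuous_on_logdet_compose continuous_rotation_sum continuous_on_riccati
        continuous_orbit continuous_on_const Upper_plus_i riccati_Upper orbit_Upper s)
  ultimately show ?thesis by simp
qed

lemma lift_sum_vertical_limit:
  assumes "0 \<le> s"
  shows "(\<lambda>k. lift_sum C (potential \<theta>) (Complex E (s + inverse (real (Suc k)))) n) \<longlonglongrightarrow> lift_sum C (potential \<theta>) (Complex E s) n"
proof (rule continuous_on_tendsto_compose[OF continuous_on_lift_sum[OF invertible_C hermitian_f0]])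
  show "(\<lambda>k. Complex E (s + inverse (real (Suc k)))) \<longlonglongrightarrow> Complex E s"
    by (intro tendsto_Complex tendsto_const LIMSEQ_inverse_real_of_nat_add)
qed (use assms in auto)

lemma lift_sum_bound_pos:
  assumes s: "0 < s"
  shows "\<bar>lift_sum C (potential \<theta>) (Complex E s) n\<bar> \<le> (real n + 2) * (2 * pi * CARD('m))"
proof -
  have "\<bar>lift_sum C (potential \<theta>) (Complex E s) n - rotation_sum E s n \<theta>\<bar> \<le> 4 * pi * CARD('m)"
    unfolding rotation_sum_def orbit_def by (rule lift_sum_close[OF invertible_C hermitian_f0 s])
  with rotation_sum_bound[OF s, of E n \<theta>] show ?thesis by (simp add: algebra_simps abs_le_iff)
qed

lemma lift_sum_bound:
  assumes "0 \<le> Im z"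
  shows "\<bar>lift_sum C (potential \<theta>) z n\<bar> \<le> (real n + 2) * (2 * pi * CARD('m))"
proof -
  have z: "Complex (Re z) (Im z) = z" by simp
  have l: "(\<lambda>k. \<bar>lift_sum C (potential \<theta>) (Complex (Re z) (Im z + inverse (real (Suc k)))) n\<bar>) \<longlonglongrightarrow> \<bar>lift_sum C (potential \<theta>) z n\<bar>"
    using lift_sum_vertical_limit[OF assms, of \<theta> "Re z" n] unfolding z by (rule tendsto_rabs)
  show ?thesis
  proof (rule LIMSEQ_le_const2[OF l], intro exI[of _ 0] allI impI)
    fix k
    show "\<bar>lift_sum C (potential \<theta>) (Complex (Re z) (Im z + inverse (real (Suc k)))) n\<bar> \<le> (real n + 2) * (2 * pi * CARD('m))"
      using assms by (intro lift_sum_bound_pos add_nonneg_pos) auto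
  qed
qed

text \<open>On the real axis the sum is a pointwise limit from above.\<close>

lemma lift_sum_measurable:
  assumes "0 \<le> Im z"
  shows "(\<lambda>\<theta>. lift_sum C (potential \<theta>) z n) \<in> borel_measurable M"
proof (rule borel_measurable_LIMSEQ_real)
  have z: "Complex (Re z) (Im z) = z" by simp
  show "(\<lambda>k. lift_sum C (potential \<theta>) (Complex (Re z) (Im z + inverse (real (Suc k)))) n) \<longlonglongrightarrow> lift_sum C (potential \<theta>) z n" for \<theta>
    using lift_sum_vertical_limit[OF assms, of \<theta> "Re z" n, unfolded z] .
  show "(\<lambda>\<theta>. lift_sum C (potential \<theta>) (Complex (Re z) (Im z + inverse (real (Suc k)))) n) \<in> borel_measurable M" for k
    using assms by (intro measurable_continuous lift_sum_continuous_base add_nonneg_pos) auto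
qed

definition mean_lift :: "complex \<Rightarrow> nat \<Rightarrow> real" where
  "mean_lift z n = (\<integral>\<theta>. lift_sum C (potential \<theta>) z n \<partial>M)"

lemma integrable_lift_sum:
  assumes "0 \<le> Im z" shows "integrable M (\<lambda>\<theta>. lift_sum C (potential \<theta>) z n)"
proof (rule integrable_const_bound[OF AE_I2 lift_sum_measurable[OF assms]])
  show "norm (lift_sum C (potential \<theta>) z n) \<le> (real n + 2) * (2 * pi * CARD('m))" for \<theta>
    unfolding real_norm_def by (rule lift_sum_bound[OF assms])
qed

lemma mean_lift_continuous:
  assumes "\<And>k. 0 \<le> Im (z k)" "z \<longlonglongrightarrow> w" "0 \<le> Im w"
  shows "(\<lambda>k. mean_lift (z k) n) \<longlonglongrightarrow> mean_lift w n"
  unfolding mean_lift_def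
proof (rule integral_dominated_convergence[where w = "\<lambda>_. (real n + 2) * (2 * pi * CARD('m))"])
  show "AE \<theta> in M. (\<lambda>k. lift_sum C (potential \<theta>) (z k) n) \<longlonglongrightarrow> lift_sum C (potential \<theta>) w n"
    by (intro AE_I2 continuous_on_tendsto_compose[OF continuous_on_lift_sum[OF invertible_C hermitian_f0] assms(2)])
       (use assms in auto)
  show "AE \<theta> in M. norm (lift_sum C (potential \<theta>) (z k) n) \<le> (real n + 2) * (2 * pi * CARD('m))" for k
    unfolding real_norm_def by (intro AE_I2 lift_sum_bound assms(1))
  show "integrable M (\<lambda>_. (real n + 2) * (2 * pi * CARD('m)))" by simp
qed (rule lift_sum_measurable assms(1,3))+

lemma mean_lift_close:
  assumes s: "0 < s"
  shows "\<bar>mean_lift (Complex E s) n - mean_rotation E s n\<bar> \<le> 4 * pi * CARD('m)"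
proof -
  define D where "D \<theta> = lift_sum C (potential \<theta>) (Complex E s) n - rotation_sum E s n \<theta>" for \<theta>
  have z: "0 \<le> Im (Complex E s)" using s by simp
  have i: "integrable M D"
    unfolding D_def by (rule Bochner_Integration.integrable_diff[OF integrable_lift_sum[OF z] integrable_rotation_sum[OF s]])
  have b: "\<bar>D \<theta>\<bar> \<le> 4 * pi * CARD('m)" for \<theta>
    unfolding D_def rotation_sum_def orbit_def by (rule lift_sum_close[OF invertible_C hermitian_f0 s])
  have "mean_lift (Complex E s) n - mean_rotation E s n = (\<integral>\<theta>. D \<theta> \<partial>M)"
    unfolding D_def mean_lift_def mean_rotation_def
    by (rule Bochner_Integration.integral_diff[OF integrable_lift_sum[OF z] integrable_rotation_sum[OF s], symmetric])
  also have "\<bar>\<dots>\<bar> \<le> (\<integral>\<theta>. \<bar>D \<theta>\<bar> \<partial>M)" by (rule integral_abs_bound)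
  also have "\<dots> \<le> (\<integral>\<theta>. 4 * pi * CARD('m) \<partial>M)" by (rule integral_mono[OF integrable_abs[OF i] _ b]) simp
  finally show ?thesis by (simp add: prob_space)
qed

lemma integrable_int_valued:
  fixes p :: "'t \<Rightarrow> int"
  assumes "continuous_on UNIV p"
  shows "continuous_on UNIV (\<lambda>\<theta>. real_of_int (p \<theta>))" "integrable M (\<lambda>\<theta>. real_of_int (p \<theta>))"
    and "\<exists>K. \<forall>\<theta>. \<bar>real_of_int (p \<theta>)\<bar> \<le> K"
proof -
  show c: "continuous_on UNIV (\<lambda>\<theta>. real_of_int (p \<theta>))"
    using assms by (intro continuous_on_of_int)
  have "compact (range (\<lambda>\<theta>. real_of_int (p \<theta>)))" by (rule compact_continuous_image[OF c compact_base])
  then obtain K where K: "\<And>\<theta>. \<bar>real_of_int (p \<theta>)\<bar> \<le> K" using compact_imp_bounded bounded_iff by (metis rangeI real_norm_def)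
  thus "\<exists>K. \<forall>\<theta>. \<bar>real_of_int (p \<theta>)\<bar> \<le> K" by blast
  show "integrable M (\<lambda>\<theta>. real_of_int (p \<theta>))" by (rule integrable_bounded_continuous[OF c K])
qed

text \<open>A continuous integer-valued function on a compact space is uniformly continuous, hence constant on all balls
  of some radius \<open>1/n\<close>, and is determined by its values at finitely many centres.\<close>

lemma countable_continuous_int: "countable {p :: 't \<Rightarrow> int. continuous_on UNIV p}"
proof -
  have "\<exists>F. finite F \<and> (UNIV :: 't set) \<subseteq> (\<Union>x\<in>F. ball x (inverse (real (Suc n))))" for n
  proof -
    have "0 < inverse (real (Suc n))" by simp
    with compact_eq_totally_bounded[THEN iffD1, OF compact_base, THEN conjunct2] show ?thesis by metis
  qed
  then obtain F where F: "\<And>n. finite (F n)" "\<And>n. (UNIV :: 't set) \<subseteq> (\<Union>x\<in>F n. ball x (inverse (real (Suc n))))" by metis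
  define P where "P n = {p :: 't \<Rightarrow> int. \<forall>x y. dist x y < inverse (real (Suc n)) \<longrightarrow> p x = p y}" for n
  have c: "countable (P n)" for n
  proof -
    obtain xs where xs: "set xs = F n" using finite_list[OF F(1)] by blast
    have "inj_on (\<lambda>p. map p xs) (P n)"
    proof (rule inj_onI, rule ext)
      fix p q y assume p: "p \<in> P n" and q: "q \<in> P n" and e: "map p xs = map q xs"
      obtain x where x: "x \<in> F n" "dist x y < inverse (real (Suc n))" using F(2)[of n] UNIV_I[of y] unfolding UN_iff mem_ball subset_iff by blast
      have "p x = q x" using e x(1) xs by simp
      moreover have "p x = p y" "q x = q y" using p q x(2) by (auto simp: P_def)
      ultimately show "p y = q y" by simp
    qed
    thus ?thesis using countable_image_inj_on[OF countableI_type] by blast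
  qed
  have "{p :: 't \<Rightarrow> int. continuous_on UNIV p} \<subseteq> (\<Union>n. P n)"
  proof
    fix p :: "'t \<Rightarrow> int" assume "p \<in> {p. continuous_on UNIV p}"
    hence "continuous_on UNIV (\<lambda>\<theta>. real_of_int (p \<theta>))" using integrable_int_valued(1) by blast
    hence "uniformly_continuous_on UNIV (\<lambda>\<theta>. real_of_int (p \<theta>))" using compact_base by (rule compact_uniformly_continuous)
    then obtain d where d: "d > 0" "\<And>x y. dist y x < d \<Longrightarrow> dist (real_of_int (p y)) (real_of_int (p x)) < 1"
      unfolding uniformly_continuous_on_def by (metis UNIV_I zero_less_one)
    obtain n where n: "inverse (real (Suc n)) < d" using reals_Archimedean[OF d(1)] by blast
    have "p x = p y" if "dist x y < inverse (real (Suc n))" for x y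
    proof -
      have "dist x y < d" using that n by linarith
      from d(2)[OF this] have "\<bar>real_of_int (p x - p y)\<bar> < 1" by (simp add: dist_real_def)
      thus ?thesis by linarith
    qed
    thus "p \<in> (\<Union>n. P n)" by (auto simp: P_def)
  qed
  thus ?thesis by (rule countable_subset) (intro countable_UN c countableI_type)
qed

lemma countable_integer_integrals: "countable (integer_integrals M)"
proof -
  have "integer_integrals M = (\<lambda>p. \<integral>\<theta>. real_of_int (p \<theta>) \<partial>M) ` {p. continuous_on UNIV p}"
    by (auto simp: integer_integrals_def)
  thus ?thesis using countable_continuous_int by simp
qed

text \<open>The defining limit holds almost everywhere; it is evaluated at \<open>W = 1\<close> and integrated. By
  \<open>lift_decomposition\<close> the integral is the mean of a continuous integer function, by invariance
  the same for all iterates, plus the mean of the lift.\<close>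

lemma rotation_number_mean_lift:
  assumes r: "r \<in> fibered_rotation_number M T (schrodinger_cocycle C f0 E)"
    and lim: "(\<lambda>n. mean_lift (complex_of_real E) n / real n) \<longlonglongrightarrow> pi * \<rho>"
  shows "\<rho> - r \<in> integer_integrals M"
proof -
  define cm where "cm = cocycle_map T (schrodinger_cocycle C f0 E)"
  obtain F f r0 where lift: "cocycle_lift T (schrodinger_cocycle C f0 E) F"
    and f: "\<And>\<theta> x S. S \<in> special_unitary_group \<Longrightarrow> f (covering_q (\<theta>, x, S)) = real CARD('m) * (fst (snd (F (\<theta>, x, S))) - x)"
    and ae: "AE \<theta> in M. \<forall>W\<in>unitary_group. (\<lambda>n. (\<Sum>j<n. f ((cm ^^ j) (\<theta>, W))) / real n) \<longlonglongrightarrow> r0"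
    and r0: "r - r0 \<in> integer_integrals M"
    using r unfolding fibered_rotation_number_def cm_def by blast
  obtain p :: "'t \<Rightarrow> int" where p: "continuous_on UNIV p" and fp: "\<And>\<theta> W. W \<in> unitary_group \<Longrightarrow>
     f (\<theta>, W) = of_int (p \<theta>) + Im (lift_log C (f0 \<theta>) (complex_of_real E, adjoint_mat W)) / pi"
    using lift_decomposition[OF lift f] by blast
  obtain q :: "'t \<Rightarrow> int" where q: "continuous_on UNIV q" and rq: "r - r0 = (\<integral>\<theta>. real_of_int (q \<theta>) \<partial>M)"
    using r0 by (auto simp: integer_integrals_def)
  note pr = integrable_int_valued[OF p]
  obtain K where K: "\<And>\<theta>. \<bar>real_of_int (p \<theta>)\<bar> \<le> K" using pr(3) by blast
  define P where "P = (\<integral>\<theta>. real_of_int (p \<theta>) \<partial>M)"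
  have fj: "f ((cm ^^ j) (\<theta>, mat 1)) = real_of_int (p ((T ^^ j) \<theta>)) +
     Im (lift_log C (potential \<theta> j) (complex_of_real E, moebius_orbit C (potential \<theta>) (complex_of_real E) j)) / pi" for \<theta> j
    unfolding cm_def using cocycle_orbit[where E = E and j = j and \<theta> = \<theta>] fp[OF adjoint_unitary] by simp
  define s where "s n \<theta> = (\<Sum>j<n. real_of_int (p ((T ^^ j) \<theta>))) / real n + lift_sum C (potential \<theta>) (complex_of_real E) n / pi / real n" for n \<theta>
  have s: "(\<Sum>j<n. f ((cm ^^ j) (\<theta>, mat 1))) / real n = s n \<theta>" for n \<theta>
    unfolding fj s_def lift_sum_def by (simp add: sum.distrib add_divide_distrib sum_divide_distrib)
  have I: "(mat 1 :: complex^'m^'m) \<in> unitary_group" by (simp add: unitary_group_def)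
  have pc: "continuous_on UNIV (\<lambda>\<theta>. real_of_int (p ((T ^^ j) \<theta>)))" for j
    by (rule continuous_on_compose2[OF pr(1) continuous_iterate(1)]) auto
  have pi': "integrable M (\<lambda>\<theta>. real_of_int (p ((T ^^ j) \<theta>)))" for j
    by (rule integrable_bounded_continuous[OF pc K])
  have li: "integrable M (\<lambda>\<theta>. lift_sum C (potential \<theta>) (complex_of_real E) n)" for n by (rule integrable_lift_sum) simp
  have int: "(\<integral>\<theta>. s n \<theta> \<partial>M) = P + mean_lift (complex_of_real E) n / real n / pi" if n: "n > 0" for n
  proof -
    have P: "(\<integral>\<theta>. real_of_int (p ((T ^^ j) \<theta>)) \<partial>M) = P" for j
      unfolding P_def by (rule integral_iterate[OF measurable_continuous[OF pr(1)]])
    have "(\<integral>\<theta>. s n \<theta> \<partial>M) = (\<Sum>j<n. \<integral>\<theta>. real_of_int (p ((T ^^ j) \<theta>)) \<partial>M) / real n + mean_lift (complex_of_real E) n / pi / real n"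
      unfolding s_def using pi' li by (simp add: Bochner_Integration.integral_add Bochner_Integration.integral_sum mean_lift_def)
    thus ?thesis using n by (simp add: P field_simps)
  qed
  have "(\<lambda>n. \<integral>\<theta>. s n \<theta> \<partial>M) \<longlonglongrightarrow> (\<integral>\<theta>. r0 \<partial>M)"
  proof (rule integral_dominated_convergence[where w = "\<lambda>_. K + 3 * (2 * pi * CARD('m)) / pi"])
    show "AE \<theta> in M. (\<lambda>n. s n \<theta>) \<longlonglongrightarrow> r0"
      using ae by eventually_elim (use I in \<open>simp add: s[symmetric]\<close>)
    show "s n \<in> borel_measurable M" for n
      unfolding s_def[abs_def]
      by (intro borel_measurable_add borel_measurable_divide borel_measurable_sum borel_measurable_const
          measurable_continuous[OF pc] lift_sum_measurable) simp
    show "AE \<theta> in M. norm (s n \<theta>) \<le> K + 3 * (2 * pi * CARD('m)) / pi" for n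
    proof (rule AE_I2)
      fix \<theta>
      have K0: "0 \<le> K" using K[of \<theta>] by linarith
      show "norm (s n \<theta>) \<le> K + 3 * (2 * pi * CARD('m)) / pi"
      proof (cases "n = 0")
        case True
        thus ?thesis using K0 by (simp add: s_def)
      next
        case False
        hence n: "1 \<le> real n" by simp
        have "\<bar>\<Sum>j<n. real_of_int (p ((T ^^ j) \<theta>))\<bar> \<le> (\<Sum>j<n. K)"
          by (rule order_trans[OF sum_abs]) (intro sum_mono K)
        hence 1: "\<bar>(\<Sum>j<n. real_of_int (p ((T ^^ j) \<theta>))) / real n\<bar> \<le> K" using n by (simp add: divide_le_eq mult.commute)
        have "\<bar>lift_sum C (potential \<theta>) (complex_of_real E) n\<bar> \<le> (real n + 2) * (2 * pi * CARD('m))"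
          by (rule lift_sum_bound) simp
        also have "\<dots> \<le> (3 * real n) * (2 * pi * CARD('m))" using n by (intro mult_right_mono) auto
        finally have "\<bar>lift_sum C (potential \<theta>) (complex_of_real E) n\<bar> / pi / real n \<le> (3 * real n) * (2 * pi * CARD('m)) / pi / real n"
          by (intro divide_right_mono) auto
        also have "\<dots> = 3 * (2 * pi * CARD('m)) / pi" using n by simp
        finally have 2: "\<bar>lift_sum C (potential \<theta>) (complex_of_real E) n / pi / real n\<bar> \<le> 3 * (2 * pi * CARD('m)) / pi"
          by (simp add: abs_divide)
        show ?thesis unfolding s_def real_norm_def by (rule order_trans[OF abs_triangle_ineq add_mono[OF 1 2]])
      qed
    qed
  qed auto
  hence "(\<lambda>n. \<integral>\<theta>. s n \<theta> \<partial>M) \<longlonglongrightarrow> r0" by (simp add: prob_space)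
  moreover have "(\<lambda>n. \<integral>\<theta>. s n \<theta> \<partial>M) \<longlonglongrightarrow> P + pi * \<rho> / pi"
  proof (rule Lim_transform_eventually)
    show "(\<lambda>n. P + mean_lift (complex_of_real E) n / real n / pi) \<longlonglongrightarrow> P + pi * \<rho> / pi"
      by (intro tendsto_intros lim) simp
    show "\<forall>\<^sub>F n in sequentially. P + mean_lift (complex_of_real E) n / real n / pi = (\<integral>\<theta>. s n \<theta> \<partial>M)"
      using eventually_gt_at_top[of 0] by eventually_elim (simp add: int)
  qed
  ultimately have "r0 = P + \<rho>" using LIMSEQ_unique by fastforce
  have pq: "continuous_on UNIV (\<lambda>\<theta>. real_of_int (- p \<theta> - q \<theta>))"
    using pr(1) integrable_int_valued(1)[OF q] by (simp add: continuous_on_diff continuous_on_minus)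
  have "\<rho> - r = - P - (\<integral>\<theta>. real_of_int (q \<theta>) \<partial>M)" using rq \<open>r0 = P + \<rho>\<close> by simp
  also have "\<dots> = (\<integral>\<theta>. real_of_int (- p \<theta> - q \<theta>) \<partial>M)"
    using pr(2) integrable_int_valued(2)[OF q] by (simp add: P_def)
  finally show ?thesis
    unfolding integer_integrals_def mem_Collect_eq
    using continuous_int_valued[OF pq] by (intro exI[of _ "\<lambda>\<theta>. - p \<theta> - q \<theta>"]) simp
qed

end

context density_family begin

text \<open>The limit of \<open>mean_arg / pi\<close> at the real axis. An atom at \<open>E\<close> counts one half, since
  the argument at \<open>x = E\<close> is \<open>pi/2\<close>.\<close>

definition rho :: "real \<Rightarrow> real" where
  "rho E = real CARD('m) * (measure dk {E<..} + measure dk {E} / 2)"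

lemma mean_arg_limit: "(\<lambda>n. mean_arg E (inverse (real (Suc n)))) \<longlonglongrightarrow> pi * rho E"
proof -
  interpret k: prob_space dk by (rule prob_k)
  define a where "a x = pi * indicator {E<..} x + pi / 2 * indicator {E} x" for x :: real
  have m: "{E<..} \<in> sets dk" "{E} \<in> sets dk" by (simp_all add: sets_k)
  have "(\<lambda>n. \<integral>x. arg_shift E (inverse (real (Suc n))) x \<partial>dk) \<longlonglongrightarrow> (\<integral>x. a x \<partial>dk)"
  proof (rule integral_dominated_convergence[where w = "\<lambda>_. pi"])
    show "a \<in> borel_measurable dk" unfolding a_def using m by simp
    show "arg_shift E (inverse (real (Suc n))) \<in> borel_measurable dk" for n
      using arg_shift_measurable[of "inverse (real (Suc n))" E] measurable_cong_sets[OF sets_k refl] by auto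
    show "AE x in dk. norm (arg_shift E (inverse (real (Suc n))) x) \<le> pi" for n
    proof (rule AE_I2)
      show "norm (arg_shift E (inverse (real (Suc n))) x) \<le> pi" for x
        using arg_shift_bounds[of "inverse (real (Suc n))" E x] pi_gt_zero by (simp add: abs_le_iff del: of_nat_Suc)
    qed
    show "AE x in dk. (\<lambda>n. arg_shift E (inverse (real (Suc n))) x) \<longlonglongrightarrow> a x"
    proof (rule AE_I2)
      fix x
      have l: "(\<lambda>n. Complex E (inverse (real (Suc n))) - of_real x) \<longlonglongrightarrow> Complex E 0 - of_real x"
        by (intro tendsto_intros tendsto_Complex LIMSEQ_inverse_real_of_nat)
      consider "x < E" | "x = E" | "x > E" by linarith
      thus "(\<lambda>n. arg_shift E (inverse (real (Suc n))) x) \<longlonglongrightarrow> a x"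
      proof cases
        case 1
        have "Complex E 0 - of_real x = of_real (E - x)" by (simp add: complex_eq_iff)
        moreover have "complex_of_real (E - x) \<notin> \<real>\<^sub>\<le>\<^sub>0" using 1 by (simp add: complex_nonpos_Reals_iff)
        ultimately have "(\<lambda>n. arg_shift E (inverse (real (Suc n))) x) \<longlonglongrightarrow> Im (Ln (of_real (E - x)))"
          unfolding arg_shift_def using l by (intro tendsto_Im tendsto_Ln) simp_all
        moreover have "Im (Ln (of_real (E - x))) = 0" using 1 by (subst Ln_of_real) auto
        ultimately show ?thesis using 1 by (simp add: a_def)
      next
        case 2
        have "arg_shift E (inverse (real (Suc n))) x = pi / 2" for n
        proof -
          define r where "r = inverse (real (Suc n))"
          have r: "0 < r" by (simp add: r_def)
          have "Complex E r - of_real x = of_real r * \<i>" by (simp add: 2 complex_eq_iff)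
          hence "arg_shift E r x = pi / 2" using Ln_times_of_real[OF r, of \<i>] r by (simp add: arg_shift_def)
          thus ?thesis by (simp only: r_def)
        qed
        moreover have "a x = pi / 2" using 2 by (simp add: a_def)
        ultimately show ?thesis by (simp only: tendsto_const)
      next
        case 3
        have e: "arg_shift E (inverse (real (Suc n))) x = Im (Ln (- (Complex E (inverse (real (Suc n))) - of_real x))) + pi" for n
        proof -
          define w where "w = Complex E (inverse (real (Suc n))) - of_real x"
          have i: "0 < Im w" by (simp add: w_def)
          hence "w \<noteq> 0" by auto
          from Ln_minus[OF this] i have "Ln (- w) = Ln w - \<i> * pi" by simp
          hence "Im (Ln w) = Im (Ln (- w)) + pi" by simp
          thus ?thesis unfolding arg_shift_def w_def .
        qed
        have "- (Complex E 0 - of_real x) = of_real (x - E)" by (simp add: complex_eq_iff)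
        moreover have "complex_of_real (x - E) \<notin> \<real>\<^sub>\<le>\<^sub>0" using 3 by (simp add: complex_nonpos_Reals_iff)
        ultimately have "(\<lambda>n. Im (Ln (- (Complex E (inverse (real (Suc n))) - of_real x))) + pi) \<longlonglongrightarrow> Im (Ln (of_real (x - E))) + pi"
          using tendsto_minus[OF l] by (intro tendsto_add tendsto_const tendsto_Im tendsto_Ln) simp_all
        moreover have "Im (Ln (of_real (x - E))) = 0" using 3 by (subst Ln_of_real) auto
        moreover have "a x = pi" using 3 by (simp add: a_def)
        ultimately show ?thesis unfolding e by (simp only: add_0_left)
      qed
    qed
  qed auto
  moreover have "(\<integral>x. a x \<partial>dk) = pi * measure dk {E<..} + pi / 2 * measure dk {E}"
    unfolding a_def using m by (simp add: k.emeasure_eq_measure)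
  ultimately have "(\<lambda>n. real CARD('m) * (\<integral>x. arg_shift E (inverse (real (Suc n))) x \<partial>dk)) \<longlonglongrightarrow>
     real CARD('m) * (pi * measure dk {E<..} + pi / 2 * measure dk {E})" by (intro tendsto_mult_left) simp
  thus ?thesis unfolding mean_arg_def rho_def by (simp add: algebra_simps)
qed

text \<open>The sum of the two errors \<open>4 pi m\<close>, which does not depend on the height above the real axis.\<close>

lemma mean_lift_rate: "\<bar>mean_lift (complex_of_real E) n - real n * (pi * rho E)\<bar> \<le> 8 * pi * CARD('m)"
proof -
  define \<epsilon> where "\<epsilon> i = inverse (real (Suc i))" for i
  have \<epsilon>: "0 < \<epsilon> i" for i by (simp add: \<epsilon>_def)
  have l\<epsilon>: "\<epsilon> \<longlonglongrightarrow> 0" unfolding \<epsilon>_def by (rule LIMSEQ_inverse_real_of_nat)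
  have "(\<lambda>i. Complex E (\<epsilon> i)) \<longlonglongrightarrow> Complex E 0" by (intro tendsto_Complex tendsto_const l\<epsilon>)
  hence "(\<lambda>i. Complex E (\<epsilon> i)) \<longlonglongrightarrow> complex_of_real E" by (simp add: complex_of_real_def)
  hence "(\<lambda>i. mean_lift (Complex E (\<epsilon> i)) n) \<longlonglongrightarrow> mean_lift (complex_of_real E) n"
    by (rule mean_lift_continuous[rotated]) (use \<epsilon> in \<open>auto intro: less_imp_le\<close>)
  moreover have "(\<lambda>i. real n * mean_arg E (\<epsilon> i)) \<longlonglongrightarrow> real n * (pi * rho E)"
    unfolding \<epsilon>_def by (intro tendsto_mult_left mean_arg_limit)
  ultimately have "(\<lambda>i. \<bar>mean_lift (Complex E (\<epsilon> i)) n - real n * mean_arg E (\<epsilon> i)\<bar>) \<longlonglongrightarrow> \<bar>mean_lift (complex_of_real E) n - real n * (pi * rho E)\<bar>"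
    by (intro tendsto_rabs tendsto_diff)
  moreover have "\<bar>mean_lift (Complex E (\<epsilon> i)) n - real n * mean_arg E (\<epsilon> i)\<bar> \<le> 8 * pi * CARD('m)" for i
    using mean_lift_close[OF \<epsilon>[of i], of E n] mean_rotation_rate[OF \<epsilon>[of i], of E n] by (simp add: abs_le_iff)
  ultimately show ?thesis by (intro LIMSEQ_le_const2) auto
qed

lemma mean_lift_limit: "(\<lambda>n. mean_lift (complex_of_real E) n / real n) \<longlonglongrightarrow> pi * rho E"
proof -
  have "(\<lambda>n. mean_lift (complex_of_real E) n / real n - pi * rho E) \<longlonglongrightarrow> 0"
  proof (rule Lim_null_comparison)
    show "(\<lambda>n. 8 * pi * CARD('m) / real n) \<longlonglongrightarrow> 0" by (rule lim_const_over_n)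
    show "\<forall>\<^sub>F n in sequentially. norm (mean_lift (complex_of_real E) n / real n - pi * rho E) \<le> 8 * pi * CARD('m) / real n"
      using eventually_gt_at_top[of 0]
    proof eventually_elim
      case (elim n)
      have "mean_lift (complex_of_real E) n / real n - pi * rho E = (mean_lift (complex_of_real E) n - real n * (pi * rho E)) / real n"
        using elim by (simp add: diff_divide_distrib)
      also have "norm \<dots> = \<bar>mean_lift (complex_of_real E) n - real n * (pi * rho E)\<bar> / real n" by simp
      also have "\<dots> \<le> 8 * pi * CARD('m) / real n" by (intro divide_right_mono mean_lift_rate) simp
      finally show ?case .
    qed
  qed
  thus ?thesis by (simp add: LIM_zero_iff)
qed

text \<open>For fixed \<open>n\<close> the mean lift is continuous in \<open>E\<close> and is \<open>n pi rho\<close> up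
  to a constant. So the oscillation of \<open>rho\<close> at a point is \<open>O(1/n)\<close> for every
  \<open>n\<close>.\<close>

lemma rho_sequentially_continuous:
  assumes "X \<longlonglongrightarrow> E" shows "(\<lambda>i. rho (X i)) \<longlonglongrightarrow> rho E"
proof -
  have "(\<lambda>i. pi * rho (X i)) \<longlonglongrightarrow> pi * rho E"
  proof (rule LIMSEQ_I)
    fix r :: real assume r: "0 < r"
    obtain n :: nat where n: "16 * pi * CARD('m) / (r/2) < real n" using reals_Archimedean2 by blast
    moreover have "0 \<le> 16 * pi * CARD('m) / (r/2)" using r by simp
    ultimately have n0: "0 < real n" by linarith
    have nr: "16 * pi * CARD('m) < real n * (r/2)" using n r by (simp add: field_simps)
    have "(\<lambda>i. complex_of_real (X i)) \<longlonglongrightarrow> complex_of_real E" using assms by (rule tendsto_of_real)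
    from mean_lift_continuous[OF _ this, of n] have
      "(\<lambda>i. mean_lift (complex_of_real (X i)) n) \<longlonglongrightarrow> mean_lift (complex_of_real E) n" by simp
    from LIMSEQ_D[OF this, of "real n * (r/2)"] n0 r obtain N where N:
      "\<And>i. i \<ge> N \<Longrightarrow> \<bar>mean_lift (complex_of_real (X i)) n - mean_lift (complex_of_real E) n\<bar> < real n * (r/2)" by auto
    have "norm (pi * rho (X i) - pi * rho E) < r" if i: "i \<ge> N" for i
    proof -
      have "\<bar>real n * (pi * rho (X i)) - real n * (pi * rho E)\<bar> < real n * r"
      proof -
        have tri: "\<bar>u - v\<bar> \<le> \<bar>A - u\<bar> + \<bar>A - B\<bar> + \<bar>B - v\<bar>" for u v A B :: real by arith
        have "real n * (r/2) + real n * (r/2) = real n * r" by (simp add: field_simps)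
        with tri[of "real n * (pi * rho (X i))" "real n * (pi * rho E)" "mean_lift (complex_of_real (X i)) n" "mean_lift (complex_of_real E) n"]
          N[OF i] mean_lift_rate[of "X i" n] mean_lift_rate[of E n] nr
        show ?thesis by linarith
      qed
      hence "real n * \<bar>pi * rho (X i) - pi * rho E\<bar> < real n * r"
        using n0 by (simp add: abs_mult flip: right_diff_distrib)
      thus ?thesis using n0 by simp
    qed
    thus "\<exists>no. \<forall>i\<ge>no. norm (pi * rho (X i) - pi * rho E) < r" by blast
  qed
  from tendsto_divide[OF this tendsto_const[of pi]] show ?thesis by simp
qed

text \<open>At points \<open>X i\<close> decreasing to \<open>E\<close> the values of \<open>rho\<close> tend to
  \<open>m k(E,\<infinity>)\<close>, which misses half of the atom at \<open>E\<close>.\<close>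

lemma no_atoms: "measure dk {E} = 0"
proof -
  interpret k: prob_space dk by (rule prob_k)
  define X where "X i = E + inverse (real (Suc i))" for i
  have X: "X \<longlonglongrightarrow> E" unfolding X_def by (rule LIMSEQ_inverse_real_of_nat_add)
  have XE: "E < X i" for i by (simp add: X_def)
  have s: "A \<in> sets borel \<Longrightarrow> A \<in> sets dk" for A by (simp add: sets_k)
  have "(\<lambda>i. measure dk {X i<..}) \<longlonglongrightarrow> measure dk (\<Union>i. {X i<..})"
  proof (rule k.finite_Lim_measure_incseq)
    show "range (\<lambda>i. {X i<..}) \<subseteq> sets dk" by (auto simp: sets_k)
    show "incseq (\<lambda>i. {X i<..})"
    proof (rule incseq_SucI)
      fix i
      have "X (Suc i) \<le> X i" by (simp add: X_def frac_le inverse_eq_divide)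
      thus "{X i<..} \<subseteq> {X (Suc i)<..}" by auto
    qed
  qed
  also have "(\<Union>i. {X i<..}) = {E<..}"
  proof (intro equalityI subsetI)
    fix x assume "x \<in> {E<..}"
    hence "\<forall>\<^sub>F i in sequentially. X i < x" using X by (intro order_tendstoD) auto
    then obtain i where "X i < x" by (auto simp: eventually_sequentially)
    thus "x \<in> (\<Union>i. {X i<..})" by auto
  next
    fix x assume "x \<in> (\<Union>i. {X i<..})"
    then obtain i where "X i < x" by auto
    thus "x \<in> {E<..}" using XE[of i] by simp
  qed
  finally have l1: "(\<lambda>i. measure dk {X i<..}) \<longlonglongrightarrow> measure dk {E<..}" .
  \<comment> \<open>The points of \<open>X\<close> may be atoms themselves, but their mass is squeezed out of \<open>{E<..}\<close>.\<close>
  have l2: "(\<lambda>i. measure dk {X i}) \<longlonglongrightarrow> 0"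
  proof (rule tendsto_sandwich[where f = "\<lambda>_. 0" and h = "\<lambda>i. measure dk {E<..} - measure dk {X i<..}"])
    have "measure dk {X i} + measure dk {X i<..} \<le> measure dk {E<..}" for i
    proof -
      have "measure dk {X i} + measure dk {X i<..} = measure dk ({X i} \<union> {X i<..})"
        by (rule k.finite_measure_Union[symmetric]) (auto intro: s)
      also have "\<dots> \<le> measure dk {E<..}" using XE[of i] by (intro k.finite_measure_mono s) auto
      finally show ?thesis .
    qed
    thus "\<forall>\<^sub>F i in sequentially. measure dk {X i} \<le> measure dk {E<..} - measure dk {X i<..}"
      by (intro always_eventually allI) (simp add: algebra_simps)
    show "(\<lambda>i. measure dk {E<..} - measure dk {X i<..}) \<longlonglongrightarrow> 0" using tendsto_diff[OF tendsto_const l1, of "measure dk {E<..}"] by simp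
  qed auto
  have "(\<lambda>i. rho (X i)) \<longlonglongrightarrow> real CARD('m) * (measure dk {E<..} + 0 / 2)"
    unfolding rho_def by (intro tendsto_intros l1 l2) simp
  from LIMSEQ_unique[OF this rho_sequentially_continuous[OF X]] show ?thesis by (simp add: rho_def)
qed

lemma rho_eq: "rho E = real CARD('m) * (1 - measure dk {..E})"
proof -
  interpret k: prob_space dk by (rule prob_k)
  have "measure dk (space dk - {..E}) = 1 - measure dk {..E}" by (rule k.prob_compl) (simp add: sets_k)
  moreover have "space dk - {..E} = {E<..}" by (auto simp: space_k)
  ultimately show ?thesis by (simp add: rho_def no_atoms)
qed

end

theorem theorem1p7:
  fixes T :: "'t::metric_space \<Rightarrow> 't"
    and M :: "'t measure"
    and C :: "complex^'m^'m"
    and f0 :: "'t \<Rightarrow> complex^'m^'m"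
    and k :: "real measure"
    and rot :: "real \<Rightarrow> real"
  assumes "compact (UNIV :: 't set)"
    and "homeomorphism UNIV UNIV T (inv T)"
    and "ergodic_measure T M"
    and "invertible C"
    and "continuous_on UNIV f0"
    and "\<And>\<theta>. hermitian (f0 \<theta>)"
    and "density_of_states M (schrodinger_operator T C f0) k"
    and "fibered_rotation_function M T (schrodinger_cocycle C f0) rot"
  shows "\<exists>c\<in>integer_integrals M. \<forall>E. real CARD('m) * (1 - measure k {..E}) = rot E + c"
proof -
  obtain \<Phi> where k: "sets k = sets borel"
    and \<Phi>: "\<And>\<theta>. borel_functional_calculus (schrodinger_operator T C f0 \<theta>) (\<Phi> \<theta>)"
    and dos: "\<And>g. g \<in> bounded_borel \<Longrightarrow> (\<integral>x. g x \<partial>k) =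
           (\<integral>\<theta>. (1 / of_nat CARD('m)) * (\<Sum>i\<in>UNIV. ell2_inner (delta0 i) (\<Phi> \<theta> g (delta0 i))) \<partial>M)"
    using assms(7) unfolding density_of_states_def by blast
  interpret density_family T M C f0 k \<Phi>
  proof (rule density_family.intro[OF stationary_family.intro density_family_axioms.intro])
    show "prob_space M" "sets M = sets borel" "distr M M T = M"
      using assms(3) unfolding ergodic_measure_def by blast+
  qed (rule assms k \<Phi> dos; assumption)+
  define D where "D E = rho E - rot E" for E
  have G: "D E \<in> integer_integrals M" for E
    unfolding D_def using assms(8) unfolding fibered_rotation_function_def
    by (intro rotation_number_mean_lift[OF _ mean_lift_limit]) blast
  have "continuous_on UNIV rho"
    unfolding continuous_on_sequentially using rho_sequentially_continuous by (simp add: o_def)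
  hence "continuous_on UNIV D"
    unfolding D_def using assms(8) by (intro continuous_intros) (auto simp: fibered_rotation_function_def)
  \<comment> \<open>A connected set of reals with two points is uncountable.\<close>
  hence conn: "connected (range D)" by (rule connected_continuous_image) simp
  have "countable (range D)" using G by (intro countable_subset[OF _ countable_integer_integrals]) auto
  hence "D E = D 0" for E using connected_uncountable[OF conn] by blast
  hence "\<forall>E. real CARD('m) * (1 - measure k {..E}) = rot E + D 0"
    unfolding rho_eq[symmetric] by (metis D_def add.commute diff_add_cancel)
  with G show ?thesis by blast
qed

end
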